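(* Let $G=(V,E)$ be a finite, connected, loop-free directed multigraph with positive vertex weight $\nu:V\to\mathbb{R}^+$. Then there is a parameter $m\in\mathbb{N}$ with $m\le(\Delta(G)-1)|V|-|E|+1$, which can be determined in time $\mathcal{O}(\Delta(G)^3|V|^3)$, and an algorithm with running time $\mathcal{O}(2^m\Delta(G)^4|V|^4\log|E|)$ solving the weighted feedback vertex set problem on $(G,\nu)$.
   Context: $\Delta(G)$ is the maximal degree (in-degree plus out-degree) of a vertex of $G$. Weighted feedback vertex set problem on $(G,\nu)$: find $U\subseteq V$ such that deleting $U$ (with all incident arcs) leaves a graph with no directed cycle and $\sum_{v\in U}\nu(v)$ is minimal. *)

theory Defs
  imports
    Complex_Main
    "HOL-Library.Landau_Symbols"
    "Graph_Theory.Digraph_Component"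
begin

section \<open>The weighted feedback vertex set problem\<close>

definition max_degree :: "('a, 'b) pre_digraph \<Rightarrow> nat" where
  "max_degree G = Max ((\<lambda>v. in_degree G v + out_degree G v) ` verts G)"

definition feedback_vertex_set :: "('a, 'b) pre_digraph \<Rightarrow> 'a set \<Rightarrow> bool" where
  "feedback_vertex_set G U \<longleftrightarrow>
     U \<subseteq> verts G \<and> \<not> (\<exists>c. pre_digraph.cycle (G \<restriction> (verts G - U)) c)"

definition min_feedback_vertex_set ::
    "('a, 'b) pre_digraph \<Rightarrow> ('a \<Rightarrow> real) \<Rightarrow> 'a set \<Rightarrow> bool" where
  "min_feedback_vertex_set G \<nu> U \<longleftrightarrow>
     feedback_vertex_set G U \<and>
     (\<forall>U'. feedback_vertex_set G U' \<longrightarrow> (\<Sum>v\<in>U. \<nu> v) \<le> (\<Sum>v\<in>U'. \<nu> v))"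

text \<open>
  \<open>Digraph_Component.connected\<close> is connectedness of the underlying undirected graph; it
  includes that there is at least one vertex.
\<close>

definition fvs_problem :: "('a, 'b) pre_digraph \<Rightarrow> ('a \<Rightarrow> real) \<Rightarrow> bool" where
  "fvs_problem G \<nu> \<longleftrightarrow>
     fin_digraph G \<and> loopfree_digraph G \<and> Digraph_Component.connected G \<and>
     (\<forall>v\<in>verts G. 0 < \<nu> v)"


section \<open>Algorithms and their running time\<close>

text \<open>
  Algorithms are programs of a structured random access machine with unit costs. The memory
  consists of named, unbounded arrays of natural numbers and of named, unbounded arrays of real
  numbers, with indirect addressing; a scalar variable is a cell with index \<open>0\<close>. Two restrictions
  keep the unit cost measure reasonable: there is no multiplication, so a number grows by at most
  a constant number of bits per step, and reals can only be copied, added, subtracted and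
  compared (no real constants, no rounding), so that neither a real number nor the program
  text can smuggle in an oracle.
\<close>

record memory =
  nats :: "string \<Rightarrow> nat \<Rightarrow> nat"
  reals :: "string \<Rightarrow> nat \<Rightarrow> real"

datatype nat_expr =
    NConst nat
  | NGet string nat_expr
  | NAdd nat_expr nat_expr
  | NSub nat_expr nat_expr

datatype real_expr =
    RGet string nat_expr
  | RAdd real_expr real_expr
  | RSub real_expr real_expr

datatype bool_expr =
    NLess nat_expr nat_expr
  | RLess real_expr real_expr
  | BNot bool_expr
  | BAnd bool_expr bool_expr

datatype program =
    Skip
  | NSet string nat_expr nat_expr
  | RSet string nat_expr real_expr
  | Seq program program
  | Cond bool_expr program program
  | While bool_expr program

text \<open>Subtraction of natural numbers is truncated at \<open>0\<close>.\<close>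

primrec nval :: "nat_expr \<Rightarrow> memory \<Rightarrow> nat" where
  "nval (NConst k) s = k"
| "nval (NGet x i) s = nats s x (nval i s)"
| "nval (NAdd a b) s = nval a s + nval b s"
| "nval (NSub a b) s = nval a s - nval b s"

primrec rval :: "real_expr \<Rightarrow> memory \<Rightarrow> real" where
  "rval (RGet x i) s = reals s x (nval i s)"
| "rval (RAdd a b) s = rval a s + rval b s"
| "rval (RSub a b) s = rval a s - rval b s"

primrec bval :: "bool_expr \<Rightarrow> memory \<Rightarrow> bool" where
  "bval (NLess a b) s \<longleftrightarrow> nval a s < nval b s"
| "bval (RLess a b) s \<longleftrightarrow> rval a s < rval b s"
| "bval (BNot b) s \<longleftrightarrow> \<not> bval b s"
| "bval (BAnd b c) s \<longleftrightarrow> bval b s \<and> bval c s"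

definition nset :: "string \<Rightarrow> nat \<Rightarrow> nat \<Rightarrow> memory \<Rightarrow> memory" where
  "nset x i v s = s\<lparr>nats := (nats s)(x := (nats s x)(i := v))\<rparr>"

definition rset :: "string \<Rightarrow> nat \<Rightarrow> real \<Rightarrow> memory \<Rightarrow> memory" where
  "rset x i v s = s\<lparr>reals := (reals s)(x := (reals s x)(i := v))\<rparr>"

text \<open>
  \<open>runs P s t s'\<close>: started in memory \<open>s\<close>, the program \<open>P\<close> terminates after \<open>t\<close> steps in memory \<open>s'\<close>.
  Every executed assignment and every evaluated test counts as one step. Since the size of the
  expressions in a fixed program is bounded, counting the individual operations would change
  the time only by a constant factor.
\<close>

inductive runs :: "program \<Rightarrow> memory \<Rightarrow> nat \<Rightarrow> memory \<Rightarrow> bool" where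
  Skip: "runs Skip s 1 s"
| NSet: "runs (NSet x i a) s 1 (nset x (nval i s) (nval a s) s)"
| RSet: "runs (RSet x i a) s 1 (rset x (nval i s) (rval a s) s)"
| Seq: "runs P s t s' \<Longrightarrow> runs Q s' u s'' \<Longrightarrow> runs (Seq P Q) s (t + u) s''"
| CondT: "bval b s \<Longrightarrow> runs P s t s' \<Longrightarrow> runs (Cond b P Q) s (1 + t) s'"
| CondF: "\<not> bval b s \<Longrightarrow> runs Q s t s' \<Longrightarrow> runs (Cond b P Q) s (1 + t) s'"
| WhileF: "\<not> bval b s \<Longrightarrow> runs (While b P) s 1 s"
| WhileT: "bval b s \<Longrightarrow> runs P s t s' \<Longrightarrow> runs (While b P) s' u s'' \<Longrightarrow>
           runs (While b P) s (1 + t + u) s''"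

inductive_cases runs_SkipE: "runs Skip s t s'"
inductive_cases runs_NSetE: "runs (NSet x i a) s t s'"
inductive_cases runs_RSetE: "runs (RSet x i a) s t s'"
inductive_cases runs_SeqE: "runs (Seq P Q) s t s'"
inductive_cases runs_CondE: "runs (Cond b P Q) s t s'"
inductive_cases runs_WhileE: "runs (While b P) s t s'"

lemma runs_deterministic:
  "runs P s t s' \<Longrightarrow> runs P s u s'' \<Longrightarrow> t = u \<and> s' = s''"
proof (induction arbitrary: u s'' rule: runs.induct)
  case (Skip s)
  then show ?case by (rule runs_SkipE) simp
next
  case (NSet x i a s)
  then show ?case by (rule runs_NSetE) simp
next
  case (RSet x i a s)
  then show ?case by (rule runs_RSetE) simp
next
  case (Seq P s t s1 Q v s2)
  from Seq.prems obtain t' v' s1' where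
    "runs P s t' s1'" "runs Q s1' v' s''" "u = t' + v'" by (rule runs_SeqE)
  with Seq.IH show ?case by metis
next
  case (CondT b s P t s1 Q)
  from CondT.prems obtain t' where "runs P s t' s''" "u = 1 + t'"
    using CondT.hyps(1) by (rule_tac runs_CondE) auto
  with CondT.IH show ?case by metis
next
  case (CondF b s Q t s1 P)
  from CondF.prems obtain t' where "runs Q s t' s''" "u = 1 + t'"
    using CondF.hyps(1) by (rule_tac runs_CondE) auto
  with CondF.IH show ?case by metis
next
  case (WhileF b s P)
  from WhileF.prems show ?case by (rule runs_WhileE) (use WhileF.hyps in simp_all)
next
  case (WhileT b s P t s1 v s2)
  from WhileT.prems obtain t' v' s1' where
    "runs P s t' s1'" "runs (While b P) s1' v' s''" "u = 1 + t' + v'"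
    by (rule runs_WhileE) (use WhileT.hyps(1) in simp_all)
  with WhileT.IH show ?case by metis
qed


section \<open>Input and output\<close>

text \<open>
  An input consists of a weighted graph together with a numbering \<open>p\<close> of its vertices and a
  numbering \<open>q\<close> of its arcs, in arbitrary order.
\<close>

type_synonym ('a, 'b) fvs_input =
  "('a, 'b) pre_digraph \<times> ('a \<Rightarrow> real) \<times> (nat \<Rightarrow> 'a) \<times> (nat \<Rightarrow> 'b)"

definition fvs_inputs :: "('a, 'b) fvs_input set" where
  "fvs_inputs = {(G, \<nu>, p, q).
     fvs_problem G \<nu> \<and>
     bij_betw p {..<card (verts G)} (verts G) \<and>
     bij_betw q {..<card (arcs G)} (arcs G)}"

definition fvs_inputs_arcs_ge :: "nat \<Rightarrow> ('a, 'b) fvs_input set" where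
  "fvs_inputs_arcs_ge k = {(G, \<nu>, p, q). (G, \<nu>, p, q) \<in> fvs_inputs \<and> k \<le> card (arcs G)}"

definition vertex_index :: "('a, 'b) pre_digraph \<Rightarrow> (nat \<Rightarrow> 'a) \<Rightarrow> 'a \<Rightarrow> nat" where
  "vertex_index G p = inv_into {..<card (verts G)} p"

text \<open>
  Initial memory: the numbers of vertices and arcs, the arc list (indices of tail and head) and
  the weights. All other cells are \<open>0\<close>.
\<close>

fun encode_input :: "('a, 'b) fvs_input \<Rightarrow> memory" where
  "encode_input (G, \<nu>, p, q) =
     \<lparr>nats = (\<lambda>_ _. 0)
        (''verts'' := (\<lambda>_. 0)(0 := card (verts G)),
         ''arcs'' := (\<lambda>_. 0)(0 := card (arcs G)),
         ''tail'' := (\<lambda>k. if k < card (arcs G) then vertex_index G p (tail G (q k)) else 0),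
         ''head'' := (\<lambda>k. if k < card (arcs G) then vertex_index G p (head G (q k)) else 0)),
      reals = (\<lambda>_ _. 0)
        (''weight'' := (\<lambda>i. if i < card (verts G) then \<nu> (p i) else 0))\<rparr>"

definition output_number :: "memory \<Rightarrow> nat" where
  "output_number s = nats s ''out'' 0"

text \<open>A set of vertices is output as its characteristic vector.\<close>

definition output_vertices :: "('a, 'b) pre_digraph \<Rightarrow> (nat \<Rightarrow> 'a) \<Rightarrow> memory \<Rightarrow> 'a set" where
  "output_vertices G p s = p ` {i. i < card (verts G) \<and> nats s ''out'' i \<noteq> 0}"

end

theory Submission
  imports Defs "HOL-Library.Nat_Bijection"
begin

text \<open>
  The parameter is \<open>m = (\<Delta> - 1) |V| - |E| + 1\<close> itself. Call a vertex branching if it has in-degree at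
  least \<open>1\<close> and out-degree at least \<open>2\<close>; in \<open>G\<close> or in the reversed graph there are at most \<open>m\<close>
  branching vertices, by counting degrees.

  Cycles through branching vertices are treated by a dynamic program over sets of branching
  vertices, in the order in which they occur in a topological sorting of the remaining graph.
  Placing \<open>a\<close> after the set \<open>T\<close> costs the minimal weight of a set separating \<open>a\<close> from all branching
  vertices outside \<open>T\<close> on paths through non-branching vertices. Those vertices have a unique
  out-arc, so they form trees directed to \<open>a\<close>, the minimal cut is computed by relaxation, and the
  trees of different \<open>a\<close> are disjoint, so that the costs add up. An optimal set is recovered from
  the optimal value by self-reduction. The remaining cycles consist of non-branching vertices, are
  pairwise disjoint, and lose one vertex of minimal weight each.
\<close>

text \<open>Adding up the costs is justified by two separate inequalities; no cut duality and no
  fixed point of the relaxation enters. Upper bound: after the last branching vertex that it leaves,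
  a path to a branching vertex \<open>a\<close> follows unique out-arcs, so the cut chosen for
  \<open>a\<close> meets it if that last vertex is unplaced, and otherwise an earlier placement has
  excluded the path. Lower bound: while branching vertices are unplaced, a given solution
  \<open>U\<close> deletes one of them or leaves one that no unplaced vertex reaches, and placing
  that vertex costs at most the part of \<open>U\<close> in its tree. The table holds numbers and
  never the cuts themselves, hence the self-reduction. With \<open>b\<close> branching vertices one
  filling takes \<open>2 ^ b * n ^ 2 * (e + 1)\<close> steps up to a constant, and there are
  \<open>n + 1\<close> fillings; \<open>e + 1 \<le> 2 * \<Delta> * n\<close> for
  \<open>e \<ge> 1\<close> turns this into the claimed bound. Since the machine cannot multiply or
  divide, powers of two, halves and parities come from arrays filled by additions.\<close>

lemma sum_UN_le:
  fixes w :: "'b \<Rightarrow> real"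
  assumes "finite I" "\<And>i. i \<in> I \<Longrightarrow> finite (D i)" "\<forall>v. 0 \<le> w v"
  shows "sum w (\<Union>i\<in>I. D i) \<le> (\<Sum>i\<in>I. sum w (D i))"
  using assms
proof (induction I rule: finite_induct)
  case (insert i I)
  have "sum w (D i \<union> (\<Union>i\<in>I. D i)) \<le> sum w (D i) + sum w (\<Union>i\<in>I. D i)"
    using insert by (subst sum_Un) (simp_all add: sum_nonneg)
  then show ?case using insert by auto
qed simp

lemma funpow_diff:
  assumes "i \<le> j"
  shows "(f ^^ j) u = (f ^^ (j - i)) ((f ^^ i) u)"
  using funpow_add[of "j - i" i f] assms by simp

text \<open>Arcs are indices, so parallel arcs stay distinct. Interpreting the locale with
  \<open>src\<close> and \<open>dst\<close> exchanged yields the reversed graph, which makes every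
  result available for both orientations.\<close>

locale arc_list =
  fixes n e :: nat and src dst :: "nat \<Rightarrow> nat"
  assumes src_less: "k < e \<Longrightarrow> src k < n" and dst_less: "k < e \<Longrightarrow> dst k < n"
begin

definition indeg :: "nat \<Rightarrow> nat" where
  "indeg v = card {k. k < e \<and> dst k = v}"

definition outdeg :: "nat \<Rightarrow> nat" where
  "outdeg v = card {k. k < e \<and> src k = v}"

abbreviation inner :: "nat \<Rightarrow> bool" where
  "inner v \<equiv> outdeg v \<le> 1"

text \<open>A vertex with several out-arcs but no in-arc is neither \<open>inner\<close> nor
  branching: no walk enters it, so it lies on no cycle.\<close>

definition branching :: "nat set" where
  "branching = {v. v < n \<and> 0 < indeg v \<and> \<not> inner v}"

text \<open>The value \<open>n\<close> stands for ``no successor''.\<close>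

definition nxt :: "nat \<Rightarrow> nat" where
  "nxt v = (if outdeg v = 1 then dst (THE k. k < e \<and> src k = v) else n)"

definition residual :: "nat set \<Rightarrow> (nat \<times> nat) set" where
  "residual U = {(src k, dst k) |k. k < e \<and> src k \<notin> U \<and> dst k \<notin> U}"

definition hits :: "nat set \<Rightarrow> bool" where
  "hits U \<longleftrightarrow> (\<forall>a\<in>branching. (a, a) \<notin> (residual U)\<^sup>+)"

lemma nxt_src:
  assumes "k < e" "inner (src k)"
  shows "nxt (src k) = dst k"
proof -
  have fin: "finite {l. l < e \<and> src l = src k}" by simp
  have "k \<in> {l. l < e \<and> src l = src k}" using assms by simp
  then have "outdeg (src k) \<noteq> 0" unfolding outdeg_def using fin by auto
  then have one: "outdeg (src k) = 1" using assms by linarith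
  then obtain l where l: "{l. l < e \<and> src l = src k} = {l}"
    unfolding outdeg_def by (rule card_1_singletonE)
  with \<open>k \<in> _\<close> have "k = l" by blast
  with l have uniq: "j < e \<Longrightarrow> src j = src k \<Longrightarrow> j = k" for j by blast
  have "(THE l. l < e \<and> src l = src k) = k"
    using assms(1) uniq by (intro the_equality) simp_all
  then show ?thesis using one by (simp add: nxt_def)
qed

lemma nxt_cases: "nxt v = n \<or> (\<exists>k<e. src k = v \<and> inner v \<and> nxt v = dst k)"
proof (cases "outdeg v = 1")
  case True
  then obtain k where "{k. k < e \<and> src k = v} = {k}"
    unfolding outdeg_def by (rule card_1_singletonE)
  then have "k < e" "src k = v" by blast+
  then show ?thesis using True nxt_src[of k] by auto
qed (simp add: nxt_def)

lemma outdeg_ge: "n \<le> v \<Longrightarrow> outdeg v = 0"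
  using src_less by (fastforce simp: outdeg_def card_eq_0_iff)

lemma nxt_ge: "n \<le> v \<Longrightarrow> nxt v = n"
  using outdeg_ge by (simp add: nxt_def)

lemma nxt_not_inner: "\<not> inner v \<Longrightarrow> nxt v = n"
  by (simp add: nxt_def)

lemma nxt_le: "nxt v \<le> n"
  using nxt_cases[of v] dst_less by (metis less_imp_le order_refl)

lemma funpow_nxt_n: "(nxt ^^ i) n = n"
  by (induction i) (auto simp: nxt_ge)

lemma funpow_nxt_le: "v \<le> n \<Longrightarrow> (nxt ^^ i) v \<le> n"
  by (induction i) (auto simp: nxt_le)

lemma branching_less: "a \<in> branching \<Longrightarrow> a < n"
  by (simp add: branching_def)

lemma finite_branching [simp]: "finite branching"
  by (simp add: branching_def)

lemma branching_not_inner: "a \<in> branching \<Longrightarrow> \<not> inner a"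
  by (simp add: branching_def)

text \<open>A branching vertex has no \<open>nxt\<close>-successor and \<open>n\<close> is
  absorbing. Consequently an orbit meets at most one branching vertex, which is the disjointness of
  the trees.\<close>

lemma funpow_nxt_after_branching:
  assumes "(nxt ^^ i) u = a" "a \<in> branching" "i < j"
  shows "(nxt ^^ j) u = n"
proof -
  have "(nxt ^^ j) u = (nxt ^^ (j - Suc i)) ((nxt ^^ (Suc i)) u)"
    using assms(3) by (intro funpow_diff) simp
  moreover have "(nxt ^^ (Suc i)) u = n"
    using assms nxt_not_inner branching_not_inner by auto
  ultimately show ?thesis using funpow_nxt_n by metis
qed

text \<open>An orbit that reaches a branching vertex cannot repeat a vertex before, so it fits into
  \<open>n\<close> vertices. This bounds the number of relaxation rounds.\<close>

lemma branching_depth_less: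
  assumes "(nxt ^^ i) u = a" "a \<in> branching"
  shows "i < n"
proof -
  have neq: "(nxt ^^ j) u \<noteq> (nxt ^^ l) u" if "j < l" "l \<le> i" for j l
  proof
    assume eq: "(nxt ^^ j) u = (nxt ^^ l) u"
    \<comment> \<open>Cutting out the loop between \<open>j\<close> and \<open>l\<close> reaches
      \<open>a\<close> strictly before step \<open>i\<close>; at step \<open>i\<close> the orbit
      would then already be stuck in \<open>n\<close>.\<close>
    have "(nxt ^^ (i - l + j)) u = (nxt ^^ (i - l)) ((nxt ^^ l) u)"
      by (simp only: funpow_add comp_apply eq)
    also have "\<dots> = (nxt ^^ i) u"
      using that by (intro funpow_diff[symmetric]) simp
    finally have "(nxt ^^ (i - l + j)) u = a" using assms by simp
    moreover have "i - l + j < i" using that by simp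
    ultimately have "a = n" using funpow_nxt_after_branching assms by metis
    then show False using assms(2) branching_less by auto
  qed
  have inj: "inj_on (\<lambda>j. (nxt ^^ j) u) {..i}"
    by (intro inj_onI) (metis atMost_iff linorder_neqE_nat neq)
  have "(nxt ^^ j) u < n" if "j \<le> i" for j
  proof (cases "j = i")
    case True
    then show ?thesis using assms branching_less by auto
  next
    case False
    have "(nxt ^^ j) u \<noteq> n \<and> (nxt ^^ j) u < n"
    proof (rule ccontr)
      assume "\<not> ?thesis"
      then have "n \<le> (nxt ^^ j) u" by auto
      then have "(nxt ^^ Suc j) u = n" using nxt_ge by simp
      moreover have "(nxt ^^ i) u = (nxt ^^ (i - Suc j)) ((nxt ^^ Suc j) u)"
        using that False by (intro funpow_diff) simp
      ultimately have "a = n" using funpow_nxt_n assms by metis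
      then show False using assms(2) branching_less by auto
    qed
    then show ?thesis by simp
  qed
  then have "(\<lambda>j. (nxt ^^ j) u) ` {..i} \<subseteq> {..<n}" by auto
  from card_inj_on_le[OF inj this] show ?thesis by simp
qed

text \<open>
  An unplaced source must be separated from \<open>v\<close> by deleting \<open>v\<close> itself; its contribution \<open>w v\<close> acts
  as infinity, because \<open>relax\<close> is capped by \<open>w v\<close>.
\<close>

definition contrib :: "(nat \<Rightarrow> real) \<Rightarrow> nat set \<Rightarrow> (nat \<Rightarrow> real) \<Rightarrow> nat \<Rightarrow> nat \<Rightarrow> real" where
  "contrib w F x v k = (if inner (src k) then x (src k) else if src k \<in> F then w v else 0)"

definition relax :: "(nat \<Rightarrow> real) \<Rightarrow> nat set \<Rightarrow> (nat \<Rightarrow> real) \<Rightarrow> nat \<Rightarrow> real" where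
  "relax w F x v = min (w v) (\<Sum>k | k < e \<and> dst k = v. contrib w F x v k)"

text \<open>One step relaxes one vertex in place, in cyclic order, exactly as the nested loops of
  \<open>cutval_prog\<close> do; \<open>n * n\<close> steps are \<open>n\<close> rounds. The lower
  bound holds after any number of steps, the upper bound needs all \<open>n\<close> rounds.\<close>

primrec cutval :: "(nat \<Rightarrow> real) \<Rightarrow> nat set \<Rightarrow> nat \<Rightarrow> nat \<Rightarrow> real" where
  "cutval w F 0 = (\<lambda>_. 0)"
| "cutval w F (Suc t) = (cutval w F t)(t mod n := relax w F (cutval w F t) (t mod n))"

lemma cutval_nonneg:
  assumes "\<forall>v. 0 \<le> w v"
  shows "0 \<le> cutval w F t v"
proof (induction t arbitrary: v)
  case (Suc t)
  have "0 \<le> relax w F (cutval w F t) u" for u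
    unfolding relax_def contrib_def using assms Suc by (auto intro!: sum_nonneg)
  then show ?case using Suc by simp
qed simp

section \<open>Separating a vertex from the unplaced branching vertices\<close>

text \<open>A path from \<open>F\<close> to \<open>v\<close> through non-branching vertices is
  determined by its first arc \<open>k\<close> and its length, because it then follows
  \<open>nxt\<close>. The bound \<open>r\<close> on the length is the number of relaxation rounds
  that \<open>v\<close> has seen.\<close>

definition blocks :: "nat set \<Rightarrow> nat set \<Rightarrow> nat \<Rightarrow> nat \<Rightarrow> bool" where
  "blocks F C v r \<longleftrightarrow>
     (\<forall>k<e. \<forall>i<r. src k \<in> F \<longrightarrow> (nxt ^^ i) (dst k) = v \<longrightarrow> (\<exists>j\<le>i. (nxt ^^ j) (dst k) \<in> C))"

definition cut_witness :: "(nat \<Rightarrow> real) \<Rightarrow> nat set \<Rightarrow> (nat \<Rightarrow> real) \<Rightarrow> nat \<Rightarrow> nat \<Rightarrow> bool" where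
  "cut_witness w F x v r \<longleftrightarrow> (\<exists>C\<subseteq>{..<n}. sum w C \<le> x v \<and> blocks F C v r)"

text \<open>If the cap \<open>w v\<close> is taken, \<open>{v}\<close> is the cut. Otherwise the sum
  is below \<open>w v\<close>, so no arc enters \<open>v\<close> directly from \<open>F\<close>, as
  that arc alone would contribute \<open>w v\<close>; the union of the cuts of the inner
  in-neighbours then blocks paths that are one step longer.\<close>

lemma cut_witness_relax:
  assumes w: "\<forall>v. 0 \<le> w v" and x: "\<forall>v. 0 \<le> x v" and F: "F \<subseteq> branching" and v: "v < n"
    and IH: "\<And>u. u < n \<Longrightarrow> cut_witness w F x u r"
  shows "cut_witness w F (x(v := relax w F x v)) v (Suc r)"
proof (cases "w v \<le> (\<Sum>k | k < e \<and> dst k = v. contrib w F x v k)")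
  case True
  then have "relax w F x v = w v" by (simp add: relax_def)
  moreover have "blocks F {v} v (Suc r)" unfolding blocks_def by auto
  ultimately show ?thesis unfolding cut_witness_def using v by (intro exI[of _ "{v}"]) auto
next
  case False
  let ?K = "{k. k < e \<and> dst k = v}"
  let ?I = "{k \<in> ?K. inner (src k)}"
  have nonneg: "0 \<le> contrib w F x v k" for k using w x by (simp add: contrib_def)
  have noF: "src k \<notin> F" if "k \<in> ?K" for k
  proof
    assume kF: "src k \<in> F"
    then have "contrib w F x v k = w v" using F branching_not_inner unfolding contrib_def by auto
    moreover have "contrib w F x v k \<le> (\<Sum>k | k < e \<and> dst k = v. contrib w F x v k)"
      using that nonneg by (intro member_le_sum) auto
    ultimately show False using False by simp
  qed
  have "\<forall>u. \<exists>C. u < n \<longrightarrow> C \<subseteq> {..<n} \<and> sum w C \<le> x u \<and> blocks F C u r"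
    using IH unfolding cut_witness_def by blast
  then obtain D where D: "\<And>u. u < n \<Longrightarrow> D u \<subseteq> {..<n} \<and> sum w (D u) \<le> x u \<and> blocks F (D u) u r"
    by metis
  define C where "C = (\<Union>k\<in>?I. D (src k))"
  have "C \<subseteq> {..<n}" unfolding C_def using D src_less by blast
  moreover have "sum w C \<le> relax w F x v"
  proof -
    have "sum w C \<le> (\<Sum>k\<in>?I. sum w (D (src k)))"
      unfolding C_def
      using w D src_less by (intro sum_UN_le) (auto intro: finite_subset)
    also have "\<dots> \<le> (\<Sum>k\<in>?I. contrib w F x v k)"
      using D src_less by (intro sum_mono) (auto simp: contrib_def)
    also have "\<dots> \<le> (\<Sum>k\<in>?K. contrib w F x v k)"
      using nonneg by (intro sum_mono2) auto
    finally show ?thesis using False by (simp add: relax_def)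
  qed
  moreover have "blocks F C v (Suc r)"
    unfolding blocks_def
  proof (intro allI impI)
    fix k i assume k: "k < e" "i < Suc r" "src k \<in> F" "(nxt ^^ i) (dst k) = v"
    show "\<exists>j\<le>i. (nxt ^^ j) (dst k) \<in> C"
    proof (cases i)
      case 0
      then show ?thesis using k noF[of k] by simp
    next
      case (Suc i')
      let ?b = "(nxt ^^ i') (dst k)"
      have "nxt ?b = v" using k Suc by simp
      then obtain l where l: "l < e" "src l = ?b" "inner ?b" "dst l = v"
        using nxt_cases[of ?b] v by auto
      then have "blocks F (D ?b) ?b r" using D src_less by metis
      then obtain j where "j \<le> i'" "(nxt ^^ j) (dst k) \<in> D ?b"
        using k Suc unfolding blocks_def by auto
      moreover have "D ?b \<subseteq> C" unfolding C_def using l by (auto intro!: bexI[of _ l])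
      ultimately show ?thesis using Suc by (auto intro!: exI[of _ j])
    qed
  qed
  ultimately show ?thesis unfolding cut_witness_def by auto
qed


lemma cut_witness_mono:
  "cut_witness w F x v r' \<Longrightarrow> r \<le> r' \<Longrightarrow> cut_witness w F x v r"
  unfolding cut_witness_def blocks_def by (meson order_less_le_trans)

lemma cut_witness_cong:
  "x v = y v \<Longrightarrow> cut_witness w F x v r = cut_witness w F y v r"
  unfolding cut_witness_def by simp

text \<open>The vertices below \<open>t mod n\<close> have already been relaxed in the current round
  and are one length ahead. Newer values of in-neighbours do no harm, since
  \<open>cut_witness\<close> is antitone in the length.\<close>

lemma cut_witness_cutval_aux:
  assumes w: "\<forall>v. 0 \<le> w v" and F: "F \<subseteq> branching" and v: "v < n"
  shows "cut_witness w F (cutval w F t) v (if v < t mod n then Suc (t div n) else t div n)"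
  using v
proof (induction t arbitrary: v)
  case 0
  then show ?case unfolding cut_witness_def blocks_def by (auto intro!: exI[of _ "{}"])
next
  case (Suc t)
  let ?j = "t mod n" and ?r = "t div n"
  have j: "?j < n" using Suc.prems by simp
  have nn: "\<forall>v. 0 \<le> cutval w F t v" using cutval_nonneg[OF w] by blast
  have "cut_witness w F (cutval w F t) u ?r" if "u < n" for u
    using Suc.IH[OF that] cut_witness_mono by (auto split: if_splits)
  then have new: "cut_witness w F (cutval w F (Suc t)) ?j (Suc ?r)"
    using cut_witness_relax[OF w nn F j] by simp
  have old: "cut_witness w F (cutval w F (Suc t)) v (if v < ?j then Suc ?r else ?r)" if "v \<noteq> ?j"
    using Suc.IH[OF Suc.prems] cut_witness_cong[of "cutval w F t" v "cutval w F (Suc t)"] that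
    by simp
  show ?case
  proof (cases "Suc ?j < n")
    case True
    then have "Suc t mod n = Suc ?j" "Suc t div n = ?r" by (simp_all add: mod_Suc div_Suc)
    then show ?thesis using new old by (cases "v = ?j") (auto simp: less_Suc_eq simp del: cutval.simps)
  next
    case False
    then have "Suc ?j = n" using j by simp
    then have *: "Suc t mod n = 0" "Suc t div n = Suc ?r" by (simp_all add: mod_Suc div_Suc)
    have "v = ?j \<or> v < ?j" using Suc.prems \<open>Suc ?j = n\<close> by linarith
    then show ?thesis using new old * by (auto simp del: cutval.simps)
  qed
qed

text \<open>By \<open>branching_depth_less\<close> every path to \<open>a\<close> is shorter than
  \<open>n\<close>, so a cut for length \<open>n\<close> is a cut for all lengths.\<close>

lemma cut_witness_cutval:
  assumes "\<forall>v. 0 \<le> w v" "F \<subseteq> branching" "a \<in> branching"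
  obtains C where "C \<subseteq> {..<n}" "sum w C \<le> cutval w F (n * n) a" "\<And>r. blocks F C a r"
proof -
  have a: "a < n" using assms branching_less by simp
  then have "cut_witness w F (cutval w F (n * n)) a n"
    using cut_witness_cutval_aux[OF assms(1,2) a, of "n * n"] by simp
  then obtain C where C: "C \<subseteq> {..<n}" "sum w C \<le> cutval w F (n * n) a" "blocks F C a n"
    unfolding cut_witness_def by blast
  have "blocks F C a r" for r
    using C(3) branching_depth_less[OF _ assms(3)] unfolding blocks_def by blast
  with C show thesis using that by blast
qed

section \<open>Lower bound by charging\<close>

text \<open>
  Every \<open>u \<in> U\<close> is charged to the vertices on its \<open>nxt\<close>-orbit. At most one of them is branching, so
  the charges of the branching vertices sum up to at most the weight of \<open>U\<close>.
\<close>

definition charge :: "(nat \<Rightarrow> real) \<Rightarrow> nat set \<Rightarrow> nat \<Rightarrow> nat \<Rightarrow> real" where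
  "charge w U t v = (\<Sum>i<t. \<Sum>u\<in>U. if (nxt ^^ i) u = v then w u else 0)"

lemma charge_nonneg: "\<forall>v. 0 \<le> w v \<Longrightarrow> 0 \<le> charge w U t v"
  unfolding charge_def by (auto intro!: sum_nonneg)

lemma charge_Suc_ge: "\<forall>v. 0 \<le> w v \<Longrightarrow> charge w U t v \<le> charge w U (Suc t) v"
  unfolding charge_def by (auto intro!: sum_nonneg)

text \<open>Splitting each orbit at its last step gives \<open>charge\<close> the recursion of
  \<open>relax\<close>, with the cap replaced by the weight of \<open>v\<close> itself if
  \<open>v\<close> lies in \<open>U\<close>.\<close>

lemma charge_Suc:
  assumes "finite U" "v < n"
  shows "charge w U (Suc t) v = (if v \<in> U then w v else 0) +
    (\<Sum>k | k < e \<and> dst k = v \<and> inner (src k). charge w U t (src k))"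
proof -
  let ?K = "{k. k < e \<and> dst k = v \<and> inner (src k)}"
  \<comment> \<open>A vertex \<open>b\<close> with \<open>nxt b = v\<close> has exactly one out-arc,
    so parallel arcs cannot count its charge twice.\<close>
  have pick: "(if nxt b = v then c else 0) = (\<Sum>k\<in>?K. if b = src k then c else (0::real))" for b c
  proof (cases "nxt b = v")
    case True
    then obtain k where k: "k < e" "src k = b" "inner b" "dst k = v"
      using nxt_cases[of b] assms by auto
    have uniq: "l = k" if "l < e" "src l = b" for l
    proof (rule ccontr)
      assume "l \<noteq> k"
      have "card {k, l} \<le> card {k. k < e \<and> src k = b}"
        using that k by (intro card_mono) auto
      then show False using k(3) \<open>l \<noteq> k\<close> unfolding outdeg_def by simp
    qed
    have "(\<Sum>l\<in>?K. if b = src l then c else 0) = (\<Sum>l\<in>?K. if l = k then c else 0)"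
      using uniq k(2) by (intro sum.cong refl if_cong) blast
    also have "\<dots> = c" using k by simp
    finally show ?thesis using True by simp
  next
    case False
    then have "\<forall>k\<in>?K. b \<noteq> src k" using nxt_src by auto
    then show ?thesis using False by simp
  qed
  have "charge w U (Suc t) v = (\<Sum>u\<in>U. if u = v then w u else 0) +
      (\<Sum>i<t. \<Sum>u\<in>U. if (nxt ^^ Suc i) u = v then w u else 0)"
    unfolding charge_def by (subst sum.lessThan_Suc_shift) simp
  also have "(\<Sum>u\<in>U. if u = v then w u else 0) = (if v \<in> U then w v else 0)"
    using assms by simp
  also have "(\<Sum>i<t. \<Sum>u\<in>U. if (nxt ^^ Suc i) u = v then w u else 0) =
      (\<Sum>i<t. \<Sum>u\<in>U. \<Sum>k\<in>?K. if (nxt ^^ i) u = src k then w u else 0)"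
    using pick by simp
  also have "\<dots> = (\<Sum>i<t. \<Sum>k\<in>?K. \<Sum>u\<in>U. if (nxt ^^ i) u = src k then w u else 0)"
    by (intro sum.cong refl sum.swap)
  also have "\<dots> = (\<Sum>k\<in>?K. \<Sum>i<t. \<Sum>u\<in>U. if (nxt ^^ i) u = src k then w u else 0)"
    by (rule sum.swap)
  finally show ?thesis unfolding charge_def .
qed

text \<open>If \<open>v\<close> is deleted, the cap is paid by its own weight. If not, no
  in-neighbour lies in \<open>F\<close>, and each inner in-neighbour again is deleted or
  unreachable, so the two recursions can be compared term by term. The disjointness of
  \<open>F\<close> and \<open>U\<close> matters because a deleted vertex of \<open>F\<close> would
  still contribute \<open>w v\<close> although its arcs are gone.\<close>

lemma cutval_le_charge:
  assumes w: "\<forall>v. 0 \<le> w v" and U: "finite U" and F: "F \<inter> U = {}"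
    and v: "v < n" "v \<in> U \<or> (\<forall>a\<in>F. (a, v) \<notin> (residual U)\<^sup>+)"
  shows "cutval w F t v \<le> charge w U t v"
  using v
proof (induction t arbitrary: v)
  case 0
  then show ?case by (simp add: charge_def)
next
  case (Suc t)
  show ?case
  proof (cases "v = t mod n")
    case False
    then show ?thesis using Suc charge_Suc_ge[OF w, of U t v] by fastforce
  next
    case True
    let ?K = "{k. k < e \<and> dst k = v}" and ?I = "{k. k < e \<and> dst k = v \<and> inner (src k)}"
    let ?x = "cutval w F t"
    have new: "cutval w F (Suc t) v = relax w F ?x v" using True by simp
    show ?thesis
    proof (cases "v \<in> U")
      case inU: True
      have "relax w F ?x v \<le> w v" by (simp add: relax_def)
      moreover have "0 \<le> (\<Sum>k\<in>?I. charge w U t (src k))"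
        using charge_nonneg[OF w] by (intro sum_nonneg) auto
      ultimately show ?thesis using new charge_Suc[OF U Suc.prems(1), of w t] inU by simp
    next
      case notU: False
      have path: "\<forall>a\<in>F. (a, v) \<notin> (residual U)\<^sup>+" using Suc.prems notU by simp
      have "relax w F ?x v \<le> (\<Sum>k\<in>?K. contrib w F ?x v k)" by (simp add: relax_def)
      also have "\<dots> = (\<Sum>k\<in>?I. contrib w F ?x v k)"
      proof (rule sum.mono_neutral_right)
        show "\<forall>k\<in>?K - ?I. contrib w F ?x v k = 0"
        proof
          fix k assume k: "k \<in> ?K - ?I"
          have "src k \<notin> F"
          proof
            assume kF: "src k \<in> F"
            then have "(src k, v) \<in> residual U"
              using k F notU unfolding residual_def by auto
            then show False using path kF by auto
          qed
          then show "contrib w F ?x v k = 0" using k by (simp add: contrib_def)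
        qed
      qed auto
      also have "\<dots> \<le> (\<Sum>k\<in>?I. charge w U t (src k))"
      proof (rule sum_mono)
        fix k assume k: "k \<in> ?I"
        have "src k \<in> U \<or> (\<forall>a\<in>F. (a, src k) \<notin> (residual U)\<^sup>+)"
        proof (rule ccontr)
          assume "\<not> ?thesis"
          then obtain a where a: "src k \<notin> U" "a \<in> F" "(a, src k) \<in> (residual U)\<^sup>+" by blast
          then have "(src k, v) \<in> residual U" using k notU unfolding residual_def by auto
          with a have "(a, v) \<in> (residual U)\<^sup>+" by (meson trancl.trancl_into_trancl)
          then show False using path a by blast
        qed
        then show "contrib w F ?x v k \<le> charge w U t (src k)"
          using k Suc.IH[of "src k"] src_less by (simp add: contrib_def)
      qed
      also have "\<dots> = charge w U (Suc t) v" using charge_Suc[OF U Suc.prems(1), of w t] notU by simp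
      finally show ?thesis using new by simp
    qed
  qed
qed

lemma sum_charge_le:
  assumes w: "\<forall>v. 0 \<le> w v"
  shows "(\<Sum>a\<in>branching. charge w U t a) \<le> sum w U"
proof -
  have one: "(\<Sum>i<t. \<Sum>a\<in>branching. if (nxt ^^ i) u = a then w u else 0) \<le> w u" for u
  proof (cases "\<exists>i a. a \<in> branching \<and> (nxt ^^ i) u = a")
    case False
    then have "(\<Sum>i<t. \<Sum>a\<in>branching. if (nxt ^^ i) u = a then w u else 0) = 0"
      by (intro sum.neutral ballI) auto
    then show ?thesis using w[rule_format, of u] by linarith
  next
    case True
    then obtain i0 where i0: "(nxt ^^ i0) u \<in> branching" by blast
    have other: "(nxt ^^ i) u \<notin> branching" if "i \<noteq> i0" for i
    proof
      assume i: "(nxt ^^ i) u \<in> branching"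
      have "n \<in> branching"
        using that i i0 funpow_nxt_after_branching[OF refl i, of i0]
          funpow_nxt_after_branching[OF refl i0, of i] by (metis linorder_neqE_nat)
      then show False using branching_less by blast
    qed
    have "(\<Sum>i<t. \<Sum>a\<in>branching. if (nxt ^^ i) u = a then w u else 0)
        = (\<Sum>i<t. if i = i0 then w u else 0)"
      using other i0 by (intro sum.cong) auto
    also have "\<dots> \<le> w u" using w[rule_format, of u] by simp
    finally show ?thesis .
  qed
  have "(\<Sum>a\<in>branching. charge w U t a)
      = (\<Sum>a\<in>branching. \<Sum>u\<in>U. \<Sum>i<t. if (nxt ^^ i) u = a then w u else 0)"
    unfolding charge_def by (intro sum.cong refl sum.swap)
  also have "\<dots> = (\<Sum>u\<in>U. \<Sum>a\<in>branching. \<Sum>i<t. if (nxt ^^ i) u = a then w u else 0)"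
    by (rule sum.swap)
  also have "\<dots> = (\<Sum>u\<in>U. \<Sum>i<t. \<Sum>a\<in>branching. if (nxt ^^ i) u = a then w u else 0)"
    by (intro sum.cong refl sum.swap)
  also have "\<dots> \<le> sum w U" using one by (intro sum_mono)
  finally show ?thesis .
qed

lemma cutval_le: 
  assumes w: "\<forall>v. 0 \<le> w v"
  shows "cutval w F t v \<le> w v"
  by (induction t arbitrary: v) (simp_all add: w relax_def)

text \<open>A deleted vertex of \<open>F\<close> is a valid choice because its own weight is charged
  to it; \<open>Suc t\<close> ensures that the term of the zeroth iterate is present. If
  \<open>F\<close> avoids \<open>U\<close>, a minimal vertex for reachability in the residual graph
  is not reached from \<open>F\<close>.\<close>

lemma next_placement:
  assumes w: "\<forall>v. 0 \<le> w v" and U: "finite U" and hits: "hits U"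
    and F: "F \<subseteq> branching" "F \<noteq> {}"
  shows "\<exists>a\<in>F. cutval w F t a \<le> charge w U (Suc t) a"
proof (cases "F \<inter> U = {}")
  case False
  then obtain a where a: "a \<in> F" "a \<in> U" by blast
  then have an: "a < n" using F branching_less by blast
  have "cutval w F t a \<le> w a" by (rule cutval_le[OF w])
  moreover have "0 \<le> (\<Sum>k | k < e \<and> dst k = a \<and> inner (src k). charge w U t (src k))"
    using charge_nonneg[OF w] by (intro sum_nonneg) auto
  ultimately have "cutval w F t a \<le> charge w U (Suc t) a"
    using charge_Suc[OF U an, of w t] a by simp
  then show ?thesis using a by blast
next
  case True
  \<comment> \<open>Transitive by construction and irreflexive because \<open>U\<close> hits every
    cycle through a branching vertex; being finite, \<open>r\<close> is well-founded.\<close>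
  define r where "r = (residual U)\<^sup>+ \<inter> F \<times> F"
  have "trans r" unfolding r_def by (auto intro!: transI)
  moreover have "\<forall>a. (a, a) \<notin> r" using hits F unfolding r_def hits_def by auto
  ultimately have "acyclic r" by (simp add: acyclic_def)
  moreover have "finite r"
    using F finite_subset[OF _ finite_branching] unfolding r_def by auto
  ultimately have "wf r" by (simp add: finite_acyclic_wf)
  then obtain a where a: "a \<in> F" "\<And>b. (b, a) \<in> r \<Longrightarrow> b \<notin> F"
    using F(2) by (metis wf_eq_minimal ex_in_conv)
  then have "\<forall>b\<in>F. (b, a) \<notin> (residual U)\<^sup>+" unfolding r_def by blast
  moreover have "a < n" using a F branching_less by blast
  ultimately have "cutval w F t a \<le> charge w U t a"
    using cutval_le_charge[OF w U True] by blast
  then show ?thesis using a(1) charge_Suc_ge[OF w, of U t a] order_trans by blast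
qed

section \<open>Upper bound\<close>

text \<open>The case \<open>b = a\<close> excludes cycles through placed vertices, the case
  \<open>b \<notin> T\<close> excludes paths back from unplaced ones. For
  \<open>T = branching\<close> this is \<open>hits U\<close>.\<close>

definition placed :: "nat set \<Rightarrow> nat set \<Rightarrow> bool" where
  "placed T U \<longleftrightarrow> (\<forall>a\<in>T. \<forall>b\<in>branching. b = a \<or> b \<notin> T \<longrightarrow> (b, a) \<notin> (residual U)\<^sup>+)"

lemma residual_mono: "U \<subseteq> U' \<Longrightarrow> (residual U')\<^sup>+ \<subseteq> (residual U)\<^sup>+"
  by (intro trancl_mono_subset) (auto simp: residual_def)

text \<open>After its last branching vertex a walk is an orbit of \<open>nxt\<close>, which is the
  kind of path that \<open>blocks\<close> speaks about.\<close>

lemma last_branching: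
  assumes "(x, z) \<in> (residual U)\<^sup>+" "x \<in> branching"
  shows "\<exists>k i. k < e \<and> src k \<in> branching \<and> (x = src k \<or> (x, src k) \<in> (residual U)\<^sup>+) \<and>
    (nxt ^^ i) (dst k) = z \<and> (\<forall>j\<le>i. (nxt ^^ j) (dst k) \<notin> U)"
  using assms
proof (induction rule: trancl_induct)
  case (base y)
  then obtain k where "k < e" "src k = x" "dst k = y" "dst k \<notin> U" unfolding residual_def by blast
  then show ?case using base by (intro exI[of _ k] exI[of _ 0]) auto
next
  case (step y z)
  then obtain l where l: "l < e" "src l = y" "dst l = z" "dst l \<notin> U" unfolding residual_def by blast
  show ?case
  proof (cases "y \<in> branching")
    case True
    then show ?thesis using l step by (intro exI[of _ l] exI[of _ 0]) auto
  next
    case False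
    \<comment> \<open>The walk enters \<open>y\<close>, so \<open>y\<close> has positive in-degree;
      not being branching, it must be inner.\<close>
    from step(1) obtain y' where "(y', y) \<in> residual U" by (rule tranclE) auto
    then obtain k' where "k' < e" "dst k' = y" unfolding residual_def by blast
    then have "0 < indeg y" unfolding indeg_def by (auto simp: card_gt_0_iff)
    then have "inner y" using False l src_less unfolding branching_def by auto
    then have nz: "nxt y = z" using nxt_src l by blast
    from step obtain k i where k: "k < e" "src k \<in> branching" "x = src k \<or> (x, src k) \<in> (residual U)\<^sup>+"
      "(nxt ^^ i) (dst k) = y" "\<forall>j\<le>i. (nxt ^^ j) (dst k) \<notin> U" by blast
    then have "(nxt ^^ Suc i) (dst k) = z" using nz by simp
    moreover have "\<forall>j\<le>Suc i. (nxt ^^ j) (dst k) \<notin> U"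
      using k(5) calculation l by (auto simp: le_Suc_eq simp del: funpow.simps)
    ultimately show ?thesis using k by blast
  qed
qed

text \<open>Consider the last branching vertex on a path from \<open>b\<close> to \<open>a\<close>,
  where \<open>b\<close> is outside \<open>T\<close>. It is not in \<open>T\<close>, since
  \<open>b\<close> reaches it and \<open>placed T U\<close> holds; so it is unplaced, and
  \<open>C\<close> meets the remaining orbit. The cycle case \<open>b = a\<close> is included
  because \<open>a\<close> is not in \<open>T\<close>.\<close>

lemma placed_insert:
  assumes P: "placed T U" and T: "T \<subseteq> branching" and a: "a \<in> branching - T"
    and C: "\<And>r. blocks (branching - T) C a r"
  shows "placed (insert a T) (U \<union> C)"
proof -
  let ?R = "(residual (U \<union> C))\<^sup>+"
  have sub: "?R \<subseteq> (residual U)\<^sup>+" by (rule residual_mono) simp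
  have "(b, a) \<notin> ?R" if b: "b \<in> branching" "b = a \<or> b \<notin> T" for b
  proof
    assume "(b, a) \<in> ?R"
    from last_branching[OF this b(1)] obtain k i where
      k: "k < e" "src k \<in> branching" "b = src k \<or> (b, src k) \<in> ?R"
        "(nxt ^^ i) (dst k) = a" "\<forall>j\<le>i. (nxt ^^ j) (dst k) \<notin> U \<union> C" by blast
    have bT: "b \<notin> T" using b a by auto
    have "src k \<notin> T"
      using k(3) sub P bT b(1) unfolding placed_def by blast
    then have "\<exists>j\<le>i. (nxt ^^ j) (dst k) \<in> C"
      using C[of "Suc i"] k unfolding blocks_def by blast
    then show False using k(5) by blast
  qed
  then show ?thesis using P sub unfolding placed_def by blast
qed

section \<open>Subsets of branching vertices as bit masks\<close>

definition rank :: "nat \<Rightarrow> nat" where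
  "rank v = card {u \<in> branching. u < v}"

abbreviation masks :: nat where
  "masks \<equiv> 2 ^ card branching"

definition unplaced :: "nat \<Rightarrow> nat set" where
  "unplaced M = {v \<in> branching. rank v \<notin> set_decode M}"

lemma unplaced_subset: "unplaced M \<subseteq> branching"
  by (auto simp: unplaced_def)

lemma finite_unplaced: "finite (unplaced M)"
  by (rule finite_subset[OF unplaced_subset finite_branching])

lemma rank_less_rank: "u \<in> branching \<Longrightarrow> u < v \<Longrightarrow> rank u < rank v"
  unfolding rank_def by (intro psubset_card_mono) auto

lemma inj_on_rank: "inj_on rank branching"
  by (intro inj_onI) (metis rank_less_rank linorder_neqE_nat less_irrefl)

lemma rank_less: "v \<in> branching \<Longrightarrow> rank v < card branching"
  unfolding rank_def by (intro psubset_card_mono) auto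

lemma rank_image: "rank ` branching = {..<card branching}"
  using rank_less by (intro card_subset_eq) (auto simp: card_image[OF inj_on_rank])

lemma set_encode_lessThan: "set_encode {..<k} = 2 ^ k - 1"
  by (induction k) (auto simp: lessThan_Suc)

lemma less_power2_iff: "M < 2 ^ k \<longleftrightarrow> set_decode M \<subseteq> {..<k}"
proof
  assume "M < 2 ^ k"
  have "i < k" if "i \<in> set_decode M" for i
  proof (rule ccontr)
    assume "\<not> i < k"
    then have "(2::nat) ^ k \<le> 2 ^ i" by simp
    then have "M < 2 ^ i" using \<open>M < 2 ^ k\<close> by linarith
    then have "M div 2 ^ i = 0" by simp
    then show False using that by (simp add: set_decode_def)
  qed
  then show "set_decode M \<subseteq> {..<k}" by blast
next
  assume "set_decode M \<subseteq> {..<k}"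
  then have "set_encode (set_decode M) \<le> set_encode {..<k}"
    unfolding set_encode_def by (intro sum_mono2) auto
  then show "M < 2 ^ k" by (simp add: set_encode_lessThan) (metis One_nat_def Suc_pred le_imp_less_Suc pos2 zero_less_power)
qed

text \<open>The bit at position \<open>rank a\<close> is clear in \<open>M\<close>, so the addition
  causes no carry and acts as setting that bit.\<close>

lemma set_decode_add_rank:
  "a \<in> unplaced M \<Longrightarrow> set_decode (M + 2 ^ rank a) = insert (rank a) (set_decode M)"
  using set_decode_plus_power_2[of "rank a" M] by (simp add: unplaced_def add.commute)

lemma unplaced_add_rank:
  assumes "a \<in> unplaced M"
  shows "unplaced (M + 2 ^ rank a) = unplaced M - {a}"
  using assms set_decode_add_rank[OF assms] inj_on_rank
  unfolding unplaced_def by (auto dest: inj_onD)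

lemma add_rank_less:
  assumes "a \<in> unplaced M" "M < masks"
  shows "M + 2 ^ rank a < masks"
  using assms set_decode_add_rank[OF assms(1)] rank_less[of a] unplaced_subset[of M]
  by (auto simp: less_power2_iff)

lemma unplaced_full: "unplaced (masks - 1) = {}"
proof -
  have "set_decode (masks - 1) = {..<card branching}"
    using set_encode_lessThan[of "card branching"] by (metis set_encode_inverse finite_lessThan)
  then show ?thesis using rank_less by (auto simp: unplaced_def)
qed

lemma unplaced_empty_imp:
  assumes "unplaced M = {}" "M < masks"
  shows "M = masks - 1"
proof -
  have "set_decode M = {..<card branching}"
  proof
    show "set_decode M \<subseteq> {..<card branching}" using assms by (simp add: less_power2_iff)
    show "{..<card branching} \<subseteq> set_decode M"
      using assms(1) unfolding unplaced_def rank_image[symmetric] by blast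
  qed
  then show ?thesis using set_encode_lessThan[of "card branching"] set_decode_inverse[of M] by simp
qed

text \<open>The two halves force equality for some set, so \<open>c\<close> is the minimum. The
  first one uses \<open>\<le>\<close> because unions of cuts may overlap and only their weight
  bounds are tracked.\<close>

definition hitting_value :: "(nat \<Rightarrow> real) \<Rightarrow> real \<Rightarrow> bool" where
  "hitting_value w c \<longleftrightarrow>
     (\<exists>U\<subseteq>{..<n}. hits U \<and> sum w U \<le> c) \<and> (\<forall>U\<subseteq>{..<n}. hits U \<longrightarrow> c \<le> sum w U)"

definition table_upper :: "(nat \<Rightarrow> real) \<Rightarrow> (nat \<Rightarrow> real) \<Rightarrow> bool" where
  "table_upper w opt \<longleftrightarrow>
     (\<forall>M<masks. \<exists>U\<subseteq>{..<n}. sum w U \<le> opt M \<and> placed (branching - unplaced M) U)"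

text \<open>\<open>B\<close> counts the masks already processed. Setting a bit increases a mask, so
  processing masks in numerical order finishes every subset before its supersets.\<close>

definition table_lower :: "(nat \<Rightarrow> real) \<Rightarrow> (nat \<Rightarrow> real) \<Rightarrow> nat \<Rightarrow> bool" where
  "table_lower w opt B \<longleftrightarrow> opt 0 \<le> 0 \<and>
     (\<forall>M<B. \<forall>a\<in>unplaced M. opt (M + 2 ^ rank a) \<le> opt M + cutval w (unplaced M) (n * n) a)"

lemma table_upper_step:
  assumes w: "\<forall>v. 0 \<le> w v" and up: "table_upper w opt" and M: "M < masks" and a: "a \<in> unplaced M"
  shows "table_upper w (opt(M + 2 ^ rank a := opt M + cutval w (unplaced M) (n * n) a))"
proof -
  from up M obtain U where U: "U \<subseteq> {..<n}" "sum w U \<le> opt M" "placed (branching - unplaced M) U"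
    unfolding table_upper_def by blast
  obtain C where C: "C \<subseteq> {..<n}" "sum w C \<le> cutval w (unplaced M) (n * n) a"
      "\<And>r. blocks (unplaced M) C a r"
    using cut_witness_cutval[OF w unplaced_subset, of a M] a unplaced_subset by blast
  have "branching - (branching - unplaced M) = unplaced M" using unplaced_subset by blast
  then have "placed (insert a (branching - unplaced M)) (U \<union> C)"
    using placed_insert[OF U(3), of a C] C(3) a unplaced_subset by auto
  moreover have "insert a (branching - unplaced M) = branching - unplaced (M + 2 ^ rank a)"
    using unplaced_add_rank[OF a] a unplaced_subset by auto
  moreover have "sum w (U \<union> C) \<le> sum w U + sum w C"
    using U C w by (subst sum_Un) (auto simp: sum_nonneg intro: finite_subset)
  then have "sum w (U \<union> C) \<le> opt M + cutval w (unplaced M) (n * n) a"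
    using U C by simp
  ultimately have "\<exists>U'\<subseteq>{..<n}. sum w U' \<le> opt M + cutval w (unplaced M) (n * n) a
      \<and> placed (branching - unplaced (M + 2 ^ rank a)) U'"
    using U C by (intro exI[of _ "U \<union> C"]) auto
  then show ?thesis using up unfolding table_upper_def by simp
qed

text \<open>For a hitting set \<open>U\<close> the placements of \<open>next_placement\<close> form
  a chain of masks from \<open>0\<close> to the full one. Along it the table entry stays below the
  charges of the placed vertices, whose total is at most the weight of \<open>U\<close>.\<close>

lemma table_value:
  assumes w: "\<forall>v. 0 \<le> w v" and up: "table_upper w opt" and low: "table_lower w opt masks"
  shows "hitting_value w (opt (masks - 1))"
proof -
  have full: "masks - 1 < (masks::nat)" by simp
  have "\<exists>U\<subseteq>{..<n}. hits U \<and> sum w U \<le> opt (masks - 1)"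
    using up[unfolded table_upper_def, rule_format, OF full] unplaced_full
    by (auto simp: placed_def hits_def)
  moreover have "opt (masks - 1) \<le> sum w U" if U: "U \<subseteq> {..<n}" "hits U" for U
  proof -
    have fin: "finite U" using U finite_subset by blast
    let ?Y = "charge w U (Suc (n * n))"
    have "\<exists>M<masks. card (unplaced M) = card branching - c \<and>
        opt M \<le> (\<Sum>a\<in>branching - unplaced M. ?Y a)" if "c \<le> card branching" for c
      using that
    proof (induction c)
      case 0
      have "unplaced 0 = branching" by (auto simp: unplaced_def)
      then show ?case using low by (intro exI[of _ 0]) (auto simp: table_lower_def)
    next
      case (Suc c)
      then obtain M where M: "M < masks" "card (unplaced M) = card branching - c"
        "opt M \<le> (\<Sum>a\<in>branching - unplaced M. ?Y a)" by auto
      have "unplaced M \<noteq> {}" using M(2) Suc.prems by auto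
      from next_placement[OF w fin U(2) unplaced_subset this, of "n * n"]
      obtain a where a: "a \<in> unplaced M" "cutval w (unplaced M) (n * n) a \<le> ?Y a" by blast
      let ?M = "M + 2 ^ rank a"
      have ab: "a \<in> branching" using a unplaced_subset by blast
      have "opt ?M \<le> opt M + cutval w (unplaced M) (n * n) a"
        using low M(1) a(1) unfolding table_lower_def by blast
      also have "\<dots> \<le> (\<Sum>a\<in>branching - unplaced M. ?Y a) + ?Y a" using M a by simp
      also have "\<dots> = (\<Sum>a\<in>insert a (branching - unplaced M). ?Y a)"
        using a by simp
      also have "insert a (branching - unplaced M) = branching - unplaced ?M"
        using unplaced_add_rank[OF a(1)] ab by blast
      finally have "opt ?M \<le> (\<Sum>a\<in>branching - unplaced ?M. ?Y a)" .
      moreover have "card (unplaced ?M) = card branching - Suc c"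
        using unplaced_add_rank[OF a(1)] M(2) a(1) finite_unplaced by simp
      ultimately show ?case using add_rank_less[OF a(1) M(1)] by blast
    qed
    from this[of "card branching"] obtain M where M: "M < masks" "card (unplaced M) = 0"
      "opt M \<le> (\<Sum>a\<in>branching - unplaced M. ?Y a)" by auto
    have "unplaced M = {}" using M(2) finite_unplaced by simp
    then have "opt (masks - 1) \<le> (\<Sum>a\<in>branching. ?Y a)"
      using M unplaced_empty_imp by auto
    also have "\<dots> \<le> sum w U" by (rule sum_charge_le[OF w])
    finally show ?thesis .
  qed
  ultimately show ?thesis unfolding hitting_value_def by blast
qed


section \<open>Self-reduction\<close>

lemma hits_mono: "hits U \<Longrightarrow> U \<subseteq> U' \<Longrightarrow> hits U'"
  using residual_mono unfolding hits_def by blast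

text \<open>
  A vertex lies in some optimal set iff giving it weight \<open>0\<close> decreases the optimum by its full
  weight. Chosen vertices keep the weight \<open>0\<close>, so in the end the chosen set itself is optimal.
\<close>

definition selection ::
    "(nat \<Rightarrow> real) \<Rightarrow> nat set \<Rightarrow> (nat \<Rightarrow> real) \<Rightarrow> nat \<Rightarrow> real \<Rightarrow> bool" where
  "selection w D wc v best \<longleftrightarrow>
     D \<subseteq> {..<v} \<and> wc = (\<lambda>u. if u \<in> D then 0 else w u) \<and> hitting_value wc best \<and>
     (\<forall>U\<subseteq>{..<n}. hits U \<longrightarrow> sum w D + best \<le> sum w U) \<and>
     (\<forall>u<v. u \<notin> D \<longrightarrow> (\<forall>U\<subseteq>{..<n}. hits U \<longrightarrow> u \<in> U \<longrightarrow> best < sum wc U))"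

lemma selection_init: "hitting_value w c \<Longrightarrow> selection w {} w 0 c"
  unfolding selection_def hitting_value_def by auto

text \<open>Adding \<open>v\<close> to a set costs at most \<open>wc v\<close> in the old weights
  and nothing in the new ones. A set through a rejected vertex with new weight at most
  \<open>c\<close> would thus give one of old weight at most \<open>best\<close>, contrary to the
  earlier rejection.\<close>

lemma selection_accept:
  assumes S: "selection w D wc v best" and v: "v < n"
    and c: "hitting_value (wc(v := 0)) c" "\<not> best < c + wc v"
  shows "selection w (insert v D) (wc(v := 0)) (Suc v) c"
proof -
  have vD: "v \<notin> D" and wcv: "wc v = w v" and D: "D \<subseteq> {..<v}"
    using S unfolding selection_def by auto
  have fin: "finite D" using D finite_subset by blast
  have S4: "best < sum wc U"
    if "u < v" "u \<notin> D" "U \<subseteq> {..<n}" "hits U" "u \<in> U" for u U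
    using S that unfolding selection_def by blast
  have "c < sum (wc(v := 0)) U"
    if u: "u < Suc v" "u \<notin> insert v D" "U \<subseteq> {..<n}" "hits U" "u \<in> U" for u U
  proof (rule ccontr)
    assume "\<not> ?thesis"
    then have le: "sum (wc(v := 0)) U \<le> c" by simp
    have finU: "finite U" using u finite_subset by blast
    have "best < sum wc (insert v U)"
      using u v hits_mono[OF u(4), of "insert v U"] by (intro S4[of u]) auto
    also have "\<dots> = wc v + sum wc (U - {v})" by (rule sum.insert_remove[OF finU])
    also have "sum wc (U - {v}) = sum (wc(v := 0)) (U - {v})" by (intro sum.cong) auto
    also have "\<dots> = sum (wc(v := 0)) U" using finU by (intro sum.mono_neutral_left) auto
    finally show False using le c(2) by linarith
  qed
  moreover have "sum w (insert v D) + c \<le> sum w U" if U: "U \<subseteq> {..<n}" "hits U" for U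
  proof -
    have "sum w D + best \<le> sum w U" using S U unfolding selection_def by blast
    then show ?thesis using c(2) vD fin wcv by simp
  qed
  ultimately show ?thesis
    using S c(1) unfolding selection_def by auto
qed

text \<open>For a set through \<open>v\<close>, dropping the weight of \<open>v\<close> to zero
  lowers its weight by exactly \<open>wc v\<close>, and the result is still at least
  \<open>c\<close>.\<close>

lemma selection_reject:
  assumes S: "selection w D wc v best" and v: "v < n"
    and c: "hitting_value (wc(v := 0)) c" "best < c + wc v"
  shows "selection w D wc (Suc v) best"
proof -
  have "best < sum wc U" if U: "U \<subseteq> {..<n}" "hits U" "v \<in> U" for U
  proof -
    have finU: "finite U" using U finite_subset by blast
    have "c \<le> sum (wc(v := 0)) U" using c U unfolding hitting_value_def by blast
    also have "sum (wc(v := 0)) U = sum (wc(v := 0)) (U - {v})"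
      using finU by (intro sum.mono_neutral_right) auto
    also have "\<dots> = sum wc (U - {v})" by (intro sum.cong) auto
    also have "\<dots> = sum wc U - wc v" using finU U by (simp add: sum_diff1)
    finally show ?thesis using c by simp
  qed
  then show ?thesis
    using S unfolding selection_def by (auto simp: less_Suc_eq)
qed

text \<open>A set attaining \<open>best\<close> contains no rejected vertex, so it lies inside
  \<open>D\<close>, and \<open>hits\<close> is monotone. Since \<open>best\<close> is nonnegative,
  the bound carried by \<open>selection\<close> yields optimality of \<open>D\<close>.\<close>

lemma selection_final:
  assumes S: "selection w D wc n best" and w: "\<forall>v. 0 \<le> w v"
  shows "D \<subseteq> {..<n}" "hits D" "\<And>U. U \<subseteq> {..<n} \<Longrightarrow> hits U \<Longrightarrow> sum w D \<le> sum w U"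
proof -
  show D: "D \<subseteq> {..<n}" using S unfolding selection_def by blast
  obtain U where U: "U \<subseteq> {..<n}" "hits U" "sum wc U \<le> best"
    using S unfolding selection_def hitting_value_def by blast
  have "U \<subseteq> D"
    using S U unfolding selection_def by (metis lessThan_iff linorder_not_le subset_iff)
  then show "hits D" using U hits_mono by blast
  have "0 \<le> sum wc U" using S w unfolding selection_def by (auto intro!: sum_nonneg)
  show "sum w D \<le> sum w U'" if "U' \<subseteq> {..<n}" "hits U'" for U'
  proof -
    have "sum w D + best \<le> sum w U'" using S that unfolding selection_def by blast
    then show ?thesis using U(3) \<open>0 \<le> sum wc U\<close> by linarith
  qed
qed

section \<open>Cycles without branching vertices\<close>

text \<open>Lexicographic order by weight and index: ties are broken so that a cycle has exactly one
  unbeaten vertex. The negated comparison is the form available on the machine.\<close>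

definition beats :: "(nat \<Rightarrow> real) \<Rightarrow> nat \<Rightarrow> nat \<Rightarrow> bool" where
  "beats w u v \<longleftrightarrow> w u < w v \<or> \<not> w v < w u \<and> u < v"

text \<open>Both quantifiers range over a walk of \<open>n\<close> steps, which goes all around any
  cycle of \<open>nxt\<close>; this is what \<open>walk_body\<close> observes.\<close>

definition cycle_reps :: "(nat \<Rightarrow> real) \<Rightarrow> nat set" where
  "cycle_reps w = {v. v < n \<and> (\<exists>j<n. (nxt ^^ Suc j) v = v) \<and>
     (\<forall>j<n. \<not> beats w ((nxt ^^ Suc j) v) v)}"

definition periodic :: "nat set" where
  "periodic = {v. v < n \<and> (\<exists>i. (nxt ^^ Suc i) v = v)}"

lemma periodic_nxt:
  assumes "v \<in> periodic"
  shows "nxt v \<in> periodic" "inner v"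
proof -
  obtain i where i: "v < n" "(nxt ^^ Suc i) v = v" using assms unfolding periodic_def by blast
  have "nxt v \<noteq> n"
  proof
    assume "nxt v = n"
    then have "(nxt ^^ Suc i) v = n" by (simp only: funpow_Suc_right comp_apply funpow_nxt_n)
    then show False using i by simp
  qed
  then show "inner v" using nxt_not_inner by blast
  have "(nxt ^^ Suc i) (nxt v) = nxt ((nxt ^^ Suc i) v)" by (simp add: funpow_swap1)
  then have "(nxt ^^ Suc i) (nxt v) = nxt v" using i by simp
  then show "nxt v \<in> periodic" using \<open>nxt v \<noteq> n\<close> nxt_le[of v] unfolding periodic_def by auto
qed

lemma period_less:
  assumes "v \<in> periodic"
  shows "\<exists>j<n. (nxt ^^ Suc j) v = v"
proof -
  define i where "i = (LEAST i. (nxt ^^ Suc i) v = v)"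
  have i: "(nxt ^^ Suc i) v = v"
    unfolding i_def by (rule LeastI_ex) (use assms in \<open>auto simp: periodic_def\<close>)
  have least: "i \<le> j" if "(nxt ^^ Suc j) v = v" for j
    unfolding i_def using that by (rule Least_le)
  have in_per: "(nxt ^^ j) v \<in> periodic" for j
    by (induction j) (use assms periodic_nxt(1) in auto)
  have neq: "(nxt ^^ j) v \<noteq> (nxt ^^ l) v" if "j < l" "l \<le> i" for j l
  proof
    assume eq: "(nxt ^^ j) v = (nxt ^^ l) v"
    have "(nxt ^^ (Suc i - l + j)) v = (nxt ^^ (Suc i - l)) ((nxt ^^ l) v)"
      by (simp only: funpow_add comp_apply eq)
    also have "\<dots> = (nxt ^^ Suc i) v" using that by (intro funpow_diff[symmetric]) simp
    finally have "(nxt ^^ Suc (i - l + j)) v = v" using i that by (simp add: Suc_diff_le)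
    from least[OF this] show False using that by simp
  qed
  have "inj_on (\<lambda>j. (nxt ^^ j) v) {..i}"
    by (intro inj_onI) (metis atMost_iff linorder_neqE_nat neq)
  moreover have "(\<lambda>j. (nxt ^^ j) v) ` {..i} \<subseteq> {..<n}"
    using in_per unfolding periodic_def by blast
  ultimately have "card {..i} \<le> card {..<n}" by (rule card_inj_on_le) simp
  then have "i < n" by simp
  then show ?thesis using i by blast
qed

lemma orbit_periodic: "v \<in> periodic \<Longrightarrow> (nxt ^^ j) v \<in> periodic"
  by (induction j) (auto simp: periodic_nxt)

lemma orbit_short:
  assumes "v \<in> periodic"
  shows "\<exists>i<n. (nxt ^^ j) v = (nxt ^^ Suc i) v"
proof -
  obtain p where p: "p < n" "(nxt ^^ Suc p) v = v" using period_less[OF assms] by blast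
  show ?thesis
  proof (cases "j mod Suc p")
    case 0
    then have "(nxt ^^ j) v = v"
      using funpow_mod_eq[OF p(2), of j] by simp
    then show ?thesis using p by metis
  next
    case (Suc i)
    then have "(nxt ^^ j) v = (nxt ^^ Suc i) v" using funpow_mod_eq[OF p(2), of j] by metis
    moreover have "i < p" using Suc mod_less_divisor[of "Suc p" j] by linarith
    ultimately show ?thesis using p by (metis less_trans)
  qed
qed

lemma orbit_back:
  assumes "v \<in> periodic"
  shows "\<exists>i. (nxt ^^ i) ((nxt ^^ j) v) = v"
proof -
  obtain p where p: "(nxt ^^ Suc p) v = v" using assms unfolding periodic_def by blast
  have "(nxt ^^ (j * Suc p)) v = v"
    using funpow_mod_eq[OF p, of "j * Suc p"] unfolding mod_mult_self2_is_0 by (metis funpow_0)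
  moreover have "(nxt ^^ (j * Suc p)) v = (nxt ^^ (j * Suc p - j)) ((nxt ^^ j) v)"
    by (rule funpow_diff) simp
  ultimately show ?thesis by metis
qed

lemma residual_cycle_inner:
  assumes h: "hits U" and z: "(z, z) \<in> (residual U)\<^sup>+"
  shows "inner z" 
proof -
  from z obtain y where "(y, z) \<in> residual U" by (meson tranclE)
  then obtain k where "k < e" "dst k = z" unfolding residual_def by blast
  then have "0 < indeg z" "z < n" using dst_less unfolding indeg_def by (auto simp: card_gt_0_iff)
  moreover have "z \<notin> branching" using h z unfolding hits_def by blast
  ultimately show ?thesis unfolding branching_def by blast
qed

text \<open>A surviving cycle avoids branching vertices, so all its vertices are inner and it is a
  cycle of \<open>nxt\<close>. Its smallest vertex with respect to \<open>beats\<close> would be in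
  \<open>cycle_reps\<close>, hence deleted.\<close>

lemma reps_acyclic:
  assumes h: "hits D"
  shows "acyclic (residual (D \<union> cycle_reps w))"
  unfolding acyclic_def
proof (intro allI notI)
  let ?R = "residual (D \<union> cycle_reps w)"
  fix x assume x: "(x, x) \<in> ?R\<^sup>+"
  have h': "hits (D \<union> cycle_reps w)" using hits_mono[OF h] by simp
  \<comment> \<open>The strong component of \<open>x\<close>; it is closed under \<open>nxt\<close>
    because each of its vertices has a unique out-arc.\<close>
  define Z where "Z = {z. (x, z) \<in> ?R\<^sup>+ \<and> (z, x) \<in> ?R\<^sup>+}"
  have ends: "z < n \<and> z \<notin> D \<union> cycle_reps w" if "(y, z) \<in> ?R" for y z
    using that dst_less unfolding residual_def by auto
  have Z_ends: "z < n \<and> z \<notin> D \<union> cycle_reps w" if "z \<in> Z" for z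
  proof -
    have "(x, z) \<in> ?R\<^sup>+" using that unfolding Z_def by simp
    then show ?thesis by (rule tranclE) (use ends in blast)+
  qed
  have Z_step: "y = nxt z" if "z \<in> Z" "(z, y) \<in> ?R" for y z
  proof -
    have "(z, z) \<in> ?R\<^sup>+" using that unfolding Z_def by (auto intro: trancl_trans)
    from residual_cycle_inner[OF h' this] have "inner z" .
    then show ?thesis using that(2) nxt_src unfolding residual_def by auto
  qed
  have Z_nxt: "nxt z \<in> Z" if "z \<in> Z" for z
  proof -
    have xz: "(x, z) \<in> ?R\<^sup>+" "(z, x) \<in> ?R\<^sup>+" using that unfolding Z_def by simp_all
    then obtain y where y: "(z, y) \<in> ?R" "(y, x) \<in> ?R\<^sup>*" by (meson tranclD)
    then have "(x, y) \<in> ?R\<^sup>+" using xz by (meson trancl.trancl_into_trancl)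
    moreover have "(y, x) \<in> ?R\<^sup>+" using y(2) x by (meson rtrancl_trancl_trancl)
    ultimately show ?thesis using Z_step[OF that y(1)] unfolding Z_def by simp
  qed
  have finZ: "finite Z" using Z_ends by (intro finite_subset[of Z "{..<n}"]) auto
  have xZ: "x \<in> Z" using x unfolding Z_def by simp
  \<comment> \<open>Minimizing the weight first and the index second yields the least element for
    \<open>beats\<close>.\<close>
  define c where "c = Min (w ` Z)"
  define y where "y = Min {z \<in> Z. w z = c}"
  have "c \<in> w ` Z" using finZ xZ unfolding c_def by (intro Min_in) auto
  then have "y \<in> {z \<in> Z. w z = c}" unfolding y_def using finZ by (intro Min_in) auto
  then have y: "y \<in> Z" "w y = c" by auto
  have "\<not> beats w z y" if "z \<in> Z" for z
  proof -
    have "c \<le> w z" using that finZ unfolding c_def by simp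
    moreover have "y \<le> z" if "w z = c"
      using that \<open>z \<in> Z\<close> finZ unfolding y_def by (intro Min_le) auto
    ultimately show ?thesis using y unfolding beats_def by force
  qed
  moreover have orbit: "(nxt ^^ j) y \<in> Z" for j
    by (induction j) (use y Z_nxt in auto)
  moreover have "\<exists>i. (nxt ^^ Suc i) y = z" if "(y, z) \<in> ?R\<^sup>+" "z \<in> Z" for z
    using that
  proof (induction rule: trancl_induct)
    case (base z)
    then show ?case using Z_step[OF y(1)] by (auto intro!: exI[of _ 0])
  next
    case (step u z)
    have "(x, u) \<in> ?R\<^sup>+" using y step(1) unfolding Z_def by (auto intro: trancl_trans)
    moreover have "(u, x) \<in> ?R\<^sup>+" using step unfolding Z_def by (auto intro: trancl_into_trancl2)
    ultimately have "u \<in> Z" unfolding Z_def by simp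
    then obtain i where "(nxt ^^ Suc i) y = u" using step.IH by blast
    then have "(nxt ^^ Suc (Suc i)) y = z" using Z_step[OF \<open>u \<in> Z\<close> step(2)] by simp
    then show ?case by blast
  qed
  moreover have "(y, y) \<in> ?R\<^sup>+" using y unfolding Z_def by (auto intro: trancl_trans)
  ultimately have "y \<in> periodic" using y Z_ends unfolding periodic_def by blast
  then have "y \<in> cycle_reps w"
    using period_less orbit \<open>\<And>z. z \<in> Z \<Longrightarrow> \<not> beats w z y\<close> Z_ends[OF y(1)]
    unfolding cycle_reps_def by blast
  then show False using Z_ends[OF y(1)] by blast
qed

text \<open>The only out-arcs of a periodic vertex lead to periodic vertices, and a branching vertex
  is not periodic. Traced backwards, a cycle through a branching vertex therefore never meets a
  periodic vertex, and restoring those creates no such cycle.\<close>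

lemma hits_Diff_periodic:
  assumes "acyclic (residual U)"
  shows "hits (U - periodic)"
  unfolding hits_def
proof (intro ballI notI)
  fix a assume a: "a \<in> branching" and cyc: "(a, a) \<in> (residual (U - periodic))\<^sup>+"
  have aP: "a \<notin> periodic" using periodic_nxt(2) branching_not_inner[OF a] by blast
  have arc: "u \<notin> periodic \<and> (u, v) \<in> residual U"
    if "(u, v) \<in> residual (U - periodic)" "v \<notin> periodic" for u v
  proof -
    from that obtain k where k: "k < e" "src k = u" "dst k = v" "u \<notin> U - periodic" "v \<notin> U - periodic"
      unfolding residual_def by blast
    have "u \<notin> periodic"
      using periodic_nxt[of u] nxt_src[of k] k that(2) by auto
    then show ?thesis using k that(2) unfolding residual_def by blast
  qed
  have "z \<notin> periodic \<and> (z, a) \<in> (residual U)\<^sup>+" if "(z, a) \<in> (residual (U - periodic))\<^sup>+" for z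
    using that
  proof (induction rule: converse_trancl_induct)
    case (base y)
    then show ?case using arc aP by blast
  next
    case (step y z)
    then show ?case using arc[of y z] by (blast intro: trancl_into_trancl2)
  qed
  then show False using cyc assms unfolding acyclic_def by blast
qed

text \<open>\<open>U\<close> meets every cycle of \<open>nxt\<close>. Sending each representative to
  a vertex of \<open>U\<close> on its own cycle is injective, since two representatives on one cycle
  do not beat each other and so coincide, and the weight does not decrease.\<close>

lemma reps_le:
  assumes w: "\<forall>v. 0 \<le> w v" and ac: "acyclic (residual U)"
  shows "sum w (cycle_reps w) \<le> sum w (U \<inter> periodic)"
proof -
  have P: "cycle_reps w \<subseteq> periodic" unfolding cycle_reps_def periodic_def by blast
  have "\<exists>j. (nxt ^^ j) v \<in> U" if v: "v \<in> periodic" for v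
  proof (rule ccontr)
    assume no: "\<not> ?thesis"
    have "(v, (nxt ^^ Suc j) v) \<in> (residual U)\<^sup>+" for j
    proof (induction j)
      have arc: "(u, nxt u) \<in> residual U" if "u = (nxt ^^ j) v" for u j
      proof -
        have "u \<in> periodic" using that orbit_periodic[OF v] by simp
        then have "nxt u < n" using periodic_nxt(1) unfolding periodic_def by blast
        then obtain k where k: "k < e" "src k = u" "nxt u = dst k" using nxt_cases[of u] by auto
        have "nxt u = (nxt ^^ Suc j) v" using that by simp
        then have "u \<notin> U" "nxt u \<notin> U" using no that by metis+
        then show ?thesis using k unfolding residual_def by (intro CollectI exI[of _ k]) simp
      qed
      case 0
      show ?case using arc[of v 0] by auto
      case (Suc j)
      have "((nxt ^^ Suc j) v, (nxt ^^ Suc (Suc j)) v) \<in> residual U"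
        using arc[OF refl, of "Suc j"] by simp
      with Suc show ?case by (rule trancl_into_trancl)
    qed
    moreover obtain i where "(nxt ^^ Suc i) v = v" using v unfolding periodic_def by blast
    ultimately have "(v, v) \<in> (residual U)\<^sup>+" by metis
    then show False using ac unfolding acyclic_def by blast
  qed
  then obtain g where g: "\<And>v. v \<in> periodic \<Longrightarrow> (nxt ^^ g v) v \<in> U" by metis
  let ?h = "\<lambda>v. (nxt ^^ g v) v"
  have nobeat: "\<not> beats w ((nxt ^^ j) v) v" if v: "v \<in> cycle_reps w" for v j
  proof -
    obtain i where "i < n" "(nxt ^^ j) v = (nxt ^^ Suc i) v" using orbit_short v P by blast
    then show ?thesis using v unfolding cycle_reps_def by simp
  qed
  have inj: "inj_on ?h (cycle_reps w)"
  proof (rule inj_onI)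
    have half: "\<not> beats w u v" if uv: "u \<in> cycle_reps w" "v \<in> cycle_reps w" "?h u = ?h v" for u v
    proof -
      obtain i where "(nxt ^^ i) (?h u) = u" using orbit_back uv(1) P by blast
      then have "(nxt ^^ (i + g v)) v = u" using uv(3) by (simp add: funpow_add)
      then show ?thesis using nobeat[OF uv(2)] by metis
    qed
    fix u v assume "u \<in> cycle_reps w" "v \<in> cycle_reps w" "?h u = ?h v"
    then have "\<not> beats w u v" "\<not> beats w v u" using half by simp_all
    then show "u = v" unfolding beats_def by linarith
  qed
  have "sum w (cycle_reps w) \<le> (\<Sum>v\<in>cycle_reps w. w (?h v))"
    using nobeat unfolding beats_def by (intro sum_mono) (meson not_less)
  also have "\<dots> = sum w (?h ` cycle_reps w)" using inj by (simp add: sum.reindex)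
  also have "\<dots> \<le> sum w (U \<inter> periodic)"
  proof (rule sum_mono2)
    show "finite (U \<inter> periodic)" by (simp add: periodic_def)
    show "?h ` cycle_reps w \<subseteq> U \<inter> periodic" using g P orbit_periodic by blast
  qed (use w in auto)
  finally show ?thesis .
qed

text \<open>The non-periodic part of a competitor \<open>U\<close> pays for \<open>D\<close>, its
  periodic part for the representatives.\<close>

lemma optimal_union_reps:
  assumes w: "\<forall>v. 0 \<le> w v" and D: "D \<subseteq> {..<n}"
    and opt: "\<And>U. U \<subseteq> {..<n} \<Longrightarrow> hits U \<Longrightarrow> sum w D \<le> sum w U"
    and U: "U \<subseteq> {..<n}" "acyclic (residual U)"
  shows "sum w (D \<union> cycle_reps w) \<le> sum w U"
proof -
  have fin: "finite D" "finite (cycle_reps w)" "finite U"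
    using D U finite_subset[of _ "{..<n}"] by (auto simp: cycle_reps_def)
  have "sum w (D \<union> cycle_reps w) \<le> sum w D + sum w (cycle_reps w)"
    using fin w by (subst sum_Un) (auto simp: sum_nonneg)
  also have "\<dots> \<le> sum w (U - periodic) + sum w (U \<inter> periodic)"
    using opt[OF _ hits_Diff_periodic[OF U(2)]] U(1) reps_le[OF w U(2)] by (intro add_mono) auto
  also have "\<dots> = sum w U"
    using fin(3) sum.Int_Diff[of U w periodic] by simp
  finally show ?thesis .
qed

end

section \<open>Total correctness with time bounds\<close>

text \<open>As \<open>runs\<close> is deterministic, one terminating run with the required property
  already means total correctness.\<close>

definition wp :: "program \<Rightarrow> nat \<Rightarrow> (memory \<Rightarrow> bool) \<Rightarrow> memory \<Rightarrow> bool" where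
  "wp P T Q s \<longleftrightarrow> (\<exists>t s'. runs P s t s' \<and> t \<le> T \<and> Q s')"

primrec nat_writes :: "program \<Rightarrow> string set" where
  "nat_writes Skip = {}"
| "nat_writes (NSet x i a) = {x}"
| "nat_writes (RSet x i a) = {}"
| "nat_writes (Seq P Q) = nat_writes P \<union> nat_writes Q"
| "nat_writes (Cond b P Q) = nat_writes P \<union> nat_writes Q"
| "nat_writes (While b P) = nat_writes P"

primrec real_writes :: "program \<Rightarrow> string set" where
  "real_writes Skip = {}"
| "real_writes (NSet x i a) = {}"
| "real_writes (RSet x i a) = {x}"
| "real_writes (Seq P Q) = real_writes P \<union> real_writes Q"
| "real_writes (Cond b P Q) = real_writes P \<union> real_writes Q"
| "real_writes (While b P) = real_writes P"

definition same_except :: "string set \<Rightarrow> string set \<Rightarrow> memory \<Rightarrow> memory \<Rightarrow> bool" where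
  "same_except N R s s' \<longleftrightarrow>
     (\<forall>x. x \<notin> N \<longrightarrow> nats s' x = nats s x) \<and> (\<forall>x. x \<notin> R \<longrightarrow> reals s' x = reals s x)"

lemma same_exceptD:
  assumes "same_except N R s s'"
  shows "x \<notin> N \<Longrightarrow> nats s' x = nats s x" "x \<notin> R \<Longrightarrow> reals s' x = reals s x"
  using assms by (auto simp: same_except_def)

lemma runs_same_except: "runs P s t s' \<Longrightarrow> same_except (nat_writes P) (real_writes P) s s'"
proof (induction rule: runs.induct)
  case (Seq P s t s' Q u s'')
  then show ?case by (auto simp: same_except_def)
qed (auto simp: same_except_def nset_def rset_def)

lemma nats_nset [simp]: "nats (nset x i v s) y = (if y = x then (nats s x)(i := v) else nats s y)"
  by (simp add: nset_def)

lemma reals_nset [simp]: "reals (nset x i v s) = reals s"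
  by (simp add: nset_def)

lemma nats_rset [simp]: "nats (rset x i v s) = nats s"
  by (simp add: rset_def)

lemma reals_rset [simp]: "reals (rset x i v s) y = (if y = x then (reals s x)(i := v) else reals s y)"
  by (simp add: rset_def)

text \<open>Weakening also supplies the frame condition, so that specifications need not list the
  arrays that a program leaves alone.\<close>

lemma wp_mono:
  assumes "wp P T Q s"
    and "\<And>s'. same_except (nat_writes P) (real_writes P) s s' \<Longrightarrow> Q s' \<Longrightarrow> Q' s'"
    and "T \<le> T'"
  shows "wp P T' Q' s"
  using assms runs_same_except unfolding wp_def by (meson le_trans)

lemma wp_seq:
  assumes "wp P T (\<lambda>s'. wp P' U Q s') s" "T + U \<le> V"
  shows "wp (Seq P P') V Q s"
  using assms unfolding wp_def by (meson runs.Seq add_mono le_trans)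

lemma wp_cond:
  assumes "bval b s \<Longrightarrow> wp P T Q s" "\<not> bval b s \<Longrightarrow> wp P' T Q s" "Suc T \<le> U"
  shows "wp (Cond b P P') U Q s"
proof (cases "bval b s")
  case True
  then obtain t s' where "runs P s t s'" "t \<le> T" "Q s'" using assms unfolding wp_def by blast
  then show ?thesis using runs.CondT[OF True] assms(3) unfolding wp_def by fastforce
next
  case False
  then obtain t s' where "runs P' s t s'" "t \<le> T" "Q s'" using assms unfolding wp_def by blast
  then show ?thesis using runs.CondF[OF False] assms(3) unfolding wp_def by fastforce
qed

primrec loop_free :: "program \<Rightarrow> bool" where
  "loop_free Skip = True"
| "loop_free (NSet x i a) = True"
| "loop_free (RSet x i a) = True"
| "loop_free (Seq P Q) = (loop_free P \<and> loop_free Q)"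
| "loop_free (Cond b P Q) = (loop_free P \<and> loop_free Q)"
| "loop_free (While b P) = False"

text \<open>Lets the simplifier compute the final memory of straight-line code. The equation for
  \<open>While\<close> is a dummy, excluded by \<open>loop_free\<close>.\<close>

primrec exec :: "program \<Rightarrow> memory \<Rightarrow> memory" where
  "exec Skip s = s"
| "exec (NSet x i a) s = nset x (nval i s) (nval a s) s"
| "exec (RSet x i a) s = rset x (nval i s) (rval a s) s"
| "exec (Seq P Q) s = exec Q (exec P s)"
| "exec (Cond b P Q) s = (if bval b s then exec P s else exec Q s)"
| "exec (While b P) s = s"

primrec steps :: "program \<Rightarrow> nat" where
  "steps Skip = 1"
| "steps (NSet x i a) = 1"
| "steps (RSet x i a) = 1"
| "steps (Seq P Q) = steps P + steps Q"
| "steps (Cond b P Q) = 1 + max (steps P) (steps Q)"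
| "steps (While b P) = 0"

lemma runs_exec:
  assumes "loop_free P"
  shows "\<exists>t\<le>steps P. runs P s t (exec P s)"
  using assms
proof (induction P arbitrary: s)
  case (Seq P Q)
  then show ?case by (metis add_mono exec.simps(4) loop_free.simps(4) runs.Seq steps.simps(4))
next
  case (Cond b P Q)
  show ?case
  proof (cases "bval b s")
    case True
    obtain t where "t \<le> steps P" "runs P s t (exec P s)" using Cond by auto
    then show ?thesis using True runs.CondT[OF True] by (intro exI[of _ "1 + t"]) auto
  next
    case False
    obtain t where "t \<le> steps Q" "runs Q s t (exec Q s)" using Cond by auto
    then show ?thesis using False runs.CondF[OF False] by (intro exI[of _ "1 + t"]) auto
  qed
next
  case Skip
  show ?case using runs.Skip by (auto intro!: exI[of _ 1])
next
  case (NSet x i a)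
  show ?case using runs.NSet[of x i a s] by (auto intro!: exI[of _ 1])
next
  case (RSet x i a)
  show ?case using runs.RSet[of x i a s] by (auto intro!: exI[of _ 1])
qed simp

lemma wp_loop_free:
  assumes "loop_free P" "steps P \<le> T" "Q (exec P s)"
  shows "wp P T Q s"
  using runs_exec[OF assms(1), of s] assms unfolding wp_def by (meson le_trans)

lemma wp_seq_loop_free:
  assumes "loop_free P" "wp P' U Q (exec P s)" "steps P + U \<le> V"
  shows "wp (Seq P P') V Q s"
  using wp_seq[OF wp_loop_free[OF assms(1) order.refl] assms(3)] assms(2) by simp

abbreviation scalar :: "string \<Rightarrow> nat_expr" where
  "scalar x \<equiv> NGet x (NConst 0)"

definition for_loop :: "string \<Rightarrow> string \<Rightarrow> program \<Rightarrow> program" where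
  "for_loop i b P = Seq (NSet i (NConst 0) (NConst 0))
     (While (NLess (scalar i) (scalar b)) (Seq P (NSet i (NConst 0) (NAdd (scalar i) (NConst 1)))))"

lemma writes_for_loop [simp]:
  "nat_writes (for_loop i b P) = insert i (nat_writes P)"
  "real_writes (for_loop i b P) = real_writes P"
  by (auto simp: for_loop_def)

text \<open>The body re-establishes the invariant for the memory in which the counter has already
  been advanced. Each round adds a test and an increment to \<open>T\<close>; the final
  \<open>2\<close> stands for the initialization and the failing test.\<close>

lemma wp_for_loop:
  assumes i: "i \<notin> nat_writes P" and b: "b \<notin> nat_writes P" "b \<noteq> i" and N: "nats s b 0 = N"
    and init: "I 0 (nset i 0 0 s)"
    and step: "\<And>j s'. j < N \<Longrightarrow> same_except (insert i (nat_writes P)) (real_writes P) s s' \<Longrightarrow>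
       nats s' i 0 = j \<Longrightarrow> I j s' \<Longrightarrow> wp P T (\<lambda>s''. I (Suc j) (nset i 0 (Suc j) s'')) s'"
    and fin: "\<And>s'. same_except (insert i (nat_writes P)) (real_writes P) s s' \<Longrightarrow> I N s' \<Longrightarrow> Q s'"
    and T': "N * (T + 2) + 2 \<le> T'"
  shows "wp (for_loop i b P) T' Q s"
proof -
  let ?same = "same_except (insert i (nat_writes P)) (real_writes P)"
  let ?inc = "NSet i (NConst 0) (NAdd (scalar i) (NConst 1))"
  let ?W = "While (NLess (scalar i) (scalar b)) (Seq P ?inc)"
  \<comment> \<open>The induction runs over the number \<open>d\<close> of rounds still to
    come.\<close>
  have loop: "\<exists>t s''. runs ?W s' t s'' \<and> t \<le> d * (T + 2) + 1 \<and> ?same s s'' \<and> I N s''"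
    if "?same s s'" "nats s' i 0 = N - d" "I (N - d) s'" "d \<le> N" for d s'
    using that
  proof (induction d arbitrary: s')
    case 0
    have "nats s' b 0 = N" using same_exceptD(1)[OF 0(1), of b] b N by simp
    then have "\<not> bval (NLess (scalar i) (scalar b)) s'" using 0 by simp
    from runs.WhileF[OF this] show ?case using 0 by (intro exI[of _ 1] exI[of _ s']) simp
  next
    case (Suc d)
    let ?j = "N - Suc d"
    have "nats s' b 0 = N" using same_exceptD(1)[OF Suc.prems(1), of b] b N by simp
    then have cond: "bval (NLess (scalar i) (scalar b)) s'" using Suc.prems by simp
    have Sj: "Suc ?j = N - d" using Suc.prems by simp
    have "?j < N" using Suc.prems(4) by simp
    from step[OF this Suc.prems(1-3)]
    obtain t s1 where P: "runs P s' t s1" "t \<le> T" "I (N - d) (nset i 0 (N - d) s1)"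
      unfolding wp_def Sj by blast
    have s1: "same_except (nat_writes P) (real_writes P) s' s1" using runs_same_except[OF P(1)] .
    then have "nats s1 i 0 = ?j" using i Suc.prems(2) by (simp add: same_except_def)
    then have "nset i (nval (NConst 0) s1) (nval (NAdd (scalar i) (NConst 1)) s1) s1
        = nset i 0 (N - d) s1" using Sj by simp
    then have "runs ?inc s1 1 (nset i 0 (N - d) s1)"
      using runs.NSet[of i "NConst 0" "NAdd (scalar i) (NConst 1)" s1] by simp
    from runs.Seq[OF P(1) this] have body: "runs (Seq P ?inc) s' (t + 1) (nset i 0 (N - d) s1)" .
    have "?same s (nset i 0 (N - d) s1)"
      using Suc.prems(1) s1 by (auto simp: same_except_def)
    moreover have "nats (nset i 0 (N - d) s1) i 0 = N - d" by simp
    moreover have "d \<le> N" using Suc.prems(4) by simp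
    ultimately obtain u s2 where
      u: "runs ?W (nset i 0 (N - d) s1) u s2" "u \<le> d * (T + 2) + 1" "?same s s2" "I N s2"
      using Suc.IH P(3) by blast
    have "1 + (t + 1) + u \<le> Suc d * (T + 2) + 1" using P(2) u(2) by simp
    then show ?case using runs.WhileT[OF cond body u(1)] u(3,4) by blast
  qed
  have "?same s (nset i 0 0 s)" by (auto simp: same_except_def)
  from loop[OF this, of N] init obtain t s' where
    "runs ?W (nset i 0 0 s) t s'" "t \<le> N * (T + 2) + 1" "?same s s'" "I N s'" by auto
  moreover have "runs (NSet i (NConst 0) (NConst 0)) s 1 (nset i 0 0 s)"
    using runs.NSet[of i "NConst 0" "NConst 0" s] by simp
  ultimately have "runs (for_loop i b P) s (1 + t) s'" "1 + t \<le> T'" "Q s'"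
    unfolding for_loop_def using T' fin by (blast intro: runs.Seq, linarith, blast)
  then show ?thesis unfolding wp_def by blast
qed

section \<open>The dynamic program over bit masks\<close>

text \<open>
  Arrays: \<open>s\<close>, \<open>d\<close> tails and heads in the chosen orientation, with in-degrees \<open>p\<close> and out-degrees
  \<open>q\<close>; \<open>b\<close> marks branching vertices, \<open>r\<close> is \<open>2\<close> to the power of their rank, \<open>f\<close> is \<open>nxt\<close>;
  \<open>h\<close>, \<open>y\<close> are the half and the parity of a mask (there is no division); \<open>z\<close> is nonzero outside
  the unplaced vertices of the current mask \<open>M\<close>; \<open>w\<close> are the current weights, \<open>x\<close> the cut values
  and \<open>T\<close> the table, of length \<open>F\<close>. Real constants are not available, so zero is written as a
  difference.
\<close>

abbreviation eq_test :: "nat_expr \<Rightarrow> nat_expr \<Rightarrow> bool_expr" where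
  "eq_test a b \<equiv> BAnd (BNot (NLess a b)) (BNot (NLess b a))"

text \<open>The mask is consumed from its lowest bit, one halving per branching vertex in increasing
  order, so the parity read at \<open>v\<close> is the bit at position
  \<open>rank v\<close>.\<close>

definition decode_prog :: program where
  "decode_prog = Seq (NSet ''m'' (NConst 0) (scalar ''M''))
     (for_loop ''v'' ''verts''
       (Cond (NLess (NConst 0) (NGet ''b'' (scalar ''v'')))
         (Seq (NSet ''z'' (scalar ''v'') (NGet ''y'' (scalar ''m'')))
           (NSet ''m'' (NConst 0) (NGet ''h'' (scalar ''m''))))
         (NSet ''z'' (scalar ''v'') (NConst 1))))"

definition reset_prog :: program where
  "reset_prog = for_loop ''v'' ''verts''
     (RSet ''x'' (scalar ''v'') (RSub (RGet ''c'' (NConst 0)) (RGet ''c'' (NConst 0))))"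

definition relax_prog :: program where
  "relax_prog = Seq (RSet ''c'' (NConst 0) (RSub (RGet ''c'' (NConst 0)) (RGet ''c'' (NConst 0))))
     (Seq (for_loop ''k'' ''arcs''
       (Cond (eq_test (NGet ''d'' (scalar ''k'')) (scalar ''v''))
         (Cond (NLess (NConst 1) (NGet ''q'' (NGet ''s'' (scalar ''k''))))
           (Cond (NLess (NGet ''z'' (NGet ''s'' (scalar ''k''))) (NConst 1))
             (RSet ''c'' (NConst 0) (RAdd (RGet ''c'' (NConst 0)) (RGet ''w'' (scalar ''v''))))
             Skip)
           (RSet ''c'' (NConst 0)
             (RAdd (RGet ''c'' (NConst 0)) (RGet ''x'' (NGet ''s'' (scalar ''k''))))))
         Skip))
     (Cond (RLess (RGet ''w'' (scalar ''v'')) (RGet ''c'' (NConst 0)))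
       (RSet ''x'' (scalar ''v'') (RGet ''w'' (scalar ''v'')))
       (RSet ''x'' (scalar ''v'') (RGet ''c'' (NConst 0)))))"

definition cutval_prog :: program where
  "cutval_prog = Seq reset_prog
     (for_loop ''t'' ''verts'' (for_loop ''v'' ''verts'' relax_prog))"

definition update_prog :: program where
  "update_prog = for_loop ''v'' ''verts''
     (Cond (BAnd (NLess (NConst 0) (NGet ''b'' (scalar ''v'')))
         (NLess (NGet ''z'' (scalar ''v'')) (NConst 1)))
       (Cond (RLess (RAdd (RGet ''T'' (scalar ''M'')) (RGet ''x'' (scalar ''v'')))
           (RGet ''T'' (NAdd (scalar ''M'') (NGet ''r'' (scalar ''v'')))))
         (RSet ''T'' (NAdd (scalar ''M'') (NGet ''r'' (scalar ''v'')))
           (RAdd (RGet ''T'' (scalar ''M'')) (RGet ''x'' (scalar ''v''))))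
         Skip)
       Skip)"

definition mask_prog :: program where
  "mask_prog = Seq decode_prog (Seq cutval_prog update_prog)"

text \<open>The total weight serves as infinity for unfilled entries. It is attained by deleting all
  vertices, so \<open>table_upper\<close> holds from the start.\<close>

definition value_prog :: program where
  "value_prog =
     Seq (RSet ''W'' (NConst 0) (RSub (RGet ''W'' (NConst 0)) (RGet ''W'' (NConst 0))))
     (Seq (for_loop ''v'' ''verts''
       (RSet ''W'' (NConst 0) (RAdd (RGet ''W'' (NConst 0)) (RGet ''w'' (scalar ''v'')))))
     (Seq (for_loop ''M'' ''F'' (RSet ''T'' (scalar ''M'') (RGet ''W'' (NConst 0))))
     (Seq (RSet ''T'' (NConst 0) (RSub (RGet ''W'' (NConst 0)) (RGet ''W'' (NConst 0))))
     (Seq (for_loop ''M'' ''F'' mask_prog)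
       (RSet ''g'' (NConst 0) (RGet ''T'' (NSub (scalar ''F'') (NConst 1))))))))"

definition select_body :: program where
  "select_body =
     Seq (RSet ''sv'' (NConst 0) (RGet ''w'' (scalar ''j'')))
     (Seq (RSet ''w'' (scalar ''j'') (RSub (RGet ''sv'' (NConst 0)) (RGet ''sv'' (NConst 0))))
     (Seq value_prog
       (Cond (RLess (RGet ''best'' (NConst 0)) (RAdd (RGet ''g'' (NConst 0)) (RGet ''sv'' (NConst 0))))
         (RSet ''w'' (scalar ''j'') (RGet ''sv'' (NConst 0)))
         (Seq (NSet ''out'' (scalar ''j'') (NConst 1))
           (RSet ''best'' (NConst 0) (RGet ''g'' (NConst 0)))))))"

definition select_prog :: program where
  "select_prog = Seq value_prog (Seq (RSet ''best'' (NConst 0) (RGet ''g'' (NConst 0)))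
     (for_loop ''j'' ''verts'' select_body))"

definition walk_body :: program where
  "walk_body = Seq (NSet ''u'' (NConst 0) (NGet ''f'' (scalar ''u'')))
     (Seq (Cond (eq_test (scalar ''u'') (scalar ''j'')) (NSet ''on'' (NConst 0) (NConst 1)) Skip)
       (Cond (BNot (BAnd
           (BNot (RLess (RGet ''weight'' (scalar ''u'')) (RGet ''weight'' (scalar ''j''))))
           (BNot (BAnd (BNot (RLess (RGet ''weight'' (scalar ''j'')) (RGet ''weight'' (scalar ''u''))))
             (NLess (scalar ''u'') (scalar ''j''))))))
         (NSet ''beaten'' (NConst 0) (NConst 1)) Skip))"

definition reps_prog :: program where
  "reps_prog = for_loop ''j'' ''verts''
     (Seq (NSet ''u'' (NConst 0) (scalar ''j''))
     (Seq (NSet ''on'' (NConst 0) (NConst 0))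
     (Seq (NSet ''beaten'' (NConst 0) (NConst 0))
     (Seq (for_loop ''k'' ''verts'' walk_body)
       (Cond (BAnd (NLess (NConst 0) (scalar ''on'')) (NLess (scalar ''beaten'') (NConst 1)))
         (NSet ''out'' (scalar ''j'') (NConst 1)) Skip)))))"

lemma card_Suc_filter:
  "card {k. k < Suc j \<and> P k} = card {k. k < j \<and> P k} + (if P j then 1 else 0)"
proof -
  have "{k. k < Suc j \<and> P k} = {k. k < j \<and> P k} \<union> (if P j then {j} else {})"
    by (auto simp: less_Suc_eq)
  then show ?thesis by (simp add: card_Un_disjoint)
qed

lemma sum_Suc_filter:
  fixes g :: "nat \<Rightarrow> real"
  shows "(\<Sum>k | k < Suc j \<and> P k. g k) = (\<Sum>k | k < j \<and> P k. g k) + (if P j then g j else 0)"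
proof -
  have "{k. k < Suc j \<and> P k} = {k. k < j \<and> P k} \<union> (if P j then {j} else {})"
    by (auto simp: less_Suc_eq)
  then show ?thesis by (simp add: sum.union_disjoint)
qed

section \<open>Correctness and running time of the dynamic program\<close>

context arc_list
begin

text \<open>The successor array is fixed at index \<open>n\<close> as well, because a walk along it
  may fall into \<open>n\<close> and has to stay there.\<close>

definition prepared :: "memory \<Rightarrow> bool" where
  "prepared s \<longleftrightarrow> nats s ''verts'' 0 = n \<and> nats s ''arcs'' 0 = e \<and> nats s ''F'' 0 = masks \<and>
     (\<forall>k<e. nats s ''s'' k = src k \<and> nats s ''d'' k = dst k) \<and>
     (\<forall>v. nats s ''q'' v = outdeg v) \<and>
     (\<forall>v<n. 0 < nats s ''b'' v \<longleftrightarrow> v \<in> branching) \<and>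
     (\<forall>v\<in>branching. nats s ''r'' v = 2 ^ rank v) \<and>
     (\<forall>M<masks. nats s ''h'' M = M div 2 \<and> nats s ''y'' M = M mod 2) \<and>
     (\<forall>v\<le>n. nats s ''f'' v = nxt v)"

definition prepared_arrays :: "string set" where
  "prepared_arrays = {''verts'', ''arcs'', ''F'', ''s'', ''d'', ''q'', ''b'', ''r'', ''h'', ''y'', ''f''}"

lemma prepared_same:
  assumes same: "same_except N R s s'" and "prepared s" and disj: "N \<inter> prepared_arrays = {}"
  shows "prepared s'"
proof -
  have eq: "nats s' x = nats s x" if "x \<in> prepared_arrays" for x
    using same_exceptD(1)[OF same] disj that by (meson disjoint_iff)
  have "nats s' ''verts'' = nats s ''verts''" "nats s' ''arcs'' = nats s ''arcs''"
    "nats s' ''F'' = nats s ''F''" "nats s' ''s'' = nats s ''s''" "nats s' ''d'' = nats s ''d''"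
    "nats s' ''q'' = nats s ''q''" "nats s' ''b'' = nats s ''b''" "nats s' ''r'' = nats s ''r''"
    "nats s' ''h'' = nats s ''h''" "nats s' ''y'' = nats s ''y''" "nats s' ''f'' = nats s ''f''"
    by (rule eq, simp add: prepared_arrays_def)+
  then show ?thesis using assms(2) unfolding prepared_def by simp
qed

lemma rank_Suc: "rank (Suc j) = rank j + (if j \<in> branching then 1 else 0)"
  using card_Suc_filter[of j "\<lambda>u. u \<in> branching"] unfolding rank_def by (simp add: conj_commute)

lemma rank_0: "rank 0 = 0"
  by (simp add: rank_def)

lemma decode_wp:
  assumes "prepared s" "nats s ''M'' 0 = M" "M < masks"
  shows "wp decode_prog (5 * n + 3) (\<lambda>s'. \<forall>v<n. 0 < nats s' ''z'' v \<longleftrightarrow> v \<notin> unplaced M) s"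
  unfolding decode_prog_def
proof (rule wp_seq_loop_free[where U = "5 * n + 2"], goal_cases)
  let ?I = "\<lambda>j s'. nats s' ''m'' 0 = M div 2 ^ rank j \<and> (\<forall>v<j. 0 < nats s' ''z'' v \<longleftrightarrow> v \<notin> unplaced M)"
  case 2
  show ?case
  proof (rule wp_for_loop[where I = ?I and N = n and T = 3], goal_cases)
    case (6 j s')
    have "prepared (nset ''m'' 0 M s)" using assms(1) by (simp add: prepared_def)
    then have set: "prepared s'" using prepared_same[OF 6(2)] assms by (simp add: prepared_arrays_def)
    \<comment> \<open>The arrays of halves and parities are known only below \<open>masks\<close>,
      so the shifted mask must stay in that range.\<close>
    have "M div 2 ^ rank j \<le> M" by simp
    then have lt: "M div 2 ^ rank j < masks" using assms(3) by (rule le_less_trans)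
    have "0 < M div 2 ^ rank j mod 2 \<longleftrightarrow> rank j \<in> set_decode M"
      by (simp add: set_decode_def odd_iff_mod_2_eq_one)
    then have y: "0 < nats s' ''y'' (M div 2 ^ rank j) \<longleftrightarrow> rank j \<in> set_decode M"
      using set lt by (simp add: prepared_def)
    have h: "nats s' ''h'' (M div 2 ^ rank j) = M div 2 ^ Suc (rank j)"
      using set lt by (simp add: prepared_def div_mult2_eq mult.commute[of 2])
    have b: "0 < nats s' ''b'' j \<longleftrightarrow> j \<in> branching" using set 6(1) by (simp add: prepared_def)
    have I: "nats s' ''m'' 0 = M div 2 ^ rank j" "\<forall>v<j. 0 < nats s' ''z'' v \<longleftrightarrow> v \<notin> unplaced M"
      using 6(4) by simp_all
    show ?case
    proof (cases "j \<in> branching")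
      case True
      then show ?thesis using I 6(3) b h y
        by (intro wp_loop_free) (simp_all add: rank_Suc less_Suc_eq unplaced_def del: power_Suc)
    next
      case False
      then show ?thesis using I 6(3) b
        by (intro wp_loop_free) (simp_all add: rank_Suc less_Suc_eq unplaced_def)
    qed
  qed (use assms in \<open>simp_all add: prepared_def rank_0\<close>)
qed simp_all

text \<open>The memory is compared with \<open>cutval\<close> only below \<open>n\<close>; tails of
  arcs lie there, so this agreement suffices for the next relaxation.\<close>

lemma relax_cong:
  assumes "\<And>u. u < n \<Longrightarrow> x u = y u"
  shows "relax w F x v = relax w F y v"
  unfolding relax_def contrib_def using assms src_less
  by (intro arg_cong[where f = "min (w v)"] sum.cong) auto

definition decoded :: "nat \<Rightarrow> memory \<Rightarrow> bool" where
  "decoded M s \<longleftrightarrow> (\<forall>v<n. 0 < nats s ''z'' v \<longleftrightarrow> v \<notin> unplaced M)"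

lemma relax_wp:
  assumes "prepared s" "decoded M s" "nats s ''v'' 0 = v" "v < n"
  shows "wp relax_prog (6 * e + 5)
    (\<lambda>s'. reals s' ''x'' = (reals s ''x'')(v := relax (reals s ''w'') (unplaced M) (reals s ''x'') v)) s"
  unfolding relax_prog_def
proof (rule wp_seq_loop_free[where U = "6 * e + 4"], goal_cases)
  let ?s = "rset ''c'' 0 0 s"
  let ?contrib = "contrib (reals s ''w'') (unplaced M) (reals s ''x'') v"
  case 2
  show ?case
  proof (rule wp_seq[where T = "6 * e + 2" and U = 2], goal_cases)
    case 1
    show ?case
    proof (rule wp_for_loop[where N = e and T = 4
          and I = "\<lambda>j s'. reals s' ''c'' 0 = (\<Sum>k | k < j \<and> dst k = v. ?contrib k)"], goal_cases)
      case (6 j s')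
      have "prepared ?s" using assms(1) by (simp add: prepared_def)
      then have set: "prepared s'" using prepared_same[OF 6(2)] by (simp add: prepared_arrays_def)
      then have sd: "nats s' ''s'' j = src j" "nats s' ''d'' j = dst j" "nats s' ''q'' (src j) = outdeg (src j)"
        using 6(1) by (simp_all add: prepared_def)
      have z: "0 < nats s' ''z'' (src j) \<longleftrightarrow> src j \<notin> unplaced M"
        using assms(2) src_less[OF 6(1)] same_exceptD(1)[OF 6(2), of "''z''"] by (simp add: decoded_def)
      have v: "nats s' ''v'' 0 = v" using assms(3) same_exceptD(1)[OF 6(2), of "''v''"] by simp
      have wx: "reals s' ''w'' = reals s ''w''" "reals s' ''x'' = reals s ''x''"
        using same_exceptD(2)[OF 6(2), of "''w''"] same_exceptD(2)[OF 6(2), of "''x''"] by simp_all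
      show ?case
        using 6(3,4) sd z v wx
        by (intro wp_loop_free) (auto simp: sum_Suc_filter contrib_def)
    next
      case (7 s')
      have v: "nats s' ''v'' 0 = v" using assms(3) same_exceptD(1)[OF 7(1), of "''v''"] by simp
      have wx: "reals s' ''w'' = reals s ''w''" "reals s' ''x'' = reals s ''x''"
        using same_exceptD(2)[OF 7(1), of "''w''"] same_exceptD(2)[OF 7(1), of "''x''"] by simp_all
      show ?case
        using 7(2) v wx by (intro wp_loop_free) (auto simp: relax_def min_def)
    qed (use assms in \<open>simp_all add: prepared_def\<close>)
  qed simp
qed simp_all

lemma writes_relax_prog:
  "nat_writes relax_prog = {''k''}" "real_writes relax_prog = {''c'', ''x''}"
  by (auto simp: relax_prog_def)

lemma reset_wp:
  assumes "prepared s"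
  shows "wp reset_prog (3 * n + 2) (\<lambda>s'. \<forall>v<n. reals s' ''x'' v = 0) s"
  unfolding reset_prog_def
proof (rule wp_for_loop[where N = n and T = 1 and I = "\<lambda>j s'. \<forall>v<j. reals s' ''x'' v = 0"], goal_cases)
  case (6 j s')
  then show ?case by (intro wp_loop_free) (auto simp: less_Suc_eq)
qed (use assms in \<open>simp_all add: prepared_def\<close>)

lemma writes_reset_prog:
  "nat_writes reset_prog = {''v''}" "real_writes reset_prog = {''x''}"
  by (auto simp: reset_prog_def)

lemma cutval_wp:
  assumes "prepared s" "decoded M s"
  shows "wp cutval_prog (n * (n * (6 * e + 7) + 4) + 3 * n + 4)
    (\<lambda>s'. \<forall>v<n. reals s' ''x'' v = cutval (reals s ''w'') (unplaced M) (n * n) v) s"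
  unfolding cutval_prog_def
proof (rule wp_seq[where T = "3 * n + 2" and U = "n * (n * (6 * e + 7) + 4) + 2", OF wp_mono[OF reset_wp[OF assms(1)]]], goal_cases)
  case (1 s1)
  let ?cut = "cutval (reals s ''w'') (unplaced M)"
  let ?ok = "\<lambda>s'. prepared s' \<and> decoded M s' \<and> reals s' ''w'' = reals s ''w''"
  have s1: "?ok s1"
    using assms prepared_same[OF 1(1)] same_exceptD[OF 1(1)]
    by (simp add: writes_reset_prog prepared_arrays_def decoded_def)
  have keep: "?ok s''" if "?ok s'" "same_except {''t'', ''v'', ''k''} {''c'', ''x''} s' s''" for s' s''
    using that(1) prepared_same[OF that(2)] same_exceptD[OF that(2)]
    by (simp add: prepared_arrays_def decoded_def)
  show ?case
  proof (rule wp_for_loop[where N = n and T = "n * (6 * e + 7) + 2"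
        and I = "\<lambda>r s'. \<forall>v<n. reals s' ''x'' v = ?cut (r * n) v"], goal_cases)
    case (6 r s')
    have s': "?ok s'" using keep[OF s1, of s'] 6(2) by (simp add: writes_relax_prog insert_commute)
    show ?case
    \<comment> \<open>Vertex \<open>j\<close> in round \<open>r\<close> is step
      \<open>r * n + j\<close> of \<open>cutval\<close>, which relaxes index
      \<open>j\<close>.\<close>
    proof (rule wp_for_loop[where N = n and T = "6 * e + 5"
          and I = "\<lambda>j s'. \<forall>v<n. reals s' ''x'' v = ?cut (r * n + j) v"], goal_cases)
      case (6 j s'')
      have s'': "?ok s''"
      proof (rule keep[OF s'])
        show "same_except {''t'', ''v'', ''k''} {''c'', ''x''} s' s''"
          using 6(2) by (auto simp: same_except_def writes_relax_prog)
      qed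
      have "wp relax_prog (6 * e + 5) (\<lambda>s3. reals s3 ''x'' =
          (reals s'' ''x'')(j := relax (reals s'' ''w'') (unplaced M) (reals s'' ''x'') j)) s''"
        using relax_wp s'' 6 by blast
      then show ?case
      proof (rule wp_mono)
        fix s3 :: memory assume "reals s3 ''x'' =
          (reals s'' ''x'')(j := relax (reals s'' ''w'') (unplaced M) (reals s'' ''x'') j)"
        moreover have "relax (reals s ''w'') (unplaced M) (reals s'' ''x'') j =
            relax (reals s ''w'') (unplaced M) (?cut (r * n + j)) j"
          using 6(4) by (intro relax_cong) blast
        moreover have "(r * n + j) mod n = j" using 6(1) by simp
        ultimately show "\<forall>v<n. reals (nset ''v'' 0 (Suc j) s3) ''x'' v = ?cut (r * n + Suc j) v"
          using 6(4) s'' by simp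
      qed simp
    qed (use s' 6 in \<open>simp_all add: writes_relax_prog prepared_def add.commute\<close>)
  qed (use s1 1 in \<open>simp_all add: writes_relax_prog prepared_def algebra_simps\<close>)
qed simp_all

lemma writes_cutval_prog:
  "nat_writes cutval_prog = {''t'', ''v'', ''k''}" "real_writes cutval_prog = {''c'', ''x''}"
  by (auto simp: cutval_prog_def writes_reset_prog writes_relax_prog)

lemma writes_decode_prog:
  "nat_writes decode_prog = {''m'', ''v'', ''z''}" "real_writes decode_prog = {}"
  by (auto simp: decode_prog_def)

text \<open>The written entries have indices above \<open>M\<close>. So the entries up to
  \<open>M\<close> keep their values while all others can only decrease, and the inequalities of
  smaller masks survive: their left sides fall and their right sides stay.\<close>

lemma update_wp:
  assumes "prepared s" "decoded M s" "nats s ''M'' 0 = M" "M < masks" "reals s ''w'' = w"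
    and w: "\<forall>v. 0 \<le> w v"
    and x: "\<forall>v<n. reals s ''x'' v = cutval w (unplaced M) (n * n) v"
    and up: "table_upper w (reals s ''T'')" and low: "table_lower w (reals s ''T'') M"
  shows "wp update_prog (5 * n + 2)
    (\<lambda>s'. table_upper w (reals s' ''T'') \<and> table_lower w (reals s' ''T'') (Suc M)) s"
  unfolding update_prog_def
proof (rule wp_for_loop[where N = n and T = 3 and I = "\<lambda>j s'. table_upper w (reals s' ''T'') \<and>
      (\<forall>i\<le>M. reals s' ''T'' i = reals s ''T'' i) \<and> (\<forall>i. reals s' ''T'' i \<le> reals s ''T'' i) \<and>
      (\<forall>v<j. v \<in> unplaced M \<longrightarrow>
         reals s' ''T'' (M + 2 ^ rank v) \<le> reals s ''T'' M + cutval w (unplaced M) (n * n) v)"], goal_cases)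
  case (6 j s')
  have eq: "nats s' ''b'' = nats s ''b''" "nats s' ''r'' = nats s ''r''" "nats s' ''M'' = nats s ''M''"
    "nats s' ''z'' = nats s ''z''" "reals s' ''x'' = reals s ''x''"
    using same_exceptD[OF 6(2)] by simp_all
  let ?T = "reals s' ''T''" and ?c = "cutval w (unplaced M) (n * n) j"
  have T: "table_upper w ?T" "?T M = reals s ''T'' M" "\<forall>i\<le>M. ?T i = reals s ''T'' i" "\<forall>i. ?T i \<le> reals s ''T'' i"
    "\<forall>v<j. v \<in> unplaced M \<longrightarrow> ?T (M + 2 ^ rank v) \<le> reals s ''T'' M + cutval w (unplaced M) (n * n) v"
    using 6(4) by auto
  have test: "0 < nats s' ''b'' j \<and> nats s' ''z'' j < 1 \<longleftrightarrow> j \<in> unplaced M"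
    using assms(1,2) 6(1) unplaced_subset eq unfolding prepared_def decoded_def by auto
  show ?case
  proof (cases "j \<in> unplaced M")
    case False
    then show ?thesis using test 6(3) T
      by (intro wp_loop_free) (auto simp: less_Suc_eq)
  next
    case True
    let ?i = "M + 2 ^ rank j"
    have "j \<in> branching" using True unplaced_subset by blast
    then have r: "nats s' ''r'' j = 2 ^ rank j" "nats s' ''M'' 0 = M" "reals s' ''x'' j = ?c"
      using \<open>j \<in> branching\<close> assms(1,3) x eq 6(1) unfolding prepared_def by auto
    have ne: "i \<noteq> ?i" if "i \<le> M" for i
      using that zero_less_power[of "2::nat" "rank j"] by linarith
    show ?thesis
    proof (cases "?T M + ?c < ?T ?i")
      case small: True
      let ?T' = "?T(?i := ?T M + ?c)"
      have "table_upper w ?T'" by (rule table_upper_step[OF w T(1) assms(4) True])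
      moreover have "\<forall>i\<le>M. ?T' i = reals s ''T'' i" using T(3) ne by auto
      moreover have le: "?T' i \<le> ?T i" for i using small by simp
      have "\<forall>i. ?T' i \<le> reals s ''T'' i" using T(4) le order_trans by blast
      moreover have "\<forall>v<Suc j. v \<in> unplaced M \<longrightarrow>
          ?T' (M + 2 ^ rank v) \<le> reals s ''T'' M + cutval w (unplaced M) (n * n) v"
      proof (intro allI impI)
        fix v assume v: "v < Suc j" "v \<in> unplaced M"
        show "?T' (M + 2 ^ rank v) \<le> reals s ''T'' M + cutval w (unplaced M) (n * n) v"
        proof (cases "v = j")
          case True
          then show ?thesis using T(2) by simp
        next
          case False
          then show ?thesis using v T(5) le[of "M + 2 ^ rank v"] by (meson less_SucE order_trans)
        qed
      qed
      ultimately show ?thesis using test True small r 6(3)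
        by (intro wp_loop_free) (simp_all del: fun_upd_apply)
    next
      case False
      then have "\<forall>v<Suc j. v \<in> unplaced M \<longrightarrow>
          ?T (M + 2 ^ rank v) \<le> reals s ''T'' M + cutval w (unplaced M) (n * n) v"
        using T(2,5) by (auto simp: less_Suc_eq)
      then show ?thesis using test True False r 6(3) T
        by (intro wp_loop_free) simp_all
    qed
  qed
next
  case (7 s')
  let ?T = "reals s' ''T''" and ?Old = "reals s ''T''"
  note T = conjunct1[OF conjunct2[OF 7(2)]] conjunct1[OF conjunct2[OF conjunct2[OF 7(2)]]]
    conjunct2[OF conjunct2[OF conjunct2[OF 7(2)]]]
  have "?T (M' + 2 ^ rank a) \<le> ?T M' + cutval w (unplaced M') (n * n) a"
    if "M' < Suc M" "a \<in> unplaced M'" for M' a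
  proof (cases "M' = M")
    case True
    have "a < n" using that unplaced_subset branching_less by blast
    then have "?T (M + 2 ^ rank a) \<le> ?Old M + cutval w (unplaced M) (n * n) a"
      using T(3) that(2) unfolding True by simp
    then show ?thesis using T(1) unfolding True by simp
  next
    case False
    then have "M' < M" using that by simp
    then have "?Old (M' + 2 ^ rank a) \<le> ?Old M' + cutval w (unplaced M') (n * n) a"
      using low that(2) unfolding table_lower_def by simp
    moreover have "?T (M' + 2 ^ rank a) \<le> ?Old (M' + 2 ^ rank a)" "?T M' = ?Old M'"
      using T(1,2) \<open>M' < M\<close> by simp_all
    ultimately show ?thesis by linarith
  qed
  moreover have "?T 0 \<le> 0" using low T(1) unfolding table_lower_def by simp
  ultimately have "table_lower w ?T (Suc M)" unfolding table_lower_def by simp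
  then show ?case using conjunct1[OF 7(2)] by simp
qed (use assms in \<open>simp_all add: prepared_def\<close>)

lemma writes_update_prog:
  "nat_writes update_prog = {''v''}" "real_writes update_prog = {''T''}"
  by (auto simp: update_prog_def)

definition mask_time :: nat where
  "mask_time = n * (n * (6 * e + 7) + 4) + 13 * n + 9"

lemma mask_wp:
  assumes "prepared s" "nats s ''M'' 0 = M" "M < masks" "reals s ''w'' = w"
    and w: "\<forall>v. 0 \<le> w v"
    and up: "table_upper w (reals s ''T'')" and low: "table_lower w (reals s ''T'') M"
  shows "wp mask_prog mask_time
    (\<lambda>s'. table_upper w (reals s' ''T'') \<and> table_lower w (reals s' ''T'') (Suc M)) s"
  unfolding mask_prog_def
proof (rule wp_seq[where T = "5 * n + 3" and U = "n * (n * (6 * e + 7) + 4) + 8 * n + 6", OF wp_mono[OF decode_wp[OF assms(1-3)]]], goal_cases)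
  case (1 s1)
  have s1: "prepared s1" "nats s1 ''M'' = nats s ''M''" "reals s1 ''w'' = reals s ''w''" "reals s1 ''T'' = reals s ''T''"
    using assms(1) prepared_same[OF 1(1)] same_exceptD[OF 1(1)]
    by (simp_all add: writes_decode_prog prepared_arrays_def)
  have d1: "decoded M s1" using 1(2) unfolding decoded_def .
  show ?case
  proof (rule wp_seq[where T = "n * (n * (6 * e + 7) + 4) + 3 * n + 4" and U = "5 * n + 2", OF wp_mono[OF cutval_wp[OF s1(1) d1]]], goal_cases)
    case (1 s2)
    have s2: "prepared s2" "decoded M s2" "nats s2 ''M'' = nats s ''M''" "reals s2 ''w'' = reals s ''w''"
       "reals s2 ''T'' = reals s ''T''"
      using s1 d1 prepared_same[OF 1(1)] same_exceptD[OF 1(1)]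
      by (simp_all add: writes_cutval_prog prepared_arrays_def decoded_def)
    show ?case using assms s2 s1 1(2) by (intro update_wp) simp_all
  qed simp_all
qed (simp_all add: mask_time_def)

lemma writes_mask_prog:
  "nat_writes mask_prog = {''m'', ''v'', ''z'', ''t'', ''k''}" "real_writes mask_prog = {''c'', ''x'', ''T''}"
  by (auto simp: mask_prog_def writes_decode_prog writes_cutval_prog writes_update_prog)

definition value_time :: nat where
  "value_time = masks * (mask_time + 2) + 3 * masks + 3 * n + 9"

lemma table_upper_init:
  assumes w: "\<forall>v. 0 \<le> w v" and T: "T 0 = 0" "\<And>M. 0 < M \<Longrightarrow> M < masks \<Longrightarrow> T M = sum w {..<n}"
  shows "table_upper w T"
  unfolding table_upper_def
proof (intro allI impI)
  fix M assume M: "M < masks"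
  show "\<exists>U\<subseteq>{..<n}. sum w U \<le> T M \<and> placed (branching - unplaced M) U"
  proof (cases "M = 0")
    case True
    then show ?thesis using T by (intro exI[of _ "{}"]) (auto simp: placed_def unplaced_def)
  next
    case False
    have "residual {..<n} = {}" using src_less by (auto simp: residual_def)
    then show ?thesis using T M False by (intro exI[of _ "{..<n}"]) (simp add: placed_def)
  qed
qed

lemma value_wp:
  assumes "prepared s" "reals s ''w'' = w" and w: "\<forall>v. 0 \<le> w v"
  shows "wp value_prog value_time (\<lambda>s'. hitting_value w (reals s' ''g'' 0)) s"
  unfolding value_prog_def
proof (rule wp_seq_loop_free[where U = "masks * (mask_time + 2) + 3 * masks + 3 * n + 8"], goal_cases)
  case 2
  let ?s = "rset ''W'' 0 0 s"
  let ?ok = "\<lambda>s'. prepared s' \<and> reals s' ''w'' = w"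
  have keep: "?ok s''" if "?ok s'" "same_except N R s' s''" "N \<inter> prepared_arrays = {}" "''w'' \<notin> R" for s' s'' N R
    using that(1) prepared_same[OF that(2)] same_exceptD[OF that(2)] that(3,4) by simp
  have s: "?ok ?s" using assms by (simp add: prepared_def)
  show ?case
  proof (rule wp_seq[where T = "3 * n + 2" and U = "masks * (mask_time + 2) + 3 * masks + 6"], goal_cases)
    case 1
    show ?case
    proof (rule wp_for_loop[where N = n and T = 1 and I = "\<lambda>j s'. reals s' ''W'' 0 = sum w {..<j}"], goal_cases)
      case (6 j s')
      have "reals s' ''w'' = w" using same_exceptD(2)[OF 6(2), of "''w''"] assms(2) by simp
      then show ?case using 6(3,4) by (intro wp_loop_free) simp_all
    next
      case (7 s1)
      have s1: "?ok s1" by (rule keep[OF _ 7(1)]) (use s in \<open>simp_all add: prepared_arrays_def\<close>)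
      show ?case
      proof (rule wp_seq[where T = "3 * masks + 2" and U = "masks * (mask_time + 2) + 4"], goal_cases)
        case 1
        show ?case
        proof (rule wp_for_loop[where N = masks and T = 1 and I = "\<lambda>j s'. \<forall>M<j. reals s' ''T'' M = sum w {..<n}"], goal_cases)
          case (6 j s')
          have "reals s' ''W'' 0 = sum w {..<n}" using same_exceptD(2)[OF 6(2), of "''W''"] 7(2) by simp
          then show ?case using 6(3,4) by (intro wp_loop_free) (auto simp: less_Suc_eq)
        next
          case (7 s2)
          have s2: "?ok s2" by (rule keep[OF s1 7(1)]) (simp_all add: prepared_arrays_def)
          show ?case
          proof (rule wp_seq_loop_free[where U = "masks * (mask_time + 2) + 3"], goal_cases)
            case 2
            let ?s3 = "rset ''T'' 0 0 s2"
            have s3: "?ok ?s3" using s2 by (simp add: prepared_def)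
            have up: "table_upper w (reals ?s3 ''T'')"
              using 7(2) by (intro table_upper_init[OF w]) simp_all
            show ?case
            proof (rule wp_seq[where T = "masks * (mask_time + 2) + 2" and U = 1], goal_cases)
              case 1
              show ?case
              proof (rule wp_for_loop[where N = masks and T = mask_time and I = "\<lambda>M s'.
                  table_upper w (reals s' ''T'') \<and> table_lower w (reals s' ''T'') M"], goal_cases)
                case (6 M s')
                have "?ok s'"
                  by (rule keep[OF _ 6(2)]) (use s3 in \<open>simp_all add: prepared_arrays_def writes_mask_prog\<close>)
                then show ?case using 6 w mask_wp[of s' M w] by simp
              next
                case (7 s')
                have "?ok s'"
                  by (rule keep[OF _ 7(1)]) (use s3 in \<open>simp_all add: prepared_arrays_def writes_mask_prog\<close>)
                then have "nats s' ''F'' 0 = masks" by (simp add: prepared_def)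
                then show ?case using 7(2) table_value[OF w] by (intro wp_loop_free) simp_all
              qed (use s3 up in \<open>simp_all add: prepared_def writes_mask_prog table_lower_def\<close>)
            qed simp
          qed simp_all
        qed (use s1 in \<open>simp_all add: prepared_def\<close>)
      qed simp
    qed (use s in \<open>simp_all add: prepared_def\<close>)
  qed simp
qed (simp_all add: value_time_def)

lemma writes_value_prog:
  "nat_writes value_prog = {''m'', ''v'', ''z'', ''t'', ''k'', ''M''}"
  "real_writes value_prog = {''c'', ''x'', ''T'', ''W'', ''g''}"
  by (auto simp: value_prog_def writes_mask_prog)

end

section \<open>Orientation and preprocessing\<close>

definition degrees_prog :: "string \<Rightarrow> string \<Rightarrow> string \<Rightarrow> string \<Rightarrow> program" where
  "degrees_prog S D X Y = for_loop ''k'' ''arcs''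
     (Seq (NSet X (NGet D (scalar ''k'')) (NAdd (NGet X (NGet D (scalar ''k''))) (NConst 1)))
       (NSet Y (NGet S (scalar ''k'')) (NAdd (NGet Y (NGet S (scalar ''k''))) (NConst 1))))"

definition count_prog :: program where
  "count_prog = for_loop ''v'' ''verts''
     (Seq (Cond (BAnd (NLess (NConst 0) (NGet ''i'' (scalar ''v'')))
           (NLess (NConst 1) (NGet ''o'' (scalar ''v''))))
         (NSet ''forward'' (NConst 0) (NAdd (scalar ''forward'') (NConst 1))) Skip)
       (Cond (BAnd (NLess (NConst 0) (NGet ''o'' (scalar ''v'')))
           (NLess (NConst 1) (NGet ''i'' (scalar ''v''))))
         (NSet ''backward'' (NConst 0) (NAdd (scalar ''backward'') (NConst 1))) Skip))"

definition copy_prog :: "string \<Rightarrow> string \<Rightarrow> program" where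
  "copy_prog S D = for_loop ''k'' ''arcs''
     (Seq (NSet ''s'' (scalar ''k'') (NGet S (scalar ''k'')))
       (NSet ''d'' (scalar ''k'') (NGet D (scalar ''k''))))"

definition orient_prog :: program where
  "orient_prog = Seq (degrees_prog ''tail'' ''head'' ''i'' ''o'')
     (Seq count_prog
       (Cond (NLess (scalar ''backward'') (scalar ''forward''))
         (copy_prog ''head'' ''tail'') (copy_prog ''tail'' ''head'')))"

text \<open>\<open>F\<close> is doubled at each branching vertex. Hence it equals
  \<open>2 ^ rank v\<close> when \<open>v\<close> is reached, and the number of masks at the
  end.\<close>

definition classify_prog :: program where
  "classify_prog = Seq (NSet ''F'' (NConst 0) (NConst 1))
     (for_loop ''v'' ''verts''
       (Seq (Cond (BAnd (NLess (NConst 0) (NGet ''p'' (scalar ''v'')))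
             (NLess (NConst 1) (NGet ''q'' (scalar ''v''))))
           (Seq (NSet ''b'' (scalar ''v'') (NConst 1))
             (Seq (NSet ''r'' (scalar ''v'') (scalar ''F''))
               (NSet ''F'' (NConst 0) (NAdd (scalar ''F'') (scalar ''F'')))))
           (NSet ''b'' (scalar ''v'') (NConst 0)))
         (NSet ''f'' (scalar ''v'') (scalar ''verts''))))"

text \<open>A vertex of out-degree 1 is written once, by its only arc; all others keep the initial
  value \<open>n\<close>.\<close>

definition successor_prog :: program where
  "successor_prog = Seq (NSet ''f'' (scalar ''verts'') (scalar ''verts''))
     (for_loop ''k'' ''arcs''
       (Cond (NLess (NConst 1) (NGet ''q'' (NGet ''s'' (scalar ''k'')))) Skip
         (NSet ''f'' (NGet ''s'' (scalar ''k'')) (NGet ''d'' (scalar ''k'')))))"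

text \<open>Division by counting: passing from \<open>M\<close> to \<open>M + 1\<close> increases
  the half exactly when \<open>M\<close> is odd, and flips the parity.\<close>

definition halving_prog :: program where
  "halving_prog = Seq (NSet ''h'' (NConst 0) (NConst 0)) (Seq (NSet ''y'' (NConst 0) (NConst 0))
     (for_loop ''M'' ''F''
       (Seq (NSet ''h'' (NAdd (scalar ''M'') (NConst 1))
           (NAdd (NGet ''h'' (scalar ''M'')) (NGet ''y'' (scalar ''M''))))
         (NSet ''y'' (NAdd (scalar ''M'') (NConst 1)) (NSub (NConst 1) (NGet ''y'' (scalar ''M'')))))))"

definition weights_prog :: program where
  "weights_prog = for_loop ''v'' ''verts'' (RSet ''w'' (scalar ''v'') (RGet ''weight'' (scalar ''v'')))"

definition prepare_prog :: program where
  "prepare_prog = Seq (degrees_prog ''s'' ''d'' ''p'' ''q'') (Seq classify_prog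
     (Seq successor_prog (Seq halving_prog weights_prog)))"

definition fvs_program :: program where
  "fvs_program = Seq orient_prog (Seq prepare_prog (Seq select_prog reps_prog))"

lemma degrees_wp:
  assumes "distinct [S, D, X, Y, ''k'', ''arcs'']" "''arcs'' \<notin> {X, Y}" "''k'' \<notin> {X, Y}" "nats s ''arcs'' 0 = e"
    "\<forall>v. nats s X v = 0 \<and> nats s Y v = 0"
  shows "wp (degrees_prog S D X Y) (4 * e + 2) (\<lambda>s'. \<forall>v.
    nats s' X v = card {k. k < e \<and> nats s D k = v} \<and>
    nats s' Y v = card {k. k < e \<and> nats s S k = v}) s"
  unfolding degrees_prog_def
proof (rule wp_for_loop[where N = e and T = 2 and I = "\<lambda>j s'. \<forall>v.
    nats s' X v = card {k. k < j \<and> nats s D k = v} \<and>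
    nats s' Y v = card {k. k < j \<and> nats s S k = v}"], goal_cases)
  case (6 j s')
  have "nats s' S = nats s S" "nats s' D = nats s D"
    using same_exceptD(1)[OF 6(2)] assms(1) by simp_all
  moreover have "Y \<noteq> X" using assms(1) by auto
  ultimately show ?case using 6(3,4) assms(1-3)
    by (intro wp_loop_free) (simp_all add: card_Suc_filter)
qed (use assms in simp_all)

lemma writes_degrees_prog:
  "nat_writes (degrees_prog S D X Y) = {''k'', X, Y}" "real_writes (degrees_prog S D X Y) = {}"
  by (auto simp: degrees_prog_def)

lemma copy_wp:
  assumes "distinct [S, D, ''k'', ''arcs'', ''s'', ''d'']" "nats s ''arcs'' 0 = e"
  shows "wp (copy_prog S D) (4 * e + 2)
    (\<lambda>s'. \<forall>k<e. nats s' ''s'' k = nats s S k \<and> nats s' ''d'' k = nats s D k) s"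
  unfolding copy_prog_def
proof (rule wp_for_loop[where N = e and T = 2 and
      I = "\<lambda>j s'. \<forall>k<j. nats s' ''s'' k = nats s S k \<and> nats s' ''d'' k = nats s D k"], goal_cases)
  case (6 j s')
  have "nats s' S = nats s S" "nats s' D = nats s D"
    using same_exceptD(1)[OF 6(2)] assms(1) by simp_all
  then show ?case using 6(3,4) assms(1)
    by (intro wp_loop_free) (simp_all add: less_Suc_eq)
qed (use assms in simp_all)

lemma writes_copy_prog:
  "nat_writes (copy_prog S D) = {''k'', ''s'', ''d''}" "real_writes (copy_prog S D) = {}"
  by (auto simp: copy_prog_def)

section \<open>Correctness of self-reduction, cycle representatives and preprocessing\<close>

context arc_list
begin

lemma select_body_wp:
  assumes "prepared s" and w: "\<forall>v. 0 \<le> w v" and j: "nats s ''j'' 0 = j" "j < n"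
    and sel: "selection w D (reals s ''w'') j (reals s ''best'' 0)"
    and out: "\<forall>v. 0 < nats s ''out'' v \<longleftrightarrow> v \<in> D"
  shows "wp select_body (value_time + 5) (\<lambda>s'. \<exists>D. selection w D (reals s' ''w'') (Suc j) (reals s' ''best'' 0) \<and>
    (\<forall>v. 0 < nats s' ''out'' v \<longleftrightarrow> v \<in> D)) s"
  unfolding select_body_def
proof (rule wp_seq_loop_free[where U = "value_time + 4"], goal_cases)
  case 2
  show ?case
  proof (rule wp_seq_loop_free[where U = "value_time + 3"], goal_cases)
    case 2
    let ?s = "exec (RSet ''w'' (scalar ''j'') (RSub (RGet ''sv'' (NConst 0)) (RGet ''sv'' (NConst 0))))
      (exec (RSet ''sv'' (NConst 0) (RGet ''w'' (scalar ''j''))) s)"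
    let ?w = "(reals s ''w'')(j := 0)"
    have s: "prepared ?s" "reals ?s ''w'' = ?w" "reals ?s ''sv'' 0 = reals s ''w'' j"
      "reals ?s ''best'' = reals s ''best''" "nats ?s ''out'' = nats s ''out''" "nats ?s ''j'' 0 = j"
      using assms(1) j by (simp_all add: prepared_def)
    have w': "\<forall>v. 0 \<le> ?w v" using sel w unfolding selection_def by auto
    show ?case
    proof (rule wp_seq[where T = value_time and U = 3, OF wp_mono[OF value_wp[OF s(1,2) w']]], goal_cases)
      case (1 s')
      have s': "reals s' ''w'' = ?w" "reals s' ''sv'' 0 = reals s ''w'' j"
        "reals s' ''best'' = reals s ''best''" "nats s' ''out'' = nats s ''out''" "nats s' ''j'' 0 = j"
        using s same_exceptD[OF 1(1)] by (simp_all add: writes_value_prog del: exec.simps)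
      show ?case
      proof (cases "reals s ''best'' 0 < reals s' ''g'' 0 + reals s ''w'' j")
        case True
        have "selection w D (reals s ''w'') (Suc j) (reals s ''best'' 0)"
          by (rule selection_reject[OF sel j(2) 1(2) True])
        then show ?thesis using True s' out by (intro wp_loop_free) auto
      next
        case False
        have "selection w (insert j D) ?w (Suc j) (reals s' ''g'' 0)"
          by (rule selection_accept[OF sel j(2) 1(2) False])
        then show ?thesis using False s' out
          by (intro wp_loop_free) (auto intro!: exI[of _ "insert j D"])
      qed
    qed simp_all
  qed simp_all
qed simp_all

lemma writes_select_body:
  "nat_writes select_body = {''m'', ''v'', ''z'', ''t'', ''k'', ''M'', ''out''}"
  "real_writes select_body = {''c'', ''x'', ''T'', ''W'', ''g'', ''sv'', ''w'', ''best''}"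
  by (auto simp: select_body_def writes_value_prog)

lemma select_wp:
  assumes "prepared s" "reals s ''w'' = w" and w: "\<forall>v. 0 \<le> w v" and out: "\<forall>v. nats s ''out'' v = 0"
  shows "wp select_prog (value_time + n * (value_time + 7) + 3)
    (\<lambda>s'. \<exists>D wc best. selection w D wc n best \<and> (\<forall>v. 0 < nats s' ''out'' v \<longleftrightarrow> v \<in> D)) s"
  unfolding select_prog_def
proof (rule wp_seq[where T = value_time and U = "n * (value_time + 7) + 3",
      OF wp_mono[OF value_wp[OF assms(1,2) w]]], goal_cases)
  case (1 s1)
  have s1: "prepared s1" "reals s1 ''w'' = w" "\<forall>v. nats s1 ''out'' v = 0"
    using assms prepared_same[OF 1(1)] same_exceptD[OF 1(1)]
    by (simp_all add: writes_value_prog prepared_arrays_def)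
  show ?case
  proof (rule wp_seq_loop_free[where U = "n * (value_time + 7) + 2"], goal_cases)
    case 2
    let ?s2 = "exec (RSet ''best'' (NConst 0) (RGet ''g'' (NConst 0))) s1"
    have s2: "prepared ?s2" using s1 by (simp add: prepared_def)
    show ?case
    proof (rule wp_for_loop[where N = n and T = "value_time + 5" and
          I = "\<lambda>j s'. \<exists>D. selection w D (reals s' ''w'') j (reals s' ''best'' 0) \<and>
            (\<forall>v. 0 < nats s' ''out'' v \<longleftrightarrow> v \<in> D)"], goal_cases)
      case (6 j s')
      have p: "prepared s'"
        using prepared_same[OF 6(2) s2] by (simp add: writes_select_body prepared_arrays_def)
      obtain D where D: "selection w D (reals s' ''w'') j (reals s' ''best'' 0)"
        "\<forall>v. 0 < nats s' ''out'' v \<longleftrightarrow> v \<in> D" using 6(4) by blast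
      show ?case using select_body_wp[OF p w 6(3,1) D] by simp
    next
      case 5
      show ?case using 1(2) s1 by (intro exI[of _ "{}"]) (simp add: selection_init)
    next
      case (7 s')
      then show ?case by blast
    qed (use s1 in \<open>simp_all add: writes_select_body prepared_def\<close>)
  qed simp_all
qed simp_all

lemma writes_select_prog:
  "nat_writes select_prog = {''m'', ''v'', ''z'', ''t'', ''k'', ''M'', ''out'', ''j''}"
  "real_writes select_prog = {''c'', ''x'', ''T'', ''W'', ''g'', ''sv'', ''w'', ''best''}"
  by (auto simp: select_prog_def writes_value_prog writes_select_body)

lemma walk_wp:
  assumes "prepared s" "nats s ''u'' 0 = j" "nats s ''j'' 0 = j" "j < n" "reals s ''weight'' = w"
    "nats s ''on'' 0 = 0" "nats s ''beaten'' 0 = 0"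
  shows "wp (for_loop ''k'' ''verts'' walk_body) (7 * n + 2) (\<lambda>s'.
    (0 < nats s' ''on'' 0 \<longleftrightarrow> (\<exists>l<n. (nxt ^^ Suc l) j = j)) \<and>
    (0 < nats s' ''beaten'' 0 \<longleftrightarrow> (\<exists>l<n. beats w ((nxt ^^ Suc l) j) j))) s"
proof (rule wp_for_loop[where N = n and T = 5 and I = "\<lambda>i s'. nats s' ''u'' 0 = (nxt ^^ i) j \<and>
    (0 < nats s' ''on'' 0 \<longleftrightarrow> (\<exists>l<i. (nxt ^^ Suc l) j = j)) \<and>
    (0 < nats s' ''beaten'' 0 \<longleftrightarrow> (\<exists>l<i. beats w ((nxt ^^ Suc l) j) j))"], goal_cases)
  case (6 i s')
  let ?u = "(nxt ^^ Suc i) j"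
  have s': "prepared s'" "nats s' ''j'' 0 = j" "reals s' ''weight'' = w"
    using assms(1,3,5) prepared_same[OF 6(2)] same_exceptD[OF 6(2)]
    by (simp_all add: walk_body_def prepared_arrays_def)
  \<comment> \<open>The walk may already be stuck in \<open>n\<close>, where the successor array is
    still specified.\<close>
  have "(nxt ^^ i) j \<le> n" using funpow_nxt_le assms(4) by simp
  then have f: "nats s' ''f'' ((nxt ^^ i) j) = ?u" using s'(1) by (simp add: prepared_def)
  have ex: "(\<exists>l<Suc i. P l) \<longleftrightarrow> (\<exists>l<i. P l) \<or> P i" for P by (auto simp: less_Suc_eq)
  have eqs: "\<not> ?u < j \<and> \<not> j < ?u \<longleftrightarrow> ?u = j" by auto
  have I: "nats s' ''u'' 0 = (nxt ^^ i) j" "0 < nats s' ''on'' 0 \<longleftrightarrow> (\<exists>l<i. (nxt ^^ Suc l) j = j)"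
    "0 < nats s' ''beaten'' 0 \<longleftrightarrow> (\<exists>l<i. beats w ((nxt ^^ Suc l) j) j)"
    using 6(4) by simp_all
  show ?case unfolding walk_body_def ex
    using I f s'(2,3) eqs
    by (intro wp_loop_free) (auto simp: beats_def simp del: funpow.simps)
qed (use assms in \<open>simp_all add: prepared_def walk_body_def\<close>)

lemma writes_walk_body:
  "nat_writes walk_body = {''u'', ''on'', ''beaten''}" "real_writes walk_body = {}"
  by (auto simp: walk_body_def)

lemma reps_wp:
  assumes "prepared s" "reals s ''weight'' = w" "\<forall>v. 0 < nats s ''out'' v \<longleftrightarrow> v \<in> D"
  shows "wp reps_prog (n * (7 * n + 9) + 2)
    (\<lambda>s'. \<forall>v. 0 < nats s' ''out'' v \<longleftrightarrow> v \<in> D \<union> cycle_reps w) s"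
  unfolding reps_prog_def
proof (rule wp_for_loop[where N = n and T = "7 * n + 7" and
      I = "\<lambda>j s'. \<forall>v. 0 < nats s' ''out'' v \<longleftrightarrow> v \<in> D \<union> (cycle_reps w \<inter> {..<j})"], goal_cases)
  case (6 j s')
  let ?A = "NSet ''u'' (NConst 0) (scalar ''j'')" and ?B = "NSet ''on'' (NConst 0) (NConst 0)"
    and ?C = "NSet ''beaten'' (NConst 0) (NConst 0)"
  let ?s = "exec ?C (exec ?B (exec ?A s'))"
  have s': "prepared s'" "reals s' ''weight'' = w"
    using assms(1,2) prepared_same[OF 6(2)] same_exceptD[OF 6(2)]
    by (simp_all add: writes_walk_body prepared_arrays_def)
  have s: "prepared ?s" "nats ?s ''u'' 0 = j" "nats ?s ''j'' 0 = j" "reals ?s ''weight'' = w"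
      "nats ?s ''on'' 0 = 0" "nats ?s ''beaten'' 0 = 0" "nats ?s ''out'' = nats s' ''out''"
    using s' 6(3) by (simp_all add: prepared_def)
  have rep: "j \<in> cycle_reps w \<longleftrightarrow> (\<exists>l<n. (nxt ^^ Suc l) j = j) \<and> \<not> (\<exists>l<n. beats w ((nxt ^^ Suc l) j) j)"
    using 6(1) unfolding cycle_reps_def by blast
  show ?case
  proof (intro wp_seq_loop_free[where P = ?A and U = "7 * n + 6"] wp_seq_loop_free[where P = ?B and U = "7 * n + 5"]
      wp_seq_loop_free[where P = ?C and U = "7 * n + 4"]
      wp_seq[where T = "7 * n + 2" and U = 2, OF wp_mono[OF walk_wp[OF s(1-3) 6(1) s(4-6)]]], goal_cases)
    case (4 s'')
    have s'': "nats s'' ''out'' = nats s' ''out''" "nats s'' ''j'' 0 = j"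
      using s(3,7) same_exceptD(1)[OF 4(1)] by (simp_all add: writes_walk_body del: exec.simps)
    have test: "0 < nats s'' ''on'' 0 \<and> nats s'' ''beaten'' 0 < 1 \<longleftrightarrow> j \<in> cycle_reps w"
      using 4(2) rep by auto
    show ?case using s'' test 6(4)
      by (intro wp_loop_free) (auto simp: less_Suc_eq)
  qed simp_all
next
  case (7 s')
  have "cycle_reps w \<inter> {..<n} = cycle_reps w" unfolding cycle_reps_def by blast
  then show ?case using 7(2) by simp
qed (use assms in \<open>simp_all add: prepared_def writes_walk_body\<close>)

lemma count_wp:
  assumes "nats s ''verts'' 0 = n" "\<forall>v. nats s ''i'' v = indeg v" "\<forall>v. nats s ''o'' v = outdeg v"
    "nats s ''forward'' 0 = 0" "nats s ''backward'' 0 = 0"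
  shows "wp count_prog (6 * n + 2) (\<lambda>s'. nats s' ''forward'' 0 = card branching \<and>
    nats s' ''backward'' 0 = card {v. v < n \<and> 0 < outdeg v \<and> 1 < indeg v}) s"
  unfolding count_prog_def
proof (rule wp_for_loop[where N = n and T = 4 and
      I = "\<lambda>j s'. nats s' ''forward'' 0 = card {v. v < j \<and> 0 < indeg v \<and> 1 < outdeg v} \<and>
        nats s' ''backward'' 0 = card {v. v < j \<and> 0 < outdeg v \<and> 1 < indeg v}"], goal_cases)
  case (6 j s')
  have "nats s' ''i'' = nats s ''i''" "nats s' ''o'' = nats s ''o''"
    using same_exceptD(1)[OF 6(2)] by simp_all
  then show ?case using 6(3,4) assms(2,3)
    by (intro wp_loop_free) (simp_all add: card_Suc_filter)
next
  case (7 s')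
  have "branching = {v. v < n \<and> 0 < indeg v \<and> 1 < outdeg v}" unfolding branching_def by auto
  then show ?case using 7(2) by simp
qed (use assms in simp_all)

lemma writes_count_prog:
  "nat_writes count_prog = {''v'', ''forward'', ''backward''}" "real_writes count_prog = {}"
  by (auto simp: count_prog_def)

lemma orient_wp:
  assumes "nats s ''verts'' 0 = n" "nats s ''arcs'' 0 = e"
    "\<forall>k<e. nats s ''tail'' k = src k \<and> nats s ''head'' k = dst k"
    "\<forall>v. nats s ''i'' v = 0 \<and> nats s ''o'' v = 0" "nats s ''forward'' 0 = 0" "nats s ''backward'' 0 = 0"
  shows "wp orient_prog (6 * n + 8 * e + 7) (\<lambda>s'.
    if card {v. v < n \<and> 0 < outdeg v \<and> 1 < indeg v} < card branching
    then \<forall>k<e. nats s' ''s'' k = dst k \<and> nats s' ''d'' k = src k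
    else \<forall>k<e. nats s' ''s'' k = src k \<and> nats s' ''d'' k = dst k) s"
  unfolding orient_prog_def
proof (rule wp_seq[where T = "4 * e + 2" and U = "6 * n + 4 * e + 5", OF wp_mono[OF degrees_wp[OF _ _ _ assms(2)]]], goal_cases)
  case (5 s1)
  have s1: "nats s1 ''verts'' = nats s ''verts''" "nats s1 ''arcs'' = nats s ''arcs''"
    "nats s1 ''tail'' = nats s ''tail''" "nats s1 ''head'' = nats s ''head''"
    "nats s1 ''forward'' = nats s ''forward''" "nats s1 ''backward'' = nats s ''backward''"
    using same_exceptD(1)[OF 5(1)] by (simp_all add: writes_degrees_prog)
  have s1': "nats s1 ''verts'' 0 = n" "nats s1 ''forward'' 0 = 0" "nats s1 ''backward'' 0 = 0"
    using s1 assms by simp_all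
  have sets: "{k. k < e \<and> nats s ''head'' k = v} = {k. k < e \<and> dst k = v}"
      "{k. k < e \<and> nats s ''tail'' k = v} = {k. k < e \<and> src k = v}" for v
    using assms(3) by auto
  have deg: "\<forall>v. nats s1 ''i'' v = indeg v" "\<forall>v. nats s1 ''o'' v = outdeg v"
    using 5(2) unfolding indeg_def outdeg_def sets by simp_all
  show ?case
  proof (rule wp_seq[where T = "6 * n + 2" and U = "4 * e + 3", OF wp_mono[OF count_wp[OF s1'(1) deg s1'(2,3)]]], goal_cases)
    case (1 s2)
    have s2: "nats s2 ''arcs'' 0 = e" "nats s2 ''tail'' = nats s ''tail''" "nats s2 ''head'' = nats s ''head''"
      using same_exceptD(1)[OF 1(1)] s1 assms(2) by (simp_all add: writes_count_prog)
    have c1: "wp (copy_prog ''head'' ''tail'') (4 * e + 2)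
        (\<lambda>s'. \<forall>k<e. nats s' ''s'' k = dst k \<and> nats s' ''d'' k = src k) s2"
      by (rule wp_mono[OF copy_wp[OF _ s2(1)]]) (use s2 assms(3) in simp_all)
    have c2: "wp (copy_prog ''tail'' ''head'') (4 * e + 2)
        (\<lambda>s'. \<forall>k<e. nats s' ''s'' k = src k \<and> nats s' ''d'' k = dst k) s2"
      by (rule wp_mono[OF copy_wp[OF _ s2(1)]]) (use s2 assms(3) in simp_all)
    show ?case
      by (rule wp_cond[where T = "4 * e + 2"]) (use 1(2) c1 c2 in simp_all)
  qed simp_all
qed (use assms in simp_all)

lemma writes_orient_prog:
  "nat_writes orient_prog = {''k'', ''i'', ''o'', ''v'', ''forward'', ''backward'', ''s'', ''d''}"
  "real_writes orient_prog = {}"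
  by (auto simp: orient_prog_def writes_degrees_prog writes_count_prog writes_copy_prog)

lemma classify_wp:
  assumes "nats s ''verts'' 0 = n" "\<forall>v. nats s ''p'' v = indeg v" "\<forall>v. nats s ''q'' v = outdeg v"
  shows "wp classify_prog (7 * n + 3) (\<lambda>s'. nats s' ''F'' 0 = masks \<and>
     (\<forall>v<n. (0 < nats s' ''b'' v \<longleftrightarrow> v \<in> branching) \<and>
       (v \<in> branching \<longrightarrow> nats s' ''r'' v = 2 ^ rank v) \<and> nats s' ''f'' v = n)) s"
  unfolding classify_prog_def
proof (rule wp_seq_loop_free[where U = "7 * n + 2"], goal_cases)
  case 2
  show ?case
  proof (rule wp_for_loop[where N = n and T = 5 and I = "\<lambda>j s'. nats s' ''F'' 0 = 2 ^ rank j \<and>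
     (\<forall>v<j. (0 < nats s' ''b'' v \<longleftrightarrow> v \<in> branching) \<and>
       (v \<in> branching \<longrightarrow> nats s' ''r'' v = 2 ^ rank v) \<and> nats s' ''f'' v = n)"], goal_cases)
    case (6 j s')
    have eq: "nats s' ''p'' j = indeg j" "nats s' ''q'' j = outdeg j" "nats s' ''verts'' 0 = n"
      using assms same_exceptD(1)[OF 6(2)] by simp_all
    have br: "0 < indeg j \<and> 1 < outdeg j \<longleftrightarrow> j \<in> branching"
      using 6(1) unfolding branching_def by auto
    show ?case
    proof (cases "j \<in> branching")
      case True
      then show ?thesis using 6(3,4) eq br by (intro wp_loop_free) (auto simp: less_Suc_eq rank_Suc)
    next
      case False
      then have "\<not> (0 < indeg j \<and> 1 < outdeg j)" using br by simp
      then show ?thesis using False 6(3,4) eq by (intro wp_loop_free) (auto simp: less_Suc_eq rank_Suc)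
    qed
  next
    case (7 s')
    have "rank n = card branching" unfolding rank_def branching_def by (rule arg_cong[where f = card]) auto
    then show ?case using 7(2) by simp
  qed (use assms in \<open>simp_all add: rank_0\<close>)
qed simp_all

lemma writes_classify_prog:
  "nat_writes classify_prog = {''F'', ''v'', ''b'', ''r'', ''f''}" "real_writes classify_prog = {}"
  by (auto simp: classify_prog_def)

lemma successor_wp:
  assumes "nats s ''verts'' 0 = n" "nats s ''arcs'' 0 = e" "\<forall>v. nats s ''q'' v = outdeg v"
    "\<forall>k<e. nats s ''s'' k = src k \<and> nats s ''d'' k = dst k" "\<forall>v<n. nats s ''f'' v = n"
  shows "wp successor_prog (4 * e + 3) (\<lambda>s'. \<forall>v\<le>n. nats s' ''f'' v = nxt v) s"
  unfolding successor_prog_def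
proof (rule wp_seq_loop_free[where U = "4 * e + 2"], goal_cases)
  case 2
  show ?case
  proof (rule wp_for_loop[where N = e and T = 2 and I = "\<lambda>j s'. \<forall>v\<le>n. nats s' ''f'' v =
      (if \<exists>k<j. src k = v \<and> inner v then nxt v else n)"], goal_cases)
    case (6 j s')
    have eq: "nats s' ''s'' j = src j" "nats s' ''d'' j = dst j" "nats s' ''q'' (src j) = outdeg (src j)"
      using assms 6(1) same_exceptD(1)[OF 6(2)] by simp_all
    have ex: "(\<exists>k<Suc j. src k = v \<and> inner v) \<longleftrightarrow> (\<exists>k<j. src k = v \<and> inner v) \<or> (v = src j \<and> inner v)" for v
      by (auto simp: less_Suc_eq)
    show ?case
    proof (rule wp_loop_free, goal_cases)
      case 3
      show ?case
      proof (intro allI impI, goal_cases)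
        case (1 v)
        have old: "nats s' ''f'' v = (if \<exists>k<j. src k = v \<and> inner v then nxt v else n)"
          using 6(4) 1 by simp
        show ?case
        proof (cases "v = src j \<and> inner v")
          case True
          then have "nxt v = dst j" using nxt_src[OF 6(1)] by metis
          moreover have "v = src j" "inner (src j)" using True by auto
          ultimately show ?thesis unfolding ex using 6(3) eq by simp
        next
          case False
          then show ?thesis unfolding ex using 6(3) eq old by auto
        qed
      qed
    qed simp_all
  next
    case (7 s')
    have "(if \<exists>k<e. src k = v \<and> inner v then nxt v else n) = nxt v" for v
      using nxt_cases[of v] by auto
    then show ?case using 7(2) by simp
  qed (use assms in \<open>auto simp: le_less\<close>)
qed simp_all

lemma writes_successor_prog:
  "nat_writes successor_prog = {''f'', ''k''}" "real_writes successor_prog = {}"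
  by (auto simp: successor_prog_def)


lemma halving_wp:
  assumes "nats s ''F'' 0 = N"
  shows "wp halving_prog (4 * N + 4)
    (\<lambda>s'. \<forall>M\<le>N. nats s' ''h'' M = M div 2 \<and> nats s' ''y'' M = M mod 2) s"
  unfolding halving_prog_def
proof (intro wp_seq_loop_free[where P = "NSet ''h'' (NConst 0) (NConst 0)" and U = "4 * N + 3"]
    wp_seq_loop_free[where P = "NSet ''y'' (NConst 0) (NConst 0)" and U = "4 * N + 2"], goal_cases)
  case 3
  show ?case
  proof (rule wp_for_loop[where N = N and T = 2 and
        I = "\<lambda>j s'. \<forall>M\<le>j. nats s' ''h'' M = M div 2 \<and> nats s' ''y'' M = M mod 2"], goal_cases)
    case (6 j s')
    have I: "nats s' ''h'' j = j div 2" "nats s' ''y'' j = j mod 2" using 6(4) by auto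
    have "j div 2 + j mod 2 = Suc j div 2" "Suc 0 - j mod 2 = Suc j mod 2"
      by presburger+
    then have step: "nats s' ''h'' j + nats s' ''y'' j = Suc j div 2" "Suc 0 - nats s' ''y'' j = Suc j mod 2"
      unfolding I .
    show ?case
    proof (rule wp_loop_free, goal_cases)
      case 3
      show ?case
      proof (intro allI impI, goal_cases)
        case (1 M)
        show ?case
        proof (cases "M = Suc j")
          case True
          show ?thesis unfolding True by (simp add: 6(3) step)
        next
          case False
          then have "M \<le> j" using 1 by simp
          then have "nats s' ''h'' M = M div 2" "nats s' ''y'' M = M mod 2" using 6(4) by simp_all
          then show ?thesis using False 6(3) by simp
        qed
      qed
    qed simp_all
  qed (use assms in auto)
qed simp_all

lemma writes_halving_prog:
  "nat_writes halving_prog = {''h'', ''y'', ''M''}" "real_writes halving_prog = {}"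
  by (auto simp: halving_prog_def)

text \<open>Equality of whole functions is obtained because both the target array and the weights
  vanish beyond \<open>n\<close>; later the array is used directly as the weight function
  \<open>w\<close>.\<close>

lemma weights_wp:
  assumes "nats s ''verts'' 0 = n" "reals s ''weight'' = w" "reals s ''w'' = (\<lambda>_. 0)" "\<forall>v\<ge>n. w v = 0"
  shows "wp weights_prog (3 * n + 2) (\<lambda>s'. reals s' ''w'' = w) s"
  unfolding weights_prog_def
proof (rule wp_for_loop[where N = n and T = 1 and
      I = "\<lambda>j s'. reals s' ''w'' = (\<lambda>v. if v < j then w v else 0)"], goal_cases)
  case (6 j s')
  have "reals s' ''weight'' = w" using same_exceptD(2)[OF 6(2), of "''weight''"] assms(2) by simp
  then show ?case using 6(3,4) by (intro wp_loop_free) (auto simp: less_Suc_eq fun_eq_iff)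
qed (use assms in \<open>auto simp: fun_eq_iff not_less\<close>)

lemma writes_weights_prog:
  "nat_writes weights_prog = {''v''}" "real_writes weights_prog = {''w''}"
  by (auto simp: weights_prog_def)

lemma prepare_wp:
  assumes "nats s ''verts'' 0 = n" "nats s ''arcs'' 0 = e"
    "\<forall>k<e. nats s ''s'' k = src k \<and> nats s ''d'' k = dst k"
    "\<forall>v. nats s ''p'' v = 0 \<and> nats s ''q'' v = 0"
    "reals s ''weight'' = w" "reals s ''w'' = (\<lambda>_. 0)" "\<forall>v\<ge>n. w v = 0"
  shows "wp prepare_prog (10 * n + 8 * e + 4 * masks + 14) (\<lambda>s'. prepared s' \<and> reals s' ''w'' = w) s"
  unfolding prepare_prog_def
proof (rule wp_seq[where T = "4 * e + 2" and U = "10 * n + 4 * e + 4 * masks + 12", OF wp_mono[OF degrees_wp[OF _ _ _ assms(2)]]], goal_cases)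
  case (5 s1)
  have sets: "{k. k < e \<and> nats s ''d'' k = v} = {k. k < e \<and> dst k = v}"
      "{k. k < e \<and> nats s ''s'' k = v} = {k. k < e \<and> src k = v}" for v
    using assms(3) by auto
  have deg: "\<forall>v. nats s1 ''p'' v = indeg v" "\<forall>v. nats s1 ''q'' v = outdeg v"
    using 5(2) unfolding indeg_def outdeg_def sets by simp_all
  have s1: "nats s1 ''verts'' 0 = n" "nats s1 ''arcs'' 0 = e" "reals s1 = reals s"
    "nats s1 ''s'' = nats s ''s''" "nats s1 ''d'' = nats s ''d''"
    using same_exceptD[OF 5(1)] assms by (simp_all add: writes_degrees_prog fun_eq_iff)
  show ?case
  proof (rule wp_seq[where T = "7 * n + 3" and U = "3 * n + 4 * e + 4 * masks + 9",
        OF wp_mono[OF classify_wp[OF s1(1) deg]]], goal_cases)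
    case (1 s2)
    have s2: "nats s2 ''verts'' 0 = n" "nats s2 ''arcs'' 0 = e" "\<forall>v. nats s2 ''q'' v = outdeg v"
      "\<forall>k<e. nats s2 ''s'' k = src k \<and> nats s2 ''d'' k = dst k" "\<forall>v<n. nats s2 ''f'' v = n"
      "reals s2 = reals s" "nats s2 ''F'' 0 = masks" "\<forall>v<n. 0 < nats s2 ''b'' v \<longleftrightarrow> v \<in> branching"
      "\<forall>v\<in>branching. nats s2 ''r'' v = 2 ^ rank v"
      using same_exceptD[OF 1(1)] s1 deg assms(3) 1(2) branching_less
      by (simp_all add: writes_classify_prog fun_eq_iff)
    show ?case
    proof (rule wp_seq[where T = "4 * e + 3" and U = "3 * n + 4 * masks + 6",
          OF wp_mono[OF successor_wp[OF s2(1-5)]]], goal_cases)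
      case (1 s3)
      have s3: "nats s3 ''verts'' 0 = n" "nats s3 ''arcs'' 0 = e" "\<forall>v. nats s3 ''q'' v = outdeg v"
        "\<forall>k<e. nats s3 ''s'' k = src k \<and> nats s3 ''d'' k = dst k"
        "reals s3 = reals s" "nats s3 ''F'' 0 = masks" "\<forall>v<n. 0 < nats s3 ''b'' v \<longleftrightarrow> v \<in> branching"
        "\<forall>v\<in>branching. nats s3 ''r'' v = 2 ^ rank v"
        using same_exceptD[OF 1(1)] s2 by (simp_all add: writes_successor_prog fun_eq_iff)
      show ?case
      proof (rule wp_seq[where T = "4 * masks + 4" and U = "3 * n + 2",
            OF wp_mono[OF halving_wp[OF s3(6)]]], goal_cases)
        case (1 s4)
        have s4: "nats s4 ''verts'' 0 = n" "reals s4 = reals s" "prepared s4"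
          using same_exceptD[OF 1(1)] s3 1(2) \<open>\<forall>v\<le>n. nats s3 ''f'' v = nxt v\<close>
          by (simp_all add: writes_halving_prog fun_eq_iff prepared_def)
        have w4: "reals s4 ''weight'' = w" "reals s4 ''w'' = (\<lambda>_. 0)"
          using s4(2) assms(5,6) by simp_all
        show ?case
        proof (rule wp_mono[OF weights_wp[OF s4(1) w4 assms(7)]], goal_cases)
          case (1 s5)
          then show ?case using prepared_same[OF 1(1) s4(3)]
            by (simp add: writes_weights_prog prepared_arrays_def)
        qed simp
      qed simp_all
    qed simp_all
  qed simp_all
qed (use assms in simp_all)

lemma writes_prepare_prog:
  "nat_writes prepare_prog = {''k'', ''p'', ''q'', ''F'', ''v'', ''b'', ''r'', ''f'', ''h'', ''y'', ''M''}"
  "real_writes prepare_prog = {''w''}"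
  by (auto simp: prepare_prog_def writes_degrees_prog writes_classify_prog writes_successor_prog
      writes_halving_prog writes_weights_prog)

end

text \<open>The product of maximal degree and vertex number arises from repeated addition. The
  negative terms are collected so that a single truncated subtraction is performed, at the
  end.\<close>

definition param_program :: program where
  "param_program = Seq (degrees_prog ''tail'' ''head'' ''i'' ''o'')
     (Seq (for_loop ''v'' ''verts''
       (Cond (NLess (scalar ''max'') (NAdd (NGet ''i'' (scalar ''v'')) (NGet ''o'' (scalar ''v''))))
         (NSet ''max'' (NConst 0) (NAdd (NGet ''i'' (scalar ''v'')) (NGet ''o'' (scalar ''v'')))) Skip))
     (Seq (for_loop ''v'' ''verts'' (NSet ''acc'' (NConst 0) (NAdd (scalar ''acc'') (scalar ''max''))))
       (NSet ''out'' (NConst 0)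
         (NSub (NAdd (scalar ''acc'') (NConst 1)) (NAdd (scalar ''verts'') (scalar ''arcs''))))))"

section \<open>Counting degrees and bounding the running time\<close>

context arc_list
begin

lemma sum_degrees: "(\<Sum>v<n. indeg v) = e" "(\<Sum>v<n. outdeg v) = e"
proof -
  have "(\<Sum>v<n. card {k \<in> {..<e}. g k = v}) = e" if "\<And>k. k < e \<Longrightarrow> g k < n" for g
    using sum.image_gen[of "{..<e}" "\<lambda>_. 1::nat" g] that
    by (subst card_UN_disjoint[symmetric]) (auto intro!: arg_cong[where f = card, of _ "{..<e}", simplified])
  from this[of src] this[of dst] show "(\<Sum>v<n. indeg v) = e" "(\<Sum>v<n. outdeg v) = e"
    using src_less dst_less unfolding indeg_def outdeg_def by simp_all
qed

definition co_branching :: "nat set" where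
  "co_branching = {v. v < n \<and> 0 < outdeg v \<and> 1 < indeg v}"

definition exponent :: nat where
  "exponent = min (card branching) (card co_branching)"

text \<open>
  For \<open>\<Delta> \<ge> 2\<close> every vertex contributes at most \<open>2 * \<Delta>\<close> to
  \<open>card branching + card co_branching + 2 * n + 2 * e\<close>. The critical case is a vertex of degree \<open>3\<close>
  for \<open>\<Delta> = 3\<close>: it branches in one orientation only.
\<close>

lemma exponent_le:
  assumes deg: "\<And>v. v < n \<Longrightarrow> indeg v + outdeg v \<le> \<Delta>" and conn: "n + e \<le> \<Delta> * n + 1"
  shows "exponent + (n + e) \<le> \<Delta> * n + 1"
proof (cases "2 \<le> \<Delta>")
  case False
  have "branching = {}"
  proof (rule equals0I)
    fix v assume "v \<in> branching"
    then show False using deg[of v] False unfolding branching_def by simp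
  qed
  then show ?thesis using conn by (simp add: exponent_def)
next
  case True
  let ?one = "\<lambda>P. if P then 1 else 0 :: nat"
  have ind: "card S = (\<Sum>v<n. ?one (v \<in> S))" if "S \<subseteq> {..<n}" for S
    using that by (simp add: sum.If_cases Int_absorb1)
  have sub: "branching \<subseteq> {..<n}" "co_branching \<subseteq> {..<n}"
    unfolding branching_def co_branching_def by auto
  \<comment> \<open>The minimum over the two orientations is at most their average; doubling avoids
    fractions and lets each arc be counted at both of its ends.\<close>
  have "2 * exponent + (2 * n + 2 * e) \<le> (card branching + card co_branching) + (2 * n + 2 * e)"
    unfolding exponent_def by simp
  also have "\<dots> = (\<Sum>v<n. ?one (v \<in> branching) + ?one (v \<in> co_branching) + (2 + (indeg v + outdeg v)))"
    unfolding sum.distrib ind[OF sub(1), symmetric] ind[OF sub(2), symmetric] sum_degrees by simp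
  also have "\<dots> \<le> (\<Sum>v<n. 2 * \<Delta>)"
  proof (rule sum_mono)
    fix v assume "v \<in> {..<n}"
    then have "indeg v + outdeg v \<le> \<Delta>" using deg by simp
    then show "?one (v \<in> branching) + ?one (v \<in> co_branching) + (2 + (indeg v + outdeg v)) \<le> 2 * \<Delta>"
      using True unfolding branching_def co_branching_def by auto
  qed
  finally have "2 * (exponent + (n + e)) \<le> 2 * (\<Delta> * n)" by (simp add: algebra_simps)
  then show ?thesis by simp
qed

lemma mask_time_le:
  assumes "0 < n"
  shows "mask_time \<le> 33 * (n * n * (e + 1))"
proof -
  define X where "X = n * n * (e + 1)"
  have "1 * 1 * 1 \<le> X" "n * 1 * 1 \<le> X" "n * n * 1 \<le> X"
    unfolding X_def using assms by (intro mult_le_mono; simp)+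
  then have "1 \<le> X" "n \<le> X" "n * n \<le> X" by simp_all
  moreover have eq: "n * (n * (6 * e + 7) + 4) = 6 * X + n * n + 4 * n"
    unfolding X_def by (simp add: algebra_simps)
  \<comment> \<open>Each of \<open>1\<close>, \<open>n\<close> and \<open>n * n\<close> is at most
    \<open>X\<close>, so the coefficients add up to 6 + 1 + 4 + 13 + 9 = 33.\<close>
  ultimately show ?thesis unfolding mask_time_def eq X_def[symmetric] by linarith
qed

lemma value_time_le:
  assumes "0 < n"
  shows "value_time \<le> 50 * (masks * (n * n * (e + 1)))"
proof -
  let ?X = "n * n * (e + 1)"
  have X: "1 \<le> ?X" using assms by (simp add: Suc_le_eq)
  have "n * 1 * 1 \<le> ?X" using assms by (intro mult_le_mono) auto
  then have nX: "n \<le> ?X" by simp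
  have "masks * (mask_time + 2) \<le> masks * (35 * ?X)"
    using mask_time_le[OF assms] X by (intro mult_le_mono2) linarith
  moreover have "masks \<le> masks * ?X" using X by simp
  moreover have "?X \<le> masks * ?X" by simp
  moreover have "masks * (35 * ?X) = 35 * (masks * ?X)" by simp
  \<comment> \<open>The constant is 35 + 3 + 3 + 9 = 50.\<close>
  ultimately show ?thesis unfolding value_time_def using X nX by linarith
qed

definition optimal :: "(nat \<Rightarrow> real) \<Rightarrow> nat set \<Rightarrow> bool" where
  "optimal w I \<longleftrightarrow> I \<subseteq> {..<n} \<and> acyclic (residual I) \<and>
     (\<forall>U\<subseteq>{..<n}. acyclic (residual U) \<longrightarrow> sum w I \<le> sum w U)"

lemma solve_wp:
  assumes pos: "0 < n" and init: "nats s ''verts'' 0 = n" "nats s ''arcs'' 0 = e"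
    "\<forall>k<e. nats s ''s'' k = src k \<and> nats s ''d'' k = dst k"
    "\<forall>v. nats s ''p'' v = 0 \<and> nats s ''q'' v = 0" "\<forall>v. nats s ''out'' v = 0"
    "reals s ''weight'' = w" "reals s ''w'' = (\<lambda>_. 0)"
    and w: "\<forall>v\<ge>n. w v = 0" "\<forall>v. 0 \<le> w v"
  shows "wp (Seq prepare_prog (Seq select_prog reps_prog)) (164 * (masks * (n * n * n * (e + 1))))
    (\<lambda>s'. optimal w {v. v < n \<and> nats s' ''out'' v \<noteq> 0}) s"
proof (rule wp_seq[where T = "10 * n + 8 * e + 4 * masks + 14" and
      U = "value_time + n * (value_time + 7) + 3 + (n * (7 * n + 9) + 2)",
      OF wp_mono[OF prepare_wp[OF init(1-4,6,7) w(1)]]], goal_cases)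
  case (1 s1)
  have s1: "prepared s1" "reals s1 ''w'' = w" "\<forall>v. nats s1 ''out'' v = 0" "reals s1 ''weight'' = w"
    using 1(2) init same_exceptD[OF 1(1)] by (simp_all add: writes_prepare_prog)
  show ?case
  proof (rule wp_seq[where T = "value_time + n * (value_time + 7) + 3" and U = "n * (7 * n + 9) + 2",
        OF wp_mono[OF select_wp[OF s1(1,2) w(2) s1(3)]]], goal_cases)
    case (1 s2)
    then obtain D wc best where D: "selection w D wc n best" "\<forall>v. 0 < nats s2 ''out'' v \<longleftrightarrow> v \<in> D"
      by blast
    have s2: "prepared s2" "reals s2 ''weight'' = w"
      using s1 prepared_same[OF 1(1)] same_exceptD[OF 1(1)]
      by (simp_all add: writes_select_prog prepared_arrays_def)
    note final = selection_final[OF D(1) w(2)]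
    show ?case
    proof (rule wp_mono[OF reps_wp[OF s2 D(2)]], goal_cases)
      case (1 s3)
      have "cycle_reps w \<subseteq> {..<n}" unfolding cycle_reps_def by blast
      then have "{v. v < n \<and> nats s3 ''out'' v \<noteq> 0} = D \<union> cycle_reps w"
        using 1(2) final(1) by auto
      then show ?case
        using final(1) \<open>cycle_reps w \<subseteq> {..<n}\<close> reps_acyclic[OF final(2)]
          optimal_union_reps[OF w(2) final(1,3)]
        unfolding optimal_def by simp
    qed simp
  qed simp_all
next
  case 3
  \<comment> \<open>\<open>?X\<close> measures one filling of the table, \<open>?Y\<close> all of
    them. The constant 164 consists of 36 for the preparation, 50 for the first filling, 50 + 7 for
    the loop over all vertices, 7 + 9 for the representatives and 3 + 2 for loop overhead.\<close>
  let ?Y = "masks * (n * n * n * (e + 1))" and ?X = "masks * (n * n * (e + 1))"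
  have v: "value_time \<le> 50 * ?X" by (rule value_time_le[OF pos])
  have nX: "n * ?X = ?Y" by (simp add: algebra_simps)
  have "n * (value_time + 7) = n * value_time + 7 * n" by (simp add: algebra_simps)
  also have "n * value_time \<le> n * (50 * ?X)" using v by (rule mult_le_mono2)
  also have "n * (50 * ?X) = 50 * ?Y" by (simp add: algebra_simps)
  finally have nv: "n * (value_time + 7) \<le> 50 * ?Y + 7 * n" by simp
  have "1 * ?X \<le> n * ?X" using pos by (intro mult_le_mono1) simp
  then have "?X \<le> ?Y" unfolding nX by simp
  moreover have "n \<le> ?Y" "e \<le> ?Y" "masks \<le> ?Y" "1 \<le> ?Y" "n * n \<le> ?Y"
  proof -
    have one: "1 \<le> n * n * n" "1 \<le> masks" "n \<le> n * n * n" "n * n \<le> n * n * n"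
      using pos by (simp_all add: Suc_le_eq)
    have "1 * (n * 1) \<le> ?Y" "1 * (1 * (e + 1)) \<le> ?Y" "masks * (1 * 1) \<le> ?Y" "1 * (1 * 1) \<le> ?Y"
      "1 * (n * n * 1) \<le> ?Y"
      using one by (intro mult_le_mono; simp)+
    then show "n \<le> ?Y" "e \<le> ?Y" "masks \<le> ?Y" "1 \<le> ?Y" "n * n \<le> ?Y" by simp_all
  qed
  moreover have "n * (7 * n + 9) = 7 * (n * n) + 9 * n" by (simp add: algebra_simps)
  ultimately show ?case using v nv by linarith
qed simp_all

text \<open>Reversing the arcs replaces the residual relation by its converse, and acyclicity is
  invariant under this. So a solution of the reversed instance can be returned unchanged.\<close>

lemma optimal_converse: "arc_list.optimal n e dst src w = optimal w"
proof -
  interpret rev: arc_list n e dst src using src_less dst_less by unfold_locales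
  have "rev.residual U = (residual U)\<inverse>" for U
    unfolding residual_def rev.residual_def by auto
  then show ?thesis unfolding optimal_def[abs_def] rev.optimal_def[abs_def] by (simp add: acyclic_converse)
qed

lemma fvs_program_wp:
  assumes pos: "0 < n" and init: "nats s ''verts'' 0 = n" "nats s ''arcs'' 0 = e"
    "\<forall>k<e. nats s ''tail'' k = src k \<and> nats s ''head'' k = dst k"
    "\<And>x. x \<notin> {''verts'', ''arcs'', ''tail'', ''head''} \<Longrightarrow> nats s x = (\<lambda>_. 0)"
    "reals s ''weight'' = w" "reals s ''w'' = (\<lambda>_. 0)"
    and w: "\<forall>v\<ge>n. w v = 0" "\<forall>v. 0 \<le> w v"
  shows "wp fvs_program (185 * (2 ^ exponent * (n * n * n * (e + 1))))
    (\<lambda>s'. optimal w {v. v < n \<and> nats s' ''out'' v \<noteq> 0}) s"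
  unfolding fvs_program_def
proof (rule wp_seq[where T = "6 * n + 8 * e + 7" and U = "164 * (2 ^ exponent * (n * n * n * (e + 1)))",
      OF wp_mono[OF orient_wp[OF init(1-3)]]], goal_cases)
  case (4 s1)
  interpret rev: arc_list n e dst src using src_less dst_less by unfold_locales
  have "rev.branching = co_branching"
    unfolding rev.branching_def co_branching_def rev.indeg_def rev.outdeg_def indeg_def outdeg_def by auto
  have s1: "nats s1 ''verts'' 0 = n" "nats s1 ''arcs'' 0 = e"
    "\<forall>v. nats s1 ''p'' v = 0 \<and> nats s1 ''q'' v = 0" "\<forall>v. nats s1 ''out'' v = 0"
    "reals s1 ''weight'' = w" "reals s1 ''w'' = (\<lambda>_. 0)"
    using init same_exceptD[OF 4(1)] by (simp_all add: writes_orient_prog)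
  show ?case
  proof (cases "card co_branching < card branching")
    case True
    then have "\<forall>k<e. nats s1 ''s'' k = dst k \<and> nats s1 ''d'' k = src k"
      using 4(2) unfolding co_branching_def by simp
    from rev.solve_wp[OF pos s1(1,2) this s1(3-6) w] show ?thesis
      using True unfolding optimal_converse \<open>rev.branching = co_branching\<close> exponent_def by simp
  next
    case False
    then have "\<forall>k<e. nats s1 ''s'' k = src k \<and> nats s1 ''d'' k = dst k"
      using 4(2) unfolding co_branching_def by simp
    from solve_wp[OF pos s1(1,2) this s1(3-6) w] show ?thesis
      using False unfolding exponent_def by simp
  qed
next
  case 6
  \<comment> \<open>Choosing the orientation adds 6 + 8 + 7 to the constant 164, which makes
    185.\<close>
  define Y where "Y = 2 ^ exponent * (n * n * n * (e + 1))"
  have one: "1 \<le> n * n * n" "n \<le> n * n * n" using pos by (simp_all add: Suc_le_eq)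
  have "1 * (n * 1) \<le> Y" "1 * (1 * (e + 1)) \<le> Y"
    unfolding Y_def using one by (intro mult_le_mono; simp)+
  then show ?case unfolding Y_def[symmetric] by simp
qed (use init in simp_all)

lemma param_program_wp:
  assumes pos: "0 < n" and init: "nats s ''verts'' 0 = n" "nats s ''arcs'' 0 = e"
    "\<forall>k<e. nats s ''tail'' k = src k \<and> nats s ''head'' k = dst k"
    "\<And>x. x \<notin> {''verts'', ''arcs'', ''tail'', ''head''} \<Longrightarrow> nats s x = (\<lambda>_. 0)"
  shows "wp param_program (4 * e + 9 * n + 7) (\<lambda>s'. nats s' ''out'' 0 =
    Max ((\<lambda>v. indeg v + outdeg v) ` {..<n}) * n + 1 - (n + e)) s"
  unfolding param_program_def
proof (rule wp_seq[where T = "4 * e + 2" and U = "9 * n + 5", OF wp_mono[OF degrees_wp[OF _ _ _ init(2)]]], goal_cases)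
  case (5 s1)
  let ?deg = "\<lambda>v. indeg v + outdeg v"
  have sets: "{k. k < e \<and> nats s ''head'' k = v} = {k. k < e \<and> dst k = v}"
      "{k. k < e \<and> nats s ''tail'' k = v} = {k. k < e \<and> src k = v}" for v
    using init(3) by auto
  have deg: "\<forall>v. nats s1 ''i'' v = indeg v" "\<forall>v. nats s1 ''o'' v = outdeg v"
    using 5(2) unfolding indeg_def outdeg_def sets by simp_all
  have s1: "nats s1 ''verts'' 0 = n" "nats s1 ''arcs'' 0 = e" "nats s1 ''max'' 0 = 0" "nats s1 ''acc'' 0 = 0"
    using init same_exceptD(1)[OF 5(1)] by (simp_all add: writes_degrees_prog)
  show ?case
  proof (rule wp_seq[where T = "4 * n + 2" and U = "3 * n + 3"], goal_cases)
    case 1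
    show ?case
    \<comment> \<open>Inserting \<open>0\<close> gives \<open>Max\<close> a defined value before the
      first vertex; as degrees are natural numbers and \<open>n\<close> is positive, the final
      maximum is unaffected.\<close>
    proof (rule wp_for_loop[where N = n and T = 2 and
          I = "\<lambda>j s'. nats s' ''max'' 0 = Max (insert 0 (?deg ` {..<j}))"], goal_cases)
      case (6 j s')
      have "nats s' ''i'' j = indeg j" "nats s' ''o'' j = outdeg j"
        using same_exceptD(1)[OF 6(2)] deg by simp_all
      moreover define mx where "mx = Max (insert 0 (?deg ` {..<j}))"
      have "Max (insert 0 (?deg ` {..<Suc j})) = max (?deg j) mx"
        unfolding mx_def by (simp add: lessThan_Suc insert_commute[of 0])
      moreover have "nats s' ''max'' 0 = mx" using 6(4) unfolding mx_def .
      ultimately show ?case using 6(3) by (intro wp_loop_free) (simp_all add: max_def)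
    next
      case (7 s2)
      let ?M = "Max (?deg ` {..<n})"
      have "Max (insert 0 (?deg ` {..<n})) = max 0 ?M" using pos by (intro Max_insert) auto
      then have s2: "nats s2 ''max'' 0 = ?M" using 7(2) by simp
      have s2': "nats s2 ''verts'' 0 = n" "nats s2 ''arcs'' 0 = e" "nats s2 ''acc'' 0 = 0"
        using s1 same_exceptD(1)[OF 7(1)] by simp_all
      show ?case
      proof (rule wp_seq[where T = "3 * n + 2" and U = 1], goal_cases)
        case 1
        show ?case
        proof (rule wp_for_loop[where N = n and T = 1 and I = "\<lambda>j s'. nats s' ''acc'' 0 = ?M * j"], goal_cases)
          case (6 j s')
          have "nats s' ''max'' 0 = ?M" using same_exceptD(1)[OF 6(2)] s2 by simp
          then show ?case using 6(3,4) by (intro wp_loop_free) simp_all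
        next
          case (7 s3)
          have "nats s3 ''verts'' 0 = n" "nats s3 ''arcs'' 0 = e"
            using s2' same_exceptD(1)[OF 7(1)] by simp_all
          then show ?case using 7(2) by (intro wp_loop_free) simp_all
        qed (use s2' in simp_all)
      qed simp
    qed (use s1 in simp_all)
  qed simp
qed (use init in simp_all)

end

section \<open>From graphs to numbered arcs\<close>

text \<open>A closed walk contains a cycle, so cycles without repeated vertices can be traded for
  the transitive closure, in which the residual relation is studied.\<close>

lemma cycle_iff_not_acyclic:
  assumes "wf_digraph H"
  shows "(\<exists>c. pre_digraph.cycle H c) \<longleftrightarrow> \<not> acyclic (arcs_ends H)"
proof -
  interpret wf_digraph H by fact
  have "(\<exists>c. cycle c) \<longleftrightarrow> (\<exists>u. u \<rightarrow>\<^sup>+\<^bsub>H\<^esub> u)"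
  proof
    assume "\<exists>c. cycle c"
    then show "\<exists>u. u \<rightarrow>\<^sup>+\<^bsub>H\<^esub> u" unfolding cycle_def reachable1_awalk by blast
  next
    assume "\<exists>u. u \<rightarrow>\<^sup>+\<^bsub>H\<^esub> u"
    then obtain u c where "awalk u c u" "c \<noteq> []" unfolding reachable1_awalk by blast
    then have "closed_w c" unfolding closed_w_def by auto
    then show "\<exists>c. cycle c" by (rule closed_w_imp_cycle)
  qed
  then show ?thesis unfolding acyclic_def by blast
qed

lemma acyclic_map:
  assumes "acyclic S" "\<And>x y. (x, y) \<in> R \<Longrightarrow> (f x, f y) \<in> S"
  shows "acyclic R"
proof -
  have "(f x, f y) \<in> S\<^sup>+" if "(x, y) \<in> R\<^sup>+" for x y
    using that by (induction rule: trancl_induct) (auto intro: assms(2) trancl_into_trancl)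
  then show ?thesis using assms(1) unfolding acyclic_def by blast
qed

lemma connected_closed_set:
  assumes conn: "Digraph_Component.connected G" and S: "S \<subseteq> verts G" "S \<noteq> {}"
    and closed: "\<And>a. a \<in> arcs G \<Longrightarrow> tail G a \<in> S \<longleftrightarrow> head G a \<in> S"
  shows "S = verts G"
proof -
  obtain x where x: "x \<in> S" using S by blast
  have "y \<in> S" if "y \<in> verts G" for y
  proof -
    have "(x, y) \<in> rtrancl_on (verts G) ((arcs_ends G)\<^sup>s)"
      using conn that x S unfolding connected_conv by blast
    then show ?thesis
    proof (induction rule: rtrancl_on_induct)
      case base
      show ?case by (rule x)
    next
      case (step y z)
      then show ?case using closed unfolding symcl_def arcs_ends_conv by auto
    qed
  qed
  then show ?thesis using S by blast
qed

context arc_list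
begin

text \<open>For \<open>2 \<le> \<Delta>\<close> both \<open>2 * e\<close> and \<open>2 * n\<close>
  are at most \<open>\<Delta> * n\<close>. For smaller \<open>\<Delta>\<close> connectedness leaves
  one vertex or one arc, and there the summand \<open>1\<close> is consumed: the bound is attained
  when \<open>\<Delta>\<close> is the maximal degree.\<close>

lemma connected_arcs_le:
  assumes deg: "\<And>v. v < n \<Longrightarrow> indeg v + outdeg v \<le> \<Delta>" and pos: "0 < n"
    and conn: "\<And>S. S \<subseteq> {..<n} \<Longrightarrow> S \<noteq> {} \<Longrightarrow> (\<And>k. k < e \<Longrightarrow> src k \<in> S \<longleftrightarrow> dst k \<in> S) \<Longrightarrow> S = {..<n}"
  shows "n + e \<le> \<Delta> * n + 1"
proof (cases "2 \<le> \<Delta>")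
  case True
  have "2 * e = (\<Sum>v<n. indeg v + outdeg v)" using sum_degrees by (simp add: sum.distrib)
  also have "\<dots> \<le> (\<Sum>v<n. \<Delta>)" using deg by (intro sum_mono) simp
  finally have "2 * e \<le> \<Delta> * n" by (simp add: mult.commute)
  moreover have "2 * n \<le> \<Delta> * n" using True by simp
  ultimately show ?thesis by linarith
next
  case False
  show ?thesis
  proof (cases "e = 0")
    case True
    have "{0} = {..<n}" using conn[of "{0}"] pos True by simp
    then have "card {..<n} = card {0::nat}" by simp
    then show ?thesis using True by simp
  next
    case False
    then have e: "0 < e" by simp
    have in_pos: "0 < indeg (dst k)" and out_pos: "0 < outdeg (src k)" if "k < e" for k
      using that unfolding indeg_def outdeg_def by (auto simp: card_gt_0_iff)
    have le1: "indeg v + outdeg v \<le> 1" if "v < n" for v using deg[OF that] \<open>\<not> 2 \<le> \<Delta>\<close> by linarith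
    \<comment> \<open>A second arc at an end of arc \<open>0\<close> would give that vertex total
      degree at least 2. So the ends of arc \<open>0\<close> form a closed set, which by
      connectedness is everything.\<close>
    have only: "k = 0" if k: "k < e" "src k \<in> {src 0, dst 0} \<or> dst k \<in> {src 0, dst 0}" for k
    proof (rule ccontr)
      assume "k \<noteq> 0"
      have two: "1 < card {l. l < e \<and> g l = g k}" if "g k = g 0" for g :: "nat \<Rightarrow> nat"
      proof -
        have "card {0, k} \<le> card {l. l < e \<and> g l = g k}" using that k e by (intro card_mono) auto
        then show ?thesis using \<open>k \<noteq> 0\<close> by simp
      qed
      have "src k \<noteq> src 0" using two[of src] le1[OF src_less[OF k(1)]] unfolding outdeg_def by auto
      moreover have "dst k \<noteq> dst 0" using two[of dst] le1[OF dst_less[OF k(1)]] unfolding indeg_def by auto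
      moreover have "src k \<noteq> dst 0"
        using in_pos[OF e] out_pos[OF k(1)] le1[OF src_less[OF k(1)]] by auto
      moreover have "dst k \<noteq> src 0"
        using in_pos[OF k(1)] out_pos[OF e] le1[OF dst_less[OF k(1)]] by auto
      ultimately show False using k(2) by auto
    qed
    have "{src 0, dst 0} = {..<n}"
    proof (rule conn)
      show "{src 0, dst 0} \<subseteq> {..<n}" using src_less dst_less e by auto
      show "src k \<in> {src 0, dst 0} \<longleftrightarrow> dst k \<in> {src 0, dst 0}" if "k < e" for k
        using only[OF that] by auto
    qed simp
    then have "k = 0" if "k < e" for k using only[OF that] src_less[OF that] by blast
    then have "e = 1" using e by (metis One_nat_def Suc_lessI not_gr_zero zero_neq_one)
    moreover have "\<Delta> \<noteq> 0" using deg[OF src_less[OF e]] out_pos[OF e] by linarith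
    ultimately show ?thesis by simp
  qed
qed

end

text \<open>The truncated subtraction is harmless by \<open>connected_arcs_le\<close>.\<close>

definition exponent_param :: "('a, 'b) pre_digraph \<Rightarrow> nat" where
  "exponent_param G = max_degree G * card (verts G) + 1 - (card (verts G) + card (arcs G))"

text \<open>The bridge between graph and numbers: everything that refers to the graph is pulled back
  along \<open>p\<close> and \<open>q\<close> here, and the remaining argument sees only
  indices.\<close>

lemma fvs_instance:
  fixes G :: "('a, 'b) pre_digraph"
  assumes "(G, \<nu>, p, q) \<in> fvs_inputs"
  defines "n \<equiv> card (verts G)" and "e \<equiv> card (arcs G)"
  defines "src \<equiv> \<lambda>k. vertex_index G p (tail G (q k))" and "dst \<equiv> \<lambda>k. vertex_index G p (head G (q k))"
  shows "0 < n" and "arc_list n e src dst"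
    and "max_degree G = Max ((\<lambda>v. arc_list.indeg e dst v + arc_list.outdeg e src v) ` {..<n})"
    and "n + e \<le> max_degree G * n + 1" and "arc_list.exponent n e src dst \<le> exponent_param G"
    and "\<And>I. arc_list.optimal n e src dst (\<lambda>i. if i < n then \<nu> (p i) else 0) I \<Longrightarrow>
      min_feedback_vertex_set G \<nu> (p ` I)"
proof -
  have prob: "fvs_problem G \<nu>" and p: "bij_betw p {..<n} (verts G)" and q: "bij_betw q {..<e} (arcs G)"
    using assms(1) unfolding fvs_inputs_def n_def e_def by auto
  have fin: "fin_digraph G" and conn: "Digraph_Component.connected G"
    using prob unfolding fvs_problem_def by auto
  interpret fin_digraph G by (rule fin)
  have ne: "verts G \<noteq> {}" using conn unfolding connected_conv by blast
  then show pos: "0 < n" unfolding n_def by (simp add: card_gt_0_iff)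
  let ?vi = "vertex_index G p"
  have vi: "?vi x < n" "p (?vi x) = x" if "x \<in> verts G" for x
    using that p bij_betw_inv_into_right[OF p that] bij_betw_apply[OF bij_betw_inv_into[OF p] that]
    unfolding vertex_index_def n_def by auto
  have vip: "?vi (p i) = i" if "i < n" for i
    using bij_betw_inv_into_left[OF p] that unfolding vertex_index_def n_def by simp
  have inj_p: "inj_on p {..<n}" using p unfolding bij_betw_def by simp
  have pv: "p i \<in> verts G" if "i < n" for i using bij_betw_apply[OF p] that by simp
  have qa: "q k \<in> arcs G" if "k < e" for k using bij_betw_apply[OF q] that by simp
  have p_src: "p (src k) = tail G (q k)" and p_dst: "p (dst k) = head G (q k)" if "k < e" for k
    using vi(2) qa[OF that] unfolding src_def dst_def by simp_all
  show al: "arc_list n e src dst"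
    using vi(1) qa unfolding arc_list_def src_def dst_def by simp
  interpret arc_list n e src dst by (rule al)
  have arcsE: "\<exists>k<e. q k = a" if "a \<in> arcs G" for a
    using q that unfolding bij_betw_def by (metis imageE lessThan_iff)
  have deg: "indeg v = in_degree G (p v)" "outdeg v = out_degree G (p v)" if "v < n" for v
  proof -
    have inj: "inj_on q {k. k < e \<and> P k}" for P
      using q unfolding bij_betw_def by (auto intro: inj_on_subset)
    have "q ` {k. k < e \<and> dst k = v} = in_arcs G (p v)"
    proof (intro set_eqI iffI)
      fix a assume "a \<in> q ` {k. k < e \<and> dst k = v}"
      then show "a \<in> in_arcs G (p v)" using p_dst qa by (auto simp: in_arcs_def)
    next
      fix a assume "a \<in> in_arcs G (p v)"
      then obtain k where "k < e" "q k = a" "head G (q k) = p v" using arcsE by (auto simp: in_arcs_def)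
      then show "a \<in> q ` {k. k < e \<and> dst k = v}" using vip[OF that] unfolding dst_def by auto
    qed
    then show "indeg v = in_degree G (p v)"
      unfolding indeg_def in_degree_def using card_image[OF inj] by metis
    have "q ` {k. k < e \<and> src k = v} = out_arcs G (p v)"
    proof (intro set_eqI iffI)
      fix a assume "a \<in> q ` {k. k < e \<and> src k = v}"
      then show "a \<in> out_arcs G (p v)" using p_src qa by (auto simp: out_arcs_def)
    next
      fix a assume "a \<in> out_arcs G (p v)"
      then obtain k where "k < e" "q k = a" "tail G (q k) = p v" using arcsE by (auto simp: out_arcs_def)
      then show "a \<in> q ` {k. k < e \<and> src k = v}" using vip[OF that] unfolding src_def by auto
    qed
    then show "outdeg v = out_degree G (p v)"
      unfolding outdeg_def out_degree_def using card_image[OF inj] by metis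
  qed
  have verts: "verts G = p ` {..<n}" using p unfolding bij_betw_def by simp
  show max: "max_degree G = Max ((\<lambda>v. indeg v + outdeg v) ` {..<n})"
    unfolding max_degree_def verts image_image using deg by (intro arg_cong[where f = Max] image_cong) auto
  have deg_le: "indeg v + outdeg v \<le> max_degree G" if "v < n" for v
    unfolding max using that by (intro Max_ge) auto
  show conn_le: "n + e \<le> max_degree G * n + 1"
  proof (rule connected_arcs_le[OF deg_le pos])
    fix S assume S: "S \<subseteq> {..<n}" "S \<noteq> {}" and closed: "\<And>k. k < e \<Longrightarrow> src k \<in> S \<longleftrightarrow> dst k \<in> S"
    have mem: "i \<in> S \<longleftrightarrow> p i \<in> p ` S" if "i < n" for i
      using inj_on_image_mem_iff[OF inj_p _ S(1)] that by simp
    have "p ` S = verts G"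
    proof (rule connected_closed_set[OF conn])
      show "p ` S \<subseteq> verts G" using S pv by auto
      fix a assume "a \<in> arcs G"
      then obtain k where k: "k < e" "q k = a" using arcsE by blast
      have "tail G a \<in> p ` S \<longleftrightarrow> src k \<in> S" "head G a \<in> p ` S \<longleftrightarrow> dst k \<in> S"
        using mem[OF src_less[OF k(1)]] mem[OF dst_less[OF k(1)]] p_src[OF k(1)] p_dst[OF k(1)] k(2) by simp_all
      then show "tail G a \<in> p ` S \<longleftrightarrow> head G a \<in> p ` S" using closed[OF k(1)] by simp
    qed (use S in simp)
    then have "{..<n} \<subseteq> S" using mem pv by auto
    then show "S = {..<n}" using S by blast
  qed
  show "exponent \<le> exponent_param G"
    using exponent_le[OF deg_le conn_le] unfolding exponent_param_def n_def e_def by simp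
  have fvs: "feedback_vertex_set G (p ` I) \<longleftrightarrow> acyclic (residual I)" if I: "I \<subseteq> {..<n}" for I
  proof -
    let ?H = "G \<restriction> (verts G - p ` I)"
    have mem: "i \<in> I \<longleftrightarrow> p i \<in> p ` I" if "i < n" for i
      using inj_on_image_mem_iff[OF inj_p _ I] that by simp
    have arc: "(x, y) \<in> arcs_ends ?H \<longleftrightarrow> (\<exists>k<e. x = p (src k) \<and> y = p (dst k) \<and> src k \<notin> I \<and> dst k \<notin> I)" for x y
    proof
      assume "(x, y) \<in> arcs_ends ?H"
      then obtain a where a: "a \<in> arcs G" "x = tail G a" "y = head G a" "x \<notin> p ` I" "y \<notin> p ` I"
        unfolding arcs_ends_conv induce_subgraph_def by auto
      then obtain k where "k < e" "q k = a" using arcsE by blast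
      then show "\<exists>k<e. x = p (src k) \<and> y = p (dst k) \<and> src k \<notin> I \<and> dst k \<notin> I"
        using a p_src p_dst mem src_less dst_less by metis
    next
      assume "\<exists>k<e. x = p (src k) \<and> y = p (dst k) \<and> src k \<notin> I \<and> dst k \<notin> I"
      then obtain k where k: "k < e" "x = p (src k)" "y = p (dst k)" "src k \<notin> I" "dst k \<notin> I" by blast
      then have "q k \<in> arcs ?H"
        using qa[OF k(1)] p_src[OF k(1)] p_dst[OF k(1)] mem[OF src_less[OF k(1)]] mem[OF dst_less[OF k(1)]]
        unfolding induce_subgraph_def by simp
      then show "(x, y) \<in> arcs_ends ?H"
        unfolding arcs_ends_conv using k p_src[OF k(1)] p_dst[OF k(1)]
        by (intro image_eqI[of _ _ "q k"]) (simp_all add: induce_subgraph_def)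
    qed
    have "wf_digraph ?H" by (rule wellformed_induce_subgraph)
    moreover have "p ` I \<subseteq> verts G" using I pv by auto
    \<comment> \<open>The numbering \<open>p\<close> and its inverse are homomorphisms in opposite
      directions, and each reflects acyclicity.\<close>
    moreover have "acyclic (arcs_ends ?H) \<longleftrightarrow> acyclic (residual I)"
    proof
      assume "acyclic (arcs_ends ?H)"
      then show "acyclic (residual I)"
        by (rule acyclic_map[where f = p]) (auto simp: arc residual_def)
    next
      assume "acyclic (residual I)"
      then show "acyclic (arcs_ends ?H)"
      proof (rule acyclic_map[where f = ?vi])
        fix x y assume "(x, y) \<in> arcs_ends ?H"
        then obtain k where "k < e" "x = p (src k)" "y = p (dst k)" "src k \<notin> I" "dst k \<notin> I"
          unfolding arc by blast
        then show "(?vi x, ?vi y) \<in> residual I"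
          using vip src_less dst_less unfolding residual_def by auto
      qed
    qed
    ultimately show ?thesis unfolding feedback_vertex_set_def using cycle_iff_not_acyclic by blast
  qed
  let ?w = "\<lambda>i. if i < n then \<nu> (p i) else 0"
  have weight: "(\<Sum>v\<in>p ` I. \<nu> v) = sum ?w I" if "I \<subseteq> {..<n}" for I
  proof -
    have "inj_on p I" using p that unfolding bij_betw_def by (auto intro: inj_on_subset)
    then have "(\<Sum>v\<in>p ` I. \<nu> v) = (\<Sum>i\<in>I. \<nu> (p i))" by (simp add: sum.reindex)
    also have "\<dots> = sum ?w I" using that by (intro sum.cong) auto
    finally show ?thesis .
  qed
  fix I assume opt: "optimal ?w I"
  then have I: "I \<subseteq> {..<n}" "acyclic (residual I)" unfolding optimal_def by auto
  show "min_feedback_vertex_set G \<nu> (p ` I)"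
    unfolding min_feedback_vertex_set_def
  proof (intro conjI allI impI)
    show "feedback_vertex_set G (p ` I)" using fvs[OF I(1)] I(2) by simp
    fix U assume U: "feedback_vertex_set G U"
    \<comment> \<open>An arbitrary competitor \<open>U\<close> is replaced by its set of indices, to
      which optimality of \<open>I\<close> applies.\<close>
    define J where "J = {i. i < n \<and> p i \<in> U}"
    have "U \<subseteq> p ` J"
    proof
      fix x assume "x \<in> U"
      then have "x \<in> verts G" using U unfolding feedback_vertex_set_def by blast
      then have "?vi x \<in> J" "x = p (?vi x)" using vi[of x] \<open>x \<in> U\<close> unfolding J_def by simp_all
      then show "x \<in> p ` J" by blast
    qed
    then have UJ: "U = p ` J" "J \<subseteq> {..<n}" unfolding J_def by auto
    then have "acyclic (residual J)" using fvs[OF UJ(2)] U by simp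
    then have "sum ?w I \<le> sum ?w J" using opt UJ(2) unfolding optimal_def by blast
    then show "(\<Sum>v\<in>p ` I. \<nu> v) \<le> (\<Sum>v\<in>U. \<nu> v)" using weight[OF I(1)] weight[OF UJ(2)] UJ(1) by simp
  qed
qed

section \<open>Runs on encoded inputs and the asymptotic bounds\<close>

lemma fvs_program_runs:
  assumes inp: "(G, \<nu>, p, q) \<in> fvs_inputs"
  defines "n \<equiv> card (verts G)" and "e \<equiv> card (arcs G)"
  shows "\<exists>t s. runs fvs_program (encode_input (G, \<nu>, p, q)) t s \<and>
    t \<le> 185 * (2 ^ exponent_param G * (n * n * n * (e + 1))) \<and>
    min_feedback_vertex_set G \<nu> (output_vertices G p s)"
proof -
  define src where "src = (\<lambda>k. vertex_index G p (tail G (q k)))"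
  define dst where "dst = (\<lambda>k. vertex_index G p (head G (q k)))"
  note inst = fvs_instance[OF inp, folded n_def e_def src_def dst_def]
  interpret arc_list n e src dst by (rule inst(2))
  let ?w = "\<lambda>i. if i < n then \<nu> (p i) else 0" and ?s = "encode_input (G, \<nu>, p, q)"
  have prob: "fvs_problem G \<nu>" and p: "bij_betw p {..<n} (verts G)"
    using inp unfolding fvs_inputs_def n_def by auto
  have "0 \<le> \<nu> (p v)" if "v < n" for v
    using prob bij_betw_apply[OF p, of v] that unfolding fvs_problem_def by (simp add: less_imp_le)
  then have w: "\<forall>v\<ge>n. ?w v = 0" "\<forall>v. 0 \<le> ?w v" by auto
  have "nats ?s ''verts'' 0 = n" "nats ?s ''arcs'' 0 = e"
    "\<forall>k<e. nats ?s ''tail'' k = src k \<and> nats ?s ''head'' k = dst k"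
    "\<And>x. x \<notin> {''verts'', ''arcs'', ''tail'', ''head''} \<Longrightarrow> nats ?s x = (\<lambda>_. 0)"
    "reals ?s ''weight'' = ?w" "reals ?s ''w'' = (\<lambda>_. 0)"
    by (simp_all add: n_def e_def src_def dst_def)
  from fvs_program_wp[OF inst(1) this w] obtain t s where
    t: "runs fvs_program ?s t s" "t \<le> 185 * (2 ^ exponent * (n * n * n * (e + 1)))"
      "optimal ?w {v. v < n \<and> nats s ''out'' v \<noteq> 0}"
    unfolding wp_def by blast
  have "(2::nat) ^ exponent \<le> 2 ^ exponent_param G" using inst(5) by simp
  then have "185 * (2 ^ exponent * (n * n * n * (e + 1))) \<le> 185 * (2 ^ exponent_param G * (n * n * n * (e + 1)))"
    by (intro mult_le_mono) simp_all
  moreover have "min_feedback_vertex_set G \<nu> (output_vertices G p s)"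
    using inst(6)[OF t(3)] unfolding output_vertices_def n_def .
  ultimately show ?thesis using t by (meson le_trans)
qed

lemma param_program_runs:
  assumes inp: "(G, \<nu>, p, q) \<in> fvs_inputs"
  defines "n \<equiv> card (verts G)" and "e \<equiv> card (arcs G)"
  shows "\<exists>t s. runs param_program (encode_input (G, \<nu>, p, q)) t s \<and>
    t \<le> 4 * e + 9 * n + 7 \<and> output_number s = exponent_param G"
proof -
  define src where "src = (\<lambda>k. vertex_index G p (tail G (q k)))"
  define dst where "dst = (\<lambda>k. vertex_index G p (head G (q k)))"
  note inst = fvs_instance[OF inp, folded n_def e_def src_def dst_def]
  interpret arc_list n e src dst by (rule inst(2))
  let ?s = "encode_input (G, \<nu>, p, q)"
  have "nats ?s ''verts'' 0 = n" "nats ?s ''arcs'' 0 = e"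
    "\<forall>k<e. nats ?s ''tail'' k = src k \<and> nats ?s ''head'' k = dst k"
    "\<And>x. x \<notin> {''verts'', ''arcs'', ''tail'', ''head''} \<Longrightarrow> nats ?s x = (\<lambda>_. 0)"
    by (simp_all add: n_def e_def src_def dst_def)
  from param_program_wp[OF inst(1) this] show ?thesis
    unfolding wp_def output_number_def exponent_param_def inst(3) n_def e_def by blast
qed

lemma exponent_param_eq:
  assumes inp: "(G, \<nu>, p, q) \<in> fvs_inputs"
  shows "int (exponent_param G) =
    (int (max_degree G) - 1) * int (card (verts G)) - int (card (arcs G)) + 1"
  using fvs_instance(4)[OF inp] unfolding exponent_param_def
  by (simp add: of_nat_diff algebra_simps)

text \<open>The bound on the parameter is claimed for graphs without numberings, whereas
  \<open>exponent_param_eq\<close> speaks about inputs.\<close>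

lemma fvs_inputs_exist:
  assumes "fvs_problem G \<nu>"
  shows "\<exists>p q. (G, \<nu>, p, q) \<in> fvs_inputs"
proof -
  interpret fin_digraph G using assms unfolding fvs_problem_def by simp
  obtain p where "bij_betw p {0..<card (verts G)} (verts G)"
    using ex_bij_betw_nat_finite[OF finite_verts] by blast
  moreover obtain q where "bij_betw q {0..<card (arcs G)} (arcs G)"
    using ex_bij_betw_nat_finite[OF finite_arcs] by blast
  ultimately show ?thesis using assms unfolding fvs_inputs_def lessThan_atLeast0 by blast
qed

text \<open>The in-degrees sum to the number of arcs, which is therefore at most the maximal degree
  times the number of vertices. The factor 2 absorbs the \<open>+ 1\<close>, as there is an
  arc.\<close>

lemma arcs_bounds:
  assumes inp: "(G, \<nu>, p, q) \<in> fvs_inputs" and "1 \<le> card (arcs G)"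
  shows "1 \<le> card (verts G)" "card (arcs G) + 1 \<le> 2 * (max_degree G * card (verts G))" "1 \<le> max_degree G"
proof -
  show n: "1 \<le> card (verts G)" using fvs_instance(1)[OF inp] by simp
  interpret arc_list "card (verts G)" "card (arcs G)" "\<lambda>k. vertex_index G p (tail G (q k))"
      "\<lambda>k. vertex_index G p (head G (q k))"
    by (rule fvs_instance(2)[OF inp])
  have "card (arcs G) = (\<Sum>v<card (verts G). indeg v)" using sum_degrees by simp
  also have "\<dots> \<le> (\<Sum>v<card (verts G). max_degree G)"
  proof (rule sum_mono)
    fix v assume "v \<in> {..<card (verts G)}"
    then have "indeg v + outdeg v \<le> max_degree G"
      unfolding fvs_instance(3)[OF inp] by (intro Max_ge) auto
    then show "indeg v \<le> max_degree G" by simp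
  qed
  finally have le: "card (arcs G) \<le> max_degree G * card (verts G)" by (simp add: mult.commute)
  then show "card (arcs G) + 1 \<le> 2 * (max_degree G * card (verts G))" using assms(2) by simp
  show "1 \<le> max_degree G" using le assms(2) by (cases "max_degree G") auto
qed

text \<open>Determinism of \<open>runs\<close> makes the step count a function of the input, as
  required for the Landau statements.\<close>

definition run_time :: "program \<Rightarrow> ('a, 'b) fvs_input \<Rightarrow> nat" where
  "run_time P I = (THE t. \<exists>s. runs P (encode_input I) t s)"

lemma run_time_eq: "runs P (encode_input I) t s \<Longrightarrow> run_time P I = t"
  unfolding run_time_def by (rule the_equality) (use runs_deterministic in blast)+

theorem theorem5:
  shows "\<exists>(m :: ('a, 'b) pre_digraph \<Rightarrow> ('a \<Rightarrow> real) \<Rightarrow> nat)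
      (param_prog :: program) (param_time :: ('a, 'b) fvs_input \<Rightarrow> nat)
      (fvs_prog :: program) (fvs_time :: ('a, 'b) fvs_input \<Rightarrow> nat).
    (\<forall>G \<nu>. fvs_problem G \<nu> \<longrightarrow>
       int (m G \<nu>) \<le> (int (max_degree G) - 1) * int (card (verts G)) - int (card (arcs G)) + 1) \<and>
    (\<forall>(G, \<nu>, p, q) \<in> fvs_inputs.
       \<exists>s. runs param_prog (encode_input (G, \<nu>, p, q)) (param_time (G, \<nu>, p, q)) s \<and>
           output_number s = m G \<nu>) \<and>
    (\<lambda>I. real (param_time I)) \<in> O[principal (fvs_inputs_arcs_ge 1)](\<lambda>(G, \<nu>, p, q). real (max_degree G) ^ 3 * real (card (verts G)) ^ 3) \<and>
    (\<forall>(G, \<nu>, p, q) \<in> fvs_inputs.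
       \<exists>s. runs fvs_prog (encode_input (G, \<nu>, p, q)) (fvs_time (G, \<nu>, p, q)) s \<and>
           min_feedback_vertex_set G \<nu> (output_vertices G p s)) \<and>
    (\<lambda>I. real (fvs_time I)) \<in> O[principal (fvs_inputs_arcs_ge 2)](\<lambda>(G, \<nu>, p, q). 2 ^ m G \<nu> * real (max_degree G) ^ 4 * real (card (verts G)) ^ 4 *
                        log 2 (real (card (arcs G))))"
proof (rule exI[of _ "\<lambda>G _. exponent_param G"], rule exI[of _ param_program],
    rule exI[of _ "run_time param_program"], rule exI[of _ fvs_program],
    rule exI[of _ "run_time fvs_program"], intro conjI)
  show "\<forall>(G :: ('a, 'b) pre_digraph) \<nu>. fvs_problem G \<nu> \<longrightarrow>
      int (exponent_param G) \<le> (int (max_degree G) - 1) * int (card (verts G)) - int (card (arcs G)) + 1"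
    using fvs_inputs_exist exponent_param_eq by (metis order_refl)
  show "\<forall>(G, \<nu>, p, q) \<in> (fvs_inputs :: ('a, 'b) fvs_input set).
      \<exists>s. runs param_program (encode_input (G, \<nu>, p, q)) (run_time param_program (G, \<nu>, p, q)) s \<and>
        output_number s = exponent_param G"
    using param_program_runs run_time_eq by fastforce
  show "\<forall>(G, \<nu>, p, q) \<in> (fvs_inputs :: ('a, 'b) fvs_input set).
      \<exists>s. runs fvs_program (encode_input (G, \<nu>, p, q)) (run_time fvs_program (G, \<nu>, p, q)) s \<and>
        min_feedback_vertex_set G \<nu> (output_vertices G p s)"
    using fvs_program_runs run_time_eq by fastforce
  show "(\<lambda>I :: ('a, 'b) fvs_input. real (run_time param_program I)) \<in> O[principal (fvs_inputs_arcs_ge 1)](\<lambda>(G, \<nu>, p, q). real (max_degree G) ^ 3 * real (card (verts G)) ^ 3)"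
  \<comment> \<open>From \<open>4 * e + 9 * n + 7\<close> with \<open>e + 1 \<le> 2 * N\<close> and
    \<open>n \<le> N\<close>: 8 + 9 + 7 = 24.\<close>
  proof (rule bigoI[where c = 24], unfold eventually_principal, safe)
    fix G :: "('a, 'b) pre_digraph" and \<nu> p q
    assume "(G, \<nu>, p, q) \<in> fvs_inputs_arcs_ge 1"
    then have inp: "(G, \<nu>, p, q) \<in> fvs_inputs" and e: "1 \<le> card (arcs G)"
      unfolding fvs_inputs_arcs_ge_def by auto
    note b = arcs_bounds[OF inp e]
    let ?N = "max_degree G * card (verts G)"
    have "1 * card (verts G) \<le> ?N" using b(3) by (intro mult_le_mono1)
    then have N: "card (verts G) \<le> ?N" by simp
    then have "1 \<le> ?N" using b(1) by linarith
    then have N3: "?N ^ 1 \<le> ?N ^ 3" by (intro power_increasing) auto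
    obtain t s where t: "runs param_program (encode_input (G, \<nu>, p, q)) t s"
        "t \<le> 4 * card (arcs G) + 9 * card (verts G) + 7"
      using param_program_runs[OF inp] by blast
    have "t \<le> 24 * ?N" using t(2) b(2) N \<open>1 \<le> ?N\<close> by linarith
    also have "\<dots> \<le> 24 * ?N ^ 3" using N3 by (simp only: power_one_right mult_le_mono2)
    finally have "t \<le> 24 * ?N ^ 3" .
    then have "real t \<le> real (24 * ?N ^ 3)" by (simp only: of_nat_le_iff)
    then show "norm (real (run_time param_program (G, \<nu>, p, q))) \<le>
        24 * norm (real (max_degree G) ^ 3 * real (card (verts G)) ^ 3)"
      unfolding run_time_eq[OF t(1)] by (simp add: power_mult_distrib)
  qed
  show "(\<lambda>I :: ('a, 'b) fvs_input. real (run_time fvs_program I)) \<in> O[principal (fvs_inputs_arcs_ge 2)](\<lambda>(G, \<nu>, p, q). 2 ^ exponent_param G * real (max_degree G) ^ 4 * real (card (verts G)) ^ 4 *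
        log 2 (real (card (arcs G))))"
  \<comment> \<open>Replacing \<open>e + 1\<close> by twice the product of maximal degree and vertex
    number doubles 185 and supplies the fourth factor \<open>n\<close>.\<close>
  proof (rule bigoI[where c = 370], unfold eventually_principal, safe)
    fix G :: "('a, 'b) pre_digraph" and \<nu> p q
    assume "(G, \<nu>, p, q) \<in> fvs_inputs_arcs_ge 2"
    then have inp: "(G, \<nu>, p, q) \<in> fvs_inputs" and e: "2 \<le> card (arcs G)"
      unfolding fvs_inputs_arcs_ge_def by auto
    then have b: "1 \<le> card (verts G)" "card (arcs G) + 1 \<le> 2 * (max_degree G * card (verts G))" "1 \<le> max_degree G"
      using arcs_bounds[OF inp] by simp_all
    let ?n = "card (verts G)" and ?\<Delta> = "max_degree G" and ?P = "2 ^ exponent_param G :: nat"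
    obtain t s where t: "runs fvs_program (encode_input (G, \<nu>, p, q)) t s"
        "t \<le> 185 * (?P * (?n * ?n * ?n * (card (arcs G) + 1)))"
      using fvs_program_runs[OF inp] by blast
    note t(2)
    also have "185 * (?P * (?n * ?n * ?n * (card (arcs G) + 1))) \<le> 185 * (?P * (?n * ?n * ?n * (2 * (?\<Delta> * ?n))))"
      using b(2) by (intro mult_le_mono order_refl)
    also have "\<dots> = 370 * (?P * ?\<Delta> ^ 1 * ?n ^ 4)" by (simp add: power4_eq_xxxx)
    also have "\<dots> \<le> 370 * (?P * ?\<Delta> ^ 4 * ?n ^ 4)"
      using b(3) by (intro mult_le_mono order_refl power_increasing) auto
    finally have "real t \<le> real (370 * (?P * ?\<Delta> ^ 4 * ?n ^ 4))" by (simp only: of_nat_le_iff)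
    also have "\<dots> = 370 * (2 ^ exponent_param G * real ?\<Delta> ^ 4 * real ?n ^ 4) * 1" by simp
    \<comment> \<open>With at least two arcs the logarithm is at least 1; for a single arc it would
      be 0.\<close>
    also have "\<dots> \<le> 370 * (2 ^ exponent_param G * real ?\<Delta> ^ 4 * real ?n ^ 4) * log 2 (real (card (arcs G)))"
      using e by (intro mult_left_mono) (simp_all add: le_log_iff)
    finally have "real t \<le> 370 * (2 ^ exponent_param G * real ?\<Delta> ^ 4 * real ?n ^ 4 * log 2 (real (card (arcs G))))"
      by (simp add: mult.assoc)
    moreover have "0 \<le> 2 ^ exponent_param G * real ?\<Delta> ^ 4 * real ?n ^ 4 * log 2 (real (card (arcs G)))"
      using e by simp
    ultimately show "norm (real (run_time fvs_program (G, \<nu>, p, q))) \<le> 370 *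
        norm (2 ^ exponent_param G * real ?\<Delta> ^ 4 * real ?n ^ 4 * log 2 (real (card (arcs G))))"
      unfolding run_time_eq[OF t(1)] by simp
  qed
qed

end
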